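(* Let $G$ be a residually finite group, let $(G_n)$ be a decreasing sequence of finite-index normal subgroups of $G$ with trivial intersection, and let $\Sigma=(\sigma_n:G\to\mathrm{Sym}(G_n\backslash G))$ be the associated sofic approximation. Let $K$ be a finite group, let $X\subseteq K^G$ be an algebraic subshift of finite type, and let $\lambda_X$ be the Haar probability measure on $X$. If $\mathrm{Fix}_{G_n}(X)$ converges to $X$ in the Hausdorff metric and $\lambda_X$ is ergodic, then $$h^\Sigma_{\mathrm{meas}}(G\curvearrowright X,\lambda_X)=h^\Sigma_{\mathrm{top}}(G\curvearrowright X)=\limsup_{n\to\infty}\frac1{|G:G_n|}\cdot\log\bigl|\mathrm{Fix}_{G_n}(X)\bigr|,$$ where $\mathrm{Fix}_{G_n}(X)=\{x\in X:g\cdot x=x\ \forall g\in G_n\}$.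
   Context: Associated sofic approximation: $D_n=G_n\backslash G=\{G_nu:u\in G\}$ and $\sigma_n(g)(G_nu)=G_nug^{-1}$. (In general, a sofic approximation is a sequence of maps $\sigma_n:G\to\mathrm{Sym}(D_n)$ with $D_n$ finite that is asymptotically free and asymptotically an action.) $G$ is countable. Subshifts: $K^G$ has the product topology ($K$ discrete), pointwise group structure, and $G$-action $(g\cdot x)(h)=x(g^{-1}h)$. A subshift is a closed $G$-invariant subset $X\subseteq K^G$; it is algebraic if it is also a subgroup. With $\alpha:K^G\to K$, $\alpha(x)=x(1_G)$, it is of finite type if there are a finite $W\subseteq G$ and $P\subseteq K^W$ such that $X=\{x\in K^G:\forall g\in G\ \exists p\in P\ \forall w\in W\ \alpha(wg\cdot x)=p(w)\}$. The Hausdorff metric is taken on closed subsets of $K^G$ with respect to any compatible metric. Topological sofic entropy: Let $G\curvearrowright X$ be a continuous action on a compact metrizable space. Let $\rho$ be a continuous pseudo-metric on $X$ that is generating (for $x\ne y$ there is $g\in G$ with $\rho(g\cdot x,g\cdot y)>0$). For $\phi,\phi':D_n\to X$ let $\rho_2(\phi,\phi')=\bigl(\frac1{|D_n|}\sum_{i}\rho(\phi(i),\phi'(i))^2\bigr)^{1/2}$ and $\rho_\infty(\phi,\phi')=\max_i\rho(\phi(i),\phi'(i))$. For finite $F\subseteq G$, $\delta>0$ let $\mathrm{Map}(\rho,F,\delta,\sigma_n)=\{\phi:D_n\to X:\rho_2(\phi\circ\sigma_n(f),f\cdot\phi)<\delta\ \forall f\in F\}$, and let $N_\kappa(\cdot,\rho_\infty)$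 be the maximum cardinality of a subset whose distinct elements satisfy $\rho_\infty(\phi,\phi')\ge\kappa$. Then $$h^\Sigma_{\mathrm{top}}(G\curvearrowright X)=\sup_{\kappa>0}\inf_{\delta>0}\inf_{F}\limsup_{n\to\infty}\frac1{|D_n|}\log N_\kappa(\mathrm{Map}(\rho,F,\delta,\sigma_n),\rho_\infty)$$ ($F$ ranging over finite subsets of $G$, $\log 0=-\infty$); this is independent of $\rho$. Measured sofic entropy: Let $G\curvearrowright(X,\mu)$ be a probability-measure-preserving action on a standard probability space. For a Borel $\alpha:X\to A$ with $A$ finite, $F\subseteq G$ finite, $\epsilon>0$, let $\mathcal{M}_\mu(\alpha,F,\epsilon,\sigma_n)$ be the set of $a\in A^{D_n}$ such that for every $p\in A^F$, $\bigl|\mu(\{x:\alpha(f\cdot x)=p(f)\ \forall f\in F\})-\frac1{|D_n|}|\{i\in D_n:a(\sigma_n(f)(i))=p(f)\ \forall f\in F\}|\bigr|\le\epsilon$. For finite-valued Borel $\alpha:X\to A$, $\beta:X\to B$ write $\alpha\ge\beta$ if $\beta=\beta_\alpha\circ\alpha$ for some $\beta_\alpha:A\to B$. Then $$h^\Sigma_{\mathrm{meas}}(G\curvearrowright X,\mu)=\sup_\beta\inf_{\alpha\ge\beta}\inf_{\epsilon>0}\inf_{F}\limsup_{n\to\infty}\frac1{|D_n|}\log\bigl|\{\beta_\alpha\circ a:a\in\mathcal{M}_\mu(\alpha,F,\epsilon,\sigma_n)\}\bigr|,$$ with $\alpha,\beta$ ranging over finite-valued Borel functions on $X$. *)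

theory Defs
  imports
    "HOL-Analysis.Analysis"
    "HOL-Algebra.Coset"
    "HOL-Algebra.Product_Groups"
    "HOL-Library.Extended_Nat"
begin

section \<open>Residual finiteness and the coset sofic approximation\<close>

definition residually_finite :: "('g, 'm) monoid_scheme \<Rightarrow> bool" where
  "residually_finite G \<longleftrightarrow>
     (\<forall>g\<in>carrier G - {\<one>\<^bsub>G\<^esub>}. \<exists>N. N \<lhd> G \<and> finite (rcosets\<^bsub>G\<^esub> N) \<and> g \<notin> N)"

text \<open>
  For a coset \<open>C = N #> u\<close> this is \<open>N #> (u \<otimes> inv g)\<close>, so \<open>coset_sofic G g\<close> permutes
  \<open>rcosets N\<close> for every subgroup \<open>N\<close>.
\<close>
definition coset_sofic :: "('g, 'm) monoid_scheme \<Rightarrow> 'g \<Rightarrow> 'g set \<Rightarrow> 'g set" where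
  "coset_sofic G g C = C #>\<^bsub>G\<^esub> inv\<^bsub>G\<^esub> g"


section \<open>Subshifts of \<open>K^G\<close>\<close>

text \<open>
  Points of \<open>K^G\<close> are extensional functions on \<open>carrier G\<close>; the group structure is the pointwise one.
\<close>
definition full_shift ::
    "('g, 'm) monoid_scheme \<Rightarrow> ('k, 'l) monoid_scheme \<Rightarrow> ('g \<Rightarrow> 'k) monoid" where
  "full_shift G K = product_group (carrier G) (\<lambda>_. K)"

definition full_shift_top ::
    "('g, 'm) monoid_scheme \<Rightarrow> ('k, 'l) monoid_scheme \<Rightarrow> ('g \<Rightarrow> 'k) topology" where
  "full_shift_top G K = product_topology (\<lambda>_. discrete_topology (carrier K)) (carrier G)"

definition shift :: "('g, 'm) monoid_scheme \<Rightarrow> 'g \<Rightarrow> ('g \<Rightarrow> 'k) \<Rightarrow> 'g \<Rightarrow> 'k" where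
  "shift G g x = (\<lambda>h\<in>carrier G. x (inv\<^bsub>G\<^esub> g \<otimes>\<^bsub>G\<^esub> h))"

definition subshift ::
    "('g, 'm) monoid_scheme \<Rightarrow> ('k, 'l) monoid_scheme \<Rightarrow> ('g \<Rightarrow> 'k) set \<Rightarrow> bool" where
  "subshift G K X \<longleftrightarrow>
     closedin (full_shift_top G K) X \<and> (\<forall>g\<in>carrier G. \<forall>x\<in>X. shift G g x \<in> X)"

definition algebraic_subshift ::
    "('g, 'm) monoid_scheme \<Rightarrow> ('k, 'l) monoid_scheme \<Rightarrow> ('g \<Rightarrow> 'k) set \<Rightarrow> bool" where
  "algebraic_subshift G K X \<longleftrightarrow> subshift G K X \<and> subgroup X (full_shift G K)"

definition finite_type ::
    "('g, 'm) monoid_scheme \<Rightarrow> ('k, 'l) monoid_scheme \<Rightarrow> ('g \<Rightarrow> 'k) set \<Rightarrow> bool" where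
  "finite_type G K X \<longleftrightarrow>
     (\<exists>W P. finite W \<and> W \<subseteq> carrier G \<and> P \<subseteq> (W \<rightarrow>\<^sub>E carrier K) \<and>
        X = {x \<in> carrier (full_shift G K).
              \<forall>g\<in>carrier G. \<exists>p\<in>P. \<forall>w\<in>W. shift G (w \<otimes>\<^bsub>G\<^esub> g) x \<one>\<^bsub>G\<^esub> = p w})"

definition fixed_points ::
    "('g, 'm) monoid_scheme \<Rightarrow> 'g set \<Rightarrow> ('g \<Rightarrow> 'k) set \<Rightarrow> ('g \<Rightarrow> 'k) set" where
  "fixed_points G H X = {x \<in> X. \<forall>g\<in>H. shift G g x = x}"

text \<open>
  Being Borel probability measures on a compact metrizable group, the measures described here
  need no separate regularity condition.
\<close>
definition haar_probability ::
    "('g, 'm) monoid_scheme \<Rightarrow> ('k, 'l) monoid_scheme \<Rightarrow> ('g \<Rightarrow> 'k) set \<Rightarrow>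
     ('g \<Rightarrow> 'k) measure \<Rightarrow> bool" where
  "haar_probability G K X \<mu> \<longleftrightarrow>
     space \<mu> = X \<and>
     sets \<mu> = sigma_sets X {U. openin (subtopology (full_shift_top G K) X) U} \<and>
     emeasure \<mu> X = 1 \<and>
     (\<forall>y\<in>X. \<forall>A\<in>sets \<mu>. emeasure \<mu> (y <#\<^bsub>full_shift G K\<^esub> A) = emeasure \<mu> A)"

definition ergodic_action ::
    "('g, 'm) monoid_scheme \<Rightarrow> ('g \<Rightarrow> 'x \<Rightarrow> 'x) \<Rightarrow> 'x measure \<Rightarrow> bool" where
  "ergodic_action G act \<mu> \<longleftrightarrow>
     (\<forall>A\<in>sets \<mu>. (\<forall>g\<in>carrier G. act g ` A = A) \<longrightarrow> emeasure \<mu> A = 0 \<or> emeasure \<mu> (space \<mu> - A) = 0)"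


section \<open>Hausdorff metric\<close>

text \<open>Meaningful for nonempty \<open>d\<close>-bounded sets, where all suprema and infima are over
  nonempty bounded sets of reals.\<close>
definition hausdorff_dist :: "('x \<Rightarrow> 'x \<Rightarrow> real) \<Rightarrow> 'x set \<Rightarrow> 'x set \<Rightarrow> real" where
  "hausdorff_dist d A B = max (SUP a\<in>A. INF b\<in>B. d a b) (SUP b\<in>B. INF a\<in>A. d a b)"


section \<open>Topological sofic entropy\<close>

text \<open>Logarithm of a cardinality, with \<open>log 0 = -\<infinity>\<close>.\<close>
definition log_card :: "enat \<Rightarrow> ereal" where
  "log_card c = (case c of enat n \<Rightarrow> if n = 0 then -\<infinity> else ereal (ln (real n)) | \<infinity> \<Rightarrow> \<infinity>)"

definition continuous_generating_pseudometric ::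
    "('g, 'm) monoid_scheme \<Rightarrow> ('g \<Rightarrow> 'x \<Rightarrow> 'x) \<Rightarrow> 'x topology \<Rightarrow> ('x \<Rightarrow> 'x \<Rightarrow> real) \<Rightarrow> bool" where
  "continuous_generating_pseudometric G act T \<rho> \<longleftrightarrow>
     (\<forall>x\<in>topspace T. \<forall>y\<in>topspace T. 0 \<le> \<rho> x y) \<and>
     (\<forall>x\<in>topspace T. \<rho> x x = 0) \<and>
     (\<forall>x\<in>topspace T. \<forall>y\<in>topspace T. \<rho> x y = \<rho> y x) \<and>
     (\<forall>x\<in>topspace T. \<forall>y\<in>topspace T. \<forall>z\<in>topspace T. \<rho> x z \<le> \<rho> x y + \<rho> y z) \<and>
     continuous_map (prod_topology T T) euclideanreal (\<lambda>(x, y). \<rho> x y) \<and>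
     (\<forall>x\<in>topspace T. \<forall>y\<in>topspace T. x \<noteq> y \<longrightarrow> (\<exists>g\<in>carrier G. 0 < \<rho> (act g x) (act g y)))"

definition rho_2 ::
    "('x \<Rightarrow> 'x \<Rightarrow> real) \<Rightarrow> 'd set \<Rightarrow> ('d \<Rightarrow> 'x) \<Rightarrow> ('d \<Rightarrow> 'x) \<Rightarrow> real" where
  "rho_2 \<rho> D \<phi> \<psi> = sqrt ((\<Sum>i\<in>D. (\<rho> (\<phi> i) (\<psi> i))\<^sup>2) / real (card D))"

definition rho_inf ::
    "('x \<Rightarrow> 'x \<Rightarrow> real) \<Rightarrow> 'd set \<Rightarrow> ('d \<Rightarrow> 'x) \<Rightarrow> ('d \<Rightarrow> 'x) \<Rightarrow> real" where
  "rho_inf \<rho> D \<phi> \<psi> = Max ((\<lambda>i. \<rho> (\<phi> i) (\<psi> i)) ` D)"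

definition top_microstates ::
    "('g \<Rightarrow> 'x \<Rightarrow> 'x) \<Rightarrow> 'x set \<Rightarrow> ('x \<Rightarrow> 'x \<Rightarrow> real) \<Rightarrow> 'g set \<Rightarrow> real \<Rightarrow>
     'd set \<Rightarrow> ('g \<Rightarrow> 'd \<Rightarrow> 'd) \<Rightarrow> ('d \<Rightarrow> 'x) set" where
  "top_microstates act X \<rho> F \<delta> D s =
     {\<phi> \<in> D \<rightarrow>\<^sub>E X. \<forall>f\<in>F. rho_2 \<rho> D (\<lambda>i. \<phi> (s f i)) (\<lambda>i. act f (\<phi> i)) < \<delta>}"

definition max_separated ::
    "('y \<Rightarrow> 'y \<Rightarrow> real) \<Rightarrow> real \<Rightarrow> 'y set \<Rightarrow> enat" where
  "max_separated d \<kappa> M =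
     (SUP S\<in>{S. S \<subseteq> M \<and> finite S \<and> (\<forall>\<phi>\<in>S. \<forall>\<psi>\<in>S. \<phi> \<noteq> \<psi> \<longrightarrow> \<kappa> \<le> d \<phi> \<psi>)}. enat (card S))"

definition top_sofic_entropy ::
    "('g, 'm) monoid_scheme \<Rightarrow> ('g \<Rightarrow> 'x \<Rightarrow> 'x) \<Rightarrow> 'x set \<Rightarrow> ('x \<Rightarrow> 'x \<Rightarrow> real) \<Rightarrow>
     (nat \<Rightarrow> 'd set) \<Rightarrow> (nat \<Rightarrow> 'g \<Rightarrow> 'd \<Rightarrow> 'd) \<Rightarrow> ereal" where
  "top_sofic_entropy G act X \<rho> D \<sigma> =
     (SUP \<kappa>\<in>{0<..}. INF \<delta>\<in>{0<..}. INF F\<in>{F. finite F \<and> F \<subseteq> carrier G}.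
        limsup (\<lambda>n. log_card (max_separated (rho_inf \<rho> (D n)) \<kappa>
                                (top_microstates act X \<rho> F \<delta> (D n) (\<sigma> n)))
                    / ereal (real (card (D n)))))"


section \<open>Measured sofic entropy\<close>

definition meas_microstates ::
    "('g \<Rightarrow> 'x \<Rightarrow> 'x) \<Rightarrow> 'x measure \<Rightarrow> 'a set \<Rightarrow> ('x \<Rightarrow> 'a) \<Rightarrow> 'g set \<Rightarrow> real \<Rightarrow>
     'd set \<Rightarrow> ('g \<Rightarrow> 'd \<Rightarrow> 'd) \<Rightarrow> ('d \<Rightarrow> 'a) set" where
  "meas_microstates act \<mu> A \<alpha> F \<epsilon> D s =
     {a \<in> D \<rightarrow>\<^sub>E A. \<forall>p \<in> F \<rightarrow>\<^sub>E A.
        \<bar>measure \<mu> {x \<in> space \<mu>. \<forall>f\<in>F. \<alpha> (act f x) = p f}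
          - real (card {i \<in> D. \<forall>f\<in>F. a (s f i) = p f}) / real (card D)\<bar> \<le> \<epsilon>}"

text \<open>
  Up to a bijection of the alphabet, a finite-valued function takes values in a finite set of
  natural numbers. The refinements \<open>\<alpha> : X \<rightarrow> A\<close> of \<open>\<beta>\<close> are listed together with the
  alphabet \<open>A\<close> and a map \<open>\<theta> : A \<rightarrow> B\<close> satisfying \<open>\<beta> = \<theta> \<circ> \<alpha>\<close>, since \<open>\<theta>\<close> is not determined
  outside the range of \<open>\<alpha>\<close>. Shrinking \<open>A\<close> to that range only shrinks the set that is counted,
  so the infimum may be restricted to surjective \<open>\<alpha>\<close>, for which \<open>\<theta>\<close> is unique.
\<close>
definition finite_refinements ::
    "'x measure \<Rightarrow> nat set \<Rightarrow> ('x \<Rightarrow> nat) \<Rightarrow> (nat set \<times> ('x \<Rightarrow> nat) \<times> (nat \<Rightarrow> nat)) set" where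
  "finite_refinements \<mu> B \<beta> =
     {(A, \<alpha>, \<theta>). finite A \<and> \<alpha> \<in> measurable \<mu> (count_space A) \<and> \<theta> \<in> A \<rightarrow> B \<and>
                 (\<forall>x\<in>space \<mu>. \<beta> x = \<theta> (\<alpha> x))}"

definition meas_sofic_entropy ::
    "('g, 'm) monoid_scheme \<Rightarrow> ('g \<Rightarrow> 'x \<Rightarrow> 'x) \<Rightarrow> 'x measure \<Rightarrow>
     (nat \<Rightarrow> 'd set) \<Rightarrow> (nat \<Rightarrow> 'g \<Rightarrow> 'd \<Rightarrow> 'd) \<Rightarrow> ereal" where
  "meas_sofic_entropy G act \<mu> D \<sigma> =
     (SUP (B, \<beta>)\<in>{(B, \<beta>). finite B \<and> \<beta> \<in> measurable \<mu> (count_space B)}.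
      INF (A, \<alpha>, \<theta>)\<in>finite_refinements \<mu> B \<beta>.
      INF \<epsilon>\<in>{0<..}. INF F\<in>{F. finite F \<and> F \<subseteq> carrier G}.
        limsup (\<lambda>n. log_card (enat (card (compose (D n) \<theta> `
                                meas_microstates act \<mu> A \<alpha> F \<epsilon> (D n) (\<sigma> n))))
                    / ereal (real (card (D n)))))"

end

theory Submission
  imports Defs
begin

text \<open>
  Let \<open>H\<close> be a normal subgroup of finite index and \<open>D\<close> the set of its cosets. Following the orbit of a
  coset turns a configuration \<open>a : D \<rightarrow> K\<close> into a point of \<open>K^G\<close> for each \<open>i \<in> D\<close>, and the points of \<open>X\<close>
  fixed by \<open>H\<close> are the configurations all of whose pullbacks lie in \<open>X\<close> (\<open>bij_pullback\<close>). Both entropies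
  count maps on \<open>D\<close> that behave almost like such periodic configurations, so both are compared with
  the growth rate of \<open>card (fixed_points G (N n) X)\<close>.

  Upper bounds. Up to a small proportion of positions, a microstate of either kind is a configuration
  that shows only patterns of \<open>X\<close> in a fixed window. As \<open>X\<close> is a group of finite type, configurations
  that are legal off a set \<open>B\<close> of positions form a group, in which the periodic configurations have
  index at most exponential in \<open>card B\<close> (\<open>card_legal_off\<close>). There are few small sets \<open>B\<close>, and the remaining
  data of a microstate is determined off \<open>B\<close> by the configuration, so the number of microstates exceeds
  the number of fixed points only by a factor of arbitrarily small exponential rate (\<open>coded_bound\<close>,
  \<open>small_defect_rate\<close>). For topological microstates this uses compactness to replace the pseudometric by
  finite windows; for measured ones it uses the approximation of Borel partitions by partitions
  with a finite window.

  Lower bounds. The orbit maps of distinct fixed points are exact topological microstates which a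
  generating pseudometric separates uniformly (\<open>max_separated_ge_fixed\<close>). For the measured entropy, take
  the partition by the identity coordinate. The name of a fixed point under it is the periodic
  configuration itself, so it suffices that most fixed points have orbits that are almost
  equidistributed for Haar measure on any prescribed window, which is shown by a variance estimate
  (\<open>visit_frequency_variance\<close>). Hausdorff convergence makes the fixed points realise all patterns of \<open>X\<close> on
  any given window, and a subgroup doing so is exactly Haar distributed there. The variance of an
  average of \<open>k\<close> independent translates of an event is at most \<open>1 / k\<close>, so what is needed is a supply of
  independent translates of a window \<open>E\<close> (\<open>independent_translates\<close>). Two windows are independent when the
  product of the corresponding kernels is all of \<open>X\<close>. If this fails for the windows \<open>f E\<close> and \<open>g E\<close>, the
  product is a translate by \<open>f\<close>, and also a translate by \<open>g\<close>, of one of the finitely many proper clopen sets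
  that contain the identity and depend on \<open>E\<close> only. Ergodicity forces all such sets to have infinite
  orbits under \<open>G\<close>, and a finite family in an action with infinite orbits can be moved off any finite set
  (\<open>neumann_separation\<close>).
\<close>

section \<open>Separating finite sets in an action with infinite orbits\<close>

text \<open>This is P. M. Neumann's separation lemma, proved along the lines of B. H. Neumann's theorem on coverings
  of a group by cosets. The failing group elements form a finite union of left cosets of
  stabilisers; if one stabiliser has infinite index, its cosets can be eliminated from the
  covering one point of \<open>\<Gamma>\<close> at a time, at the price of enlarging \<open>\<Delta>\<close>.\<close>
lemma (in group) neumann_separation:
  fixes act :: "'a \<Rightarrow> 'w \<Rightarrow> 'w"
  assumes mult: "\<And>g h w. \<lbrakk>g \<in> carrier G; h \<in> carrier G; w \<in> \<Omega>\<rbrakk> \<Longrightarrow> act (g \<otimes> h) w = act g (act h w)"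
    and unit: "\<And>w. w \<in> \<Omega> \<Longrightarrow> act \<one> w = w"
    and closed: "\<And>g w. \<lbrakk>g \<in> carrier G; w \<in> \<Omega>\<rbrakk> \<Longrightarrow> act g w \<in> \<Omega>"
    and orbits: "\<And>w. w \<in> \<Omega> \<Longrightarrow> infinite ((\<lambda>g. act g w) ` carrier G)"
    and "finite \<Gamma>" "\<Gamma> \<subseteq> \<Omega>" "finite \<Delta>"
  shows "\<exists>g\<in>carrier G. \<forall>w\<in>\<Gamma>. act g w \<notin> \<Delta>"
  using \<open>finite \<Gamma>\<close> \<open>\<Gamma> \<subseteq> \<Omega>\<close> \<open>finite \<Delta>\<close>
proof (induction \<Gamma> arbitrary: \<Delta> rule: finite_induct)
  case empty
  then show ?case by auto
next
  case (insert \<gamma> \<Gamma>)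
  have \<gamma>: "\<gamma> \<in> \<Omega>" using insert.prems by auto
  obtain h where h: "h \<in> carrier G" "act h \<gamma> \<notin> \<Delta>"
    using orbits[OF \<gamma>] insert.prems(2) by (meson finite_subset image_subsetI)
  show ?case
  proof (rule ccontr)
    assume "\<not> ?thesis"
    then have cover: "\<exists>w\<in>insert \<gamma> \<Gamma>. act g w \<in> \<Delta>" if "g \<in> carrier G" for g using that by blast
    \<comment> \<open>The left coset \<open>{g. act g \<gamma> = act h \<gamma>}\<close> is covered using \<open>\<Gamma>\<close> alone, and so are all its
      left translates \<open>{g. act g \<gamma> = act k \<gamma>}\<close>.\<close>
    define kk where "kk \<delta> = (SOME k. k \<in> carrier G \<and> act k \<gamma> = \<delta>)" for \<delta>
    define \<Delta>' where "\<Delta>' = \<Delta> \<union> (\<Union>\<delta>\<in>\<Delta>. act (kk \<delta> \<otimes> inv h) ` \<Delta>)"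
    have "finite \<Delta>'" using insert.prems by (auto simp: \<Delta>'_def)
    then obtain g where g: "g \<in> carrier G" "\<forall>w\<in>\<Gamma>. act g w \<notin> \<Delta>'"
      using insert.IH[of \<Delta>'] insert.prems(1) by blast
    then have "act g \<gamma> \<in> \<Delta>" using cover[OF g(1)] by (auto simp: \<Delta>'_def)
    define k where "k = kk (act g \<gamma>)"
    have k: "k \<in> carrier G" "act k \<gamma> = act g \<gamma>"
      using someI[of "\<lambda>k. k \<in> carrier G \<and> act k \<gamma> = act g \<gamma>" g] g(1) by (auto simp: k_def kk_def)
    define g' where "g' = h \<otimes> inv k \<otimes> g"
    have g': "g' \<in> carrier G" using g h k by (auto simp: g'_def)
    have "act g' \<gamma> = act h (act (inv k) (act g \<gamma>))"
      using g h k \<gamma> by (simp add: g'_def mult closed m_assoc)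
    also have "act (inv k) (act g \<gamma>) = act (inv k \<otimes> k) \<gamma>"
      using k(1) \<gamma> by (subst mult) (auto simp: k(2))
    finally have "act g' \<gamma> = act h \<gamma>" using k(1) \<gamma> by (simp add: unit)
    then obtain w where w: "w \<in> \<Gamma>" "act g' w \<in> \<Delta>" using cover[OF g'] h(2) by auto
    have w\<Omega>: "w \<in> \<Omega>" using w insert.prems by auto
    have "act (k \<otimes> inv h) (act g' w) = act ((k \<otimes> inv h) \<otimes> g') w"
      using g' k(1) h(1) w\<Omega> by (simp add: mult)
    also have "(k \<otimes> inv h) \<otimes> g' = g"
      using g h k by (simp add: g'_def m_assoc inv_solve_left) (simp add: m_assoc[symmetric])
    finally have "act g w \<in> act (k \<otimes> inv h) ` \<Delta>" using w(2) by (metis imageI)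
    then have "act g w \<in> \<Delta>'" using \<open>act g \<gamma> \<in> \<Delta>\<close> by (auto simp: \<Delta>'_def k_def)
    then show False using g(2) w(1) by auto
  qed
qed

section \<open>Algebraic subshifts\<close>

locale alg_subshift = G: group G + K: group K
  for G :: "('g, 'm) monoid_scheme" (structure) and K :: "('k, 'l) monoid_scheme" +
  fixes X :: "('g \<Rightarrow> 'k) set"
  assumes countable_G: "countable (carrier G)"
    and finite_K: "finite (carrier K)"
    and alg: "algebraic_subshift G K X"
begin

lemma full_carrier: "carrier (full_shift G K) = carrier G \<rightarrow>\<^sub>E carrier K"
  by (simp add: full_shift_def)

lemma X_sub: "X \<subseteq> carrier G \<rightarrow>\<^sub>E carrier K"
  using alg subgroup.subset[of X "full_shift G K"] by (simp add: algebraic_subshift_def full_carrier)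

lemma X_K: "x \<in> X \<Longrightarrow> h \<in> carrier G \<Longrightarrow> x h \<in> carrier K"
  using X_sub by auto

lemma X_ext: "x \<in> X \<Longrightarrow> y \<in> X \<Longrightarrow> (\<And>h. h \<in> carrier G \<Longrightarrow> x h = y h) \<Longrightarrow> x = y"
  by (rule extensionalityI[of x "carrier G"]) (use X_sub in \<open>simp_all add: PiE_iff subset_iff\<close>)

abbreviation xone :: "'g \<Rightarrow> 'k" where
  "xone \<equiv> (\<lambda>h\<in>carrier G. \<one>\<^bsub>K\<^esub>)"

definition xmult :: "('g \<Rightarrow> 'k) \<Rightarrow> ('g \<Rightarrow> 'k) \<Rightarrow> 'g \<Rightarrow> 'k" where
  "xmult x y = (\<lambda>h\<in>carrier G. x h \<otimes>\<^bsub>K\<^esub> y h)"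

definition xinv :: "('g \<Rightarrow> 'k) \<Rightarrow> 'g \<Rightarrow> 'k" where
  "xinv x = (\<lambda>h\<in>carrier G. inv\<^bsub>K\<^esub> x h)"

lemma X_one: "xone \<in> X"
  using alg subgroup.one_closed[of X "full_shift G K"]
  by (simp add: algebraic_subshift_def full_shift_def)

lemma X_mult: "x \<in> X \<Longrightarrow> y \<in> X \<Longrightarrow> xmult x y \<in> X"
  using alg subgroup.m_closed[of X "full_shift G K" x y]
  by (simp add: algebraic_subshift_def full_shift_def xmult_def)

lemma X_inv: assumes "x \<in> X" shows "xinv x \<in> X"
proof -
  have "inv\<^bsub>full_shift G K\<^esub> x = xinv x"
    using assms X_sub by (auto simp: full_shift_def xinv_def K.is_group)
  then show ?thesis
    using alg subgroup.m_inv_closed[of X "full_shift G K" x] assms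
    by (simp add: algebraic_subshift_def)
qed

lemma X_shift: "g \<in> carrier G \<Longrightarrow> x \<in> X \<Longrightarrow> shift G g x \<in> X"
  using alg by (simp add: algebraic_subshift_def subshift_def)

lemma X_nonempty: "X \<noteq> {}" using X_one by auto

lemma shift_apply: "h \<in> carrier G \<Longrightarrow> shift G g x h = x (inv g \<otimes> h)"
  by (simp add: shift_def)

lemma shift_mult:
  assumes "g \<in> carrier G" "h \<in> carrier G"
  shows "shift G (g \<otimes> h) x = shift G g (shift G h x)"
  using assms by (auto simp: shift_def fun_eq_iff G.inv_mult_group G.m_assoc)

lemma shift_one: "x \<in> extensional (carrier G) \<Longrightarrow> shift G \<one> x = x"
  by (auto simp: shift_def fun_eq_iff extensional_def)

lemma X_extensional: "x \<in> X \<Longrightarrow> x \<in> extensional (carrier G)"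
  using X_sub by (auto simp: PiE_def)

lemma shift_inv_cancel:
  assumes "g \<in> carrier G" "x \<in> extensional (carrier G)"
  shows "shift G g (shift G (inv g) x) = x" "shift G (inv g) (shift G g x) = x"
  using assms by (simp_all add: shift_mult[symmetric] shift_one)

lemma shift_image_eq:
  assumes "g \<in> carrier G" "C \<subseteq> X"
  shows "shift G g ` C = {x \<in> X. shift G (inv g) x \<in> C}"
proof (intro Set.set_eqI iffI)
  fix x assume "x \<in> shift G g ` C"
  then show "x \<in> {x \<in> X. shift G (inv g) x \<in> C}"
    using assms by (auto simp: shift_inv_cancel(2) X_extensional subset_iff intro!: X_shift)
next
  fix x assume "x \<in> {x \<in> X. shift G (inv g) x \<in> C}"
  then show "x \<in> shift G g ` C"
    using assms shift_inv_cancel(1)[of g x] X_extensional by (metis (mono_tags, lifting) imageI mem_Collect_eq)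
qed

lemma shift_image_mult:
  assumes "g \<in> carrier G" "h \<in> carrier G"
  shows "shift G (g \<otimes> h) ` C = shift G g ` shift G h ` C"
  using assms by (auto simp: image_image shift_mult)

end

section \<open>Sets depending on a window\<close>

text \<open>The sets with a finite window \<open>E\<close> are clopen, and Haar measure can be computed on them by counting
  patterns; they stand in for all Borel sets below.\<close>
definition determined_by :: "('g \<Rightarrow> 'k) set \<Rightarrow> 'g set \<Rightarrow> ('g \<Rightarrow> 'k) set \<Rightarrow> bool" where
  "determined_by X E C \<longleftrightarrow> C \<subseteq> X \<and> (\<forall>x\<in>C. \<forall>y\<in>X. (\<forall>e\<in>E. x e = y e) \<longrightarrow> y \<in> C)"

definition patterns :: "'g set \<Rightarrow> ('g \<Rightarrow> 'k) set \<Rightarrow> ('g \<Rightarrow> 'k) set" where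
  "patterns E C = (\<lambda>x. restrict x E) ` C"

lemma restrict_eq_iff: "restrict x E = restrict y E \<longleftrightarrow> (\<forall>e\<in>E. x e = y e)"
  by (auto simp: restrict_def fun_eq_iff)

lemma determined_by_mono: "determined_by X E C \<Longrightarrow> E \<subseteq> E' \<Longrightarrow> determined_by X E' C"
  unfolding determined_by_def by blast

lemma determined_by_subset: "determined_by X E C \<Longrightarrow> C \<subseteq> X"
  by (simp add: determined_by_def)

lemma determined_by_UNIV: "determined_by X E X"
  by (simp add: determined_by_def)

lemma determined_by_Diff: "determined_by X E C \<Longrightarrow> determined_by X E (X - C)"
  unfolding determined_by_def by (metis Diff_iff Diff_subset)

lemma determined_by_Int: "determined_by X E C \<Longrightarrow> determined_by X E D \<Longrightarrow> determined_by X E (C \<inter> D)"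
  unfolding determined_by_def by blast

lemma determined_by_eqI:
  assumes "determined_by X E C" "determined_by X E D" "patterns E C = patterns E D"
  shows "C = D"
proof -
  have *: "C \<subseteq> D" if "determined_by X E C" "determined_by X E D" "patterns E C = patterns E D" for C D
  proof
    fix x assume "x \<in> C"
    then have "restrict x E \<in> patterns E D" using that by (auto simp: patterns_def)
    then obtain y where "y \<in> D" "restrict y E = restrict x E" by (auto simp: patterns_def)
    then show "x \<in> D" using that \<open>x \<in> C\<close> unfolding determined_by_def restrict_eq_iff by blast
  qed
  show ?thesis using *[OF assms] *[OF assms(2,1)] assms(3) by auto
qed

context alg_subshift
begin

lemma patterns_finite:
  assumes "finite E" "E \<subseteq> carrier G" "C \<subseteq> X"
  shows "finite (patterns E C)"
proof (rule finite_subset)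
  show "patterns E C \<subseteq> E \<rightarrow>\<^sub>E carrier K"
    using assms X_K by (force simp: patterns_def)
  show "finite (E \<rightarrow>\<^sub>E carrier K)" using assms finite_K by (intro finite_PiE) auto
qed

abbreviation translate :: "'g \<Rightarrow> 'g set \<Rightarrow> 'g set" where
  "translate g E \<equiv> (\<lambda>e. g \<otimes> e) ` E"

lemma determined_by_shift:
  assumes "g \<in> carrier G" "E \<subseteq> carrier G" "determined_by X E C"
  shows "determined_by X (translate g E) (shift G g ` C)"
proof -
  have C: "C \<subseteq> X" using assms(3) by (rule determined_by_subset)
  show ?thesis
    unfolding shift_image_eq[OF assms(1) C] determined_by_def
  proof (intro conjI ballI impI)
    fix x y assume x: "x \<in> {x \<in> X. shift G (inv g) x \<in> C}" and y: "y \<in> X"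
      and eq: "\<forall>e\<in>translate g E. x e = y e"
    have "\<forall>e\<in>E. shift G (inv g) x e = shift G (inv g) y e"
      using eq assms by (auto simp: shift_apply subset_iff)
    moreover have "shift G (inv g) y \<in> X" using y assms by (intro X_shift) auto
    ultimately show "y \<in> {x \<in> X. shift G (inv g) x \<in> C}"
      using x y assms(3) unfolding determined_by_def by blast
  qed auto
qed

section \<open>Topology of the subshift\<close>

abbreviation TX :: "('g \<Rightarrow> 'k) topology" where
  "TX \<equiv> subtopology (full_shift_top G K) X"

lemma topspace_full: "topspace (full_shift_top G K) = carrier G \<rightarrow>\<^sub>E carrier K"
  by (simp add: full_shift_top_def)

lemma topspace_TX: "topspace TX = X"
  using X_sub by (auto simp: topspace_full)

lemma compact_full: "compact_space (full_shift_top G K)"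
  unfolding full_shift_top_def compact_space_product_topology
  using finite_K by (auto simp: compact_space_discrete_topology)

lemma compact_TX: "compact_space TX"
  using alg closedin_compact_space[OF compact_full, of X]
  by (simp add: algebraic_subshift_def subshift_def compact_space_subtopology)

lemma openin_coordinate:
  assumes "h \<in> carrier G"
  shows "openin TX {x \<in> X. x h \<in> U}"
proof -
  have "continuous_map (full_shift_top G K) (discrete_topology (carrier K)) (\<lambda>x. x h)"
    unfolding full_shift_top_def using assms by (rule continuous_map_product_projection)
  then have "continuous_map TX (discrete_topology (carrier K)) (\<lambda>x. x h)"
    by (rule continuous_map_from_subtopology)
  then have "openin TX {x \<in> topspace TX. x h \<in> U \<inter> carrier K}"
    by (rule openin_continuous_map_preimage) auto
  also have "{x \<in> topspace TX. x h \<in> U \<inter> carrier K} = {x \<in> X. x h \<in> U}"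
    using assms X_K by (auto simp: topspace_TX simp del: topspace_subtopology)
  finally show ?thesis .
qed

lemma openin_determined:
  assumes E: "finite E" "E \<subseteq> carrier G" and C: "determined_by X E C"
  shows "openin TX C"
proof -
  have *: "openin TX {y \<in> X. \<forall>e\<in>E. y e = x e}" for x
  proof -
    have "{y \<in> X. \<forall>e\<in>E. y e = x e} = X \<inter> \<Inter>((\<lambda>e. {y \<in> X. y e \<in> {x e}}) ` E)" by auto
    also have "openin TX (X \<inter> \<Inter>((\<lambda>e. {y \<in> X. y e \<in> {x e}}) ` E))"
    proof (cases "E = {}")
      case True then show ?thesis using openin_topspace[of TX] by (simp only: topspace_TX) simp
    next
      case False
      then have "openin TX (\<Inter>((\<lambda>e. {y \<in> X. y e \<in> {x e}}) ` E))"
        using E openin_coordinate by (intro openin_Inter) blast+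
      moreover have "openin TX X" using openin_topspace[of TX] by (simp only: topspace_TX)
      ultimately show ?thesis by (intro openin_Int)
    qed
    finally show ?thesis .
  qed
  have C_eq: "C = \<Union>((\<lambda>x. {y \<in> X. \<forall>e\<in>E. y e = x e}) ` C)"
    using C unfolding determined_by_def by (auto 0 3)
  show ?thesis by (subst C_eq, rule openin_Union) (use * in auto)
qed

lemma continuous_shift:
  assumes g: "g \<in> carrier G"
  shows "continuous_map TX TX (shift G g)"
proof (rule continuous_map_into_subtopology)
  show "shift G g \<in> topspace TX \<rightarrow> X" unfolding topspace_TX using g X_shift by auto
  have "continuous_map TX (discrete_topology (carrier K)) (\<lambda>x. x h)" if "h \<in> carrier G" for h
    unfolding full_shift_top_def
    by (intro continuous_map_from_subtopology continuous_map_product_projection that)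
  then show "continuous_map TX (full_shift_top G K) (shift G g)"
    unfolding full_shift_top_def shift_def continuous_map_componentwise
    using g by (auto simp: full_shift_top_def)
qed

text \<open>Countability of \<open>G\<close> makes a countable union sufficient, so that the finite-window sets generate the
  Borel \<open>\<sigma>\<close>-algebra.\<close>
lemma open_union_determined:
  assumes U: "openin TX U"
  shows "\<exists>E C. (\<forall>m::nat. finite (E m) \<and> E m \<subseteq> carrier G \<and> determined_by X (E m) (C m)) \<and> U = (\<Union>m. C m)"
proof -
  \<comment> \<open>\<open>C m\<close> is the set of points that the first \<open>m\<close> coordinates force into \<open>U\<close>.\<close>
  define E where "E m = from_nat_into (carrier G) ` {..<m}" for m :: nat
  define C where "C m = {x \<in> X. \<forall>y\<in>X. (\<forall>e\<in>E m. x e = y e) \<longrightarrow> y \<in> U}" for m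
  have ne: "carrier G \<noteq> {}" by auto
  have E: "finite (E m)" "E m \<subseteq> carrier G" for m
    using from_nat_into[OF ne] by (auto simp: E_def)
  have exE: "\<exists>m. F \<subseteq> E m" if "finite F" "F \<subseteq> carrier G" for F
  proof -
    have "\<exists>m. f \<in> E m" if "f \<in> carrier G" for f
      using from_nat_into_surj[OF countable_G that] by (auto simp: E_def)
    then obtain m where m: "\<And>f. f \<in> carrier G \<Longrightarrow> f \<in> E (m f)" by metis
    have mono: "E i \<subseteq> E j" if "i \<le> j" for i j using that by (auto simp: E_def)
    have "F \<subseteq> E (Max (m ` F))"
    proof
      fix f assume f: "f \<in> F"
      then have "m f \<le> Max (m ` F)" using \<open>finite F\<close> by auto
      then show "f \<in> E (Max (m ` F))" using m[of f] mono f \<open>F \<subseteq> carrier G\<close> by blast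
    qed
    then show ?thesis by blast
  qed
  have "determined_by X (E m) (C m)" for m
    unfolding determined_by_def C_def by auto
  moreover have "U = (\<Union>m. C m)"
  proof
    show "(\<Union>m. C m) \<subseteq> U" by (auto simp: C_def)
    show "U \<subseteq> (\<Union>m. C m)"
    proof
      fix x assume x: "x \<in> U"
      obtain S where S: "openin (full_shift_top G K) S" "U = S \<inter> X"
        using U by (auto simp: openin_subtopology)
      then have "openin (product_topology (\<lambda>_. discrete_topology (carrier K)) (carrier G)) S" "x \<in> S"
        using x by (auto simp: full_shift_top_def)
      then obtain V where V: "finite {i \<in> carrier G. V i \<noteq> carrier K}" "x \<in> PiE (carrier G) V"
          "PiE (carrier G) V \<subseteq> S"
        unfolding openin_product_topology_alt by auto
      obtain m where m: "{i \<in> carrier G. V i \<noteq> carrier K} \<subseteq> E m"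
        using exE[OF V(1)] by auto
      have "y \<in> U" if y: "y \<in> X" "\<forall>e\<in>E m. x e = y e" for y
      proof -
        have "y \<in> PiE (carrier G) V"
        proof (rule PiE_I)
          fix h assume h: "h \<in> carrier G"
          show "y h \<in> V h"
          proof (cases "h \<in> E m")
            case True then show ?thesis using y V(2) h by (metis PiE_mem)
          next
            case False
            then have "V h = carrier K" using m h by auto
            then show ?thesis using y h X_K by auto
          qed
        qed (use y X_sub in auto)
        then show ?thesis using V(3) S y by auto
      qed
      then show "x \<in> (\<Union>m. C m)" using x S by (auto simp: C_def)
    qed
  qed
  ultimately show ?thesis using E by (intro exI[of _ E] exI[of _ C]) auto
qed

end

section \<open>Haar measure of sets with a finite window\<close>

context alg_subshift
begin

definition pointwise_subgroup :: "('g \<Rightarrow> 'k) set \<Rightarrow> bool" where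
  "pointwise_subgroup Z \<longleftrightarrow> Z \<subseteq> carrier G \<rightarrow>\<^sub>E carrier K \<and> xone \<in> Z \<and>
     (\<forall>x\<in>Z. \<forall>y\<in>Z. xmult x y \<in> Z) \<and> (\<forall>x\<in>Z. xinv x \<in> Z)"

lemma pointwise_subgroup_X: "pointwise_subgroup X"
  using X_sub X_one X_mult X_inv by (simp add: pointwise_subgroup_def)

lemma xmult_apply: "h \<in> carrier G \<Longrightarrow> xmult x y h = x h \<otimes>\<^bsub>K\<^esub> y h"
  by (simp add: xmult_def)

lemma xinv_apply: "h \<in> carrier G \<Longrightarrow> xinv x h = inv\<^bsub>K\<^esub> x h"
  by (simp add: xinv_def)

text \<open>All fibres of the projection to a window are translates of the kernel, hence they have the
  same measure. The lemma is stated for a general subgroup \<open>Z\<close>, because it serves both for Haar measure on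
  \<open>X\<close> and for the counting measure on a finite group of periodic points.\<close>
lemma measure_determined:
  assumes Z: "pointwise_subgroup Z" and E: "finite E" "E \<subseteq> carrier G"
    and M: "finite_measure M" "measure M Z = 1"
    and det: "\<And>C. determined_by Z E C \<Longrightarrow> C \<in> sets M"
    and inv: "\<And>y A. \<lbrakk>y \<in> Z; A \<in> sets M\<rbrakk> \<Longrightarrow> measure M (xmult y ` A) = measure M A"
    and C: "determined_by Z E C"
  shows "measure M C = real (card (patterns E C)) / real (card (patterns E Z))"
proof -
  interpret finite_measure M by (rule M(1))
  have ZK: "x h \<in> carrier K" if "x \<in> Z" "h \<in> carrier G" for x h
    using Z that by (auto simp: pointwise_subgroup_def)
  define fib where "fib p = {x \<in> Z. restrict x E = p}" for p
  have fib_det: "determined_by Z E (fib p)" for p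
    unfolding determined_by_def fib_def using restrict_eq_iff[of _ E] by auto
  define c where "c = measure M (fib (restrict xone E))"
  have fib_measure: "measure M (fib p) = c" if "p \<in> patterns E Z" for p
  proof -
    obtain z where z: "z \<in> Z" "p = restrict z E" using \<open>p \<in> patterns E Z\<close> by (auto simp: patterns_def)
    have "xmult z ` fib (restrict xone E) = fib p"
    proof (intro Set.set_eqI iffI)
      fix x assume "x \<in> xmult z ` fib (restrict xone E)"
      then obtain y where y: "y \<in> Z" "restrict y E = restrict xone E" "x = xmult z y"
        by (auto simp: fib_def)
      have "x e = z e" if "e \<in> E" for e
        using fun_cong[OF y(2), of e] that E(2) ZK[OF z(1), of e]
        by (auto simp: y(3) xmult_apply subset_iff)
      then show "x \<in> fib p"
        using y(1,3) z Z by (auto simp: fib_def restrict_eq_iff pointwise_subgroup_def)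
    next
      fix x assume x: "x \<in> fib p"
      then have xZ: "x \<in> Z" and eq: "\<forall>e\<in>E. x e = z e" by (auto simp: fib_def z restrict_eq_iff)
      have xe: "x \<in> extensional (carrier G)"
        using xZ Z by (auto simp: pointwise_subgroup_def PiE_def)
      define y where "y = xmult (xinv z) x"
      have yZ: "y \<in> Z" using Z z xZ by (auto simp: y_def pointwise_subgroup_def)
      have "y e = \<one>\<^bsub>K\<^esub>" if "e \<in> E" for e
        using that E(2) eq ZK[OF z(1), of e] by (auto simp: y_def xmult_apply xinv_apply subset_iff)
      then have "y \<in> fib (restrict xone E)"
        using yZ E(2) by (simp add: fib_def restrict_eq_iff subset_iff del: restrict_restrict)
      moreover have "x = xmult z y"
      proof (rule extensionalityI[OF xe])
        show "xmult z y \<in> extensional (carrier G)" by (simp add: xmult_def)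
        show "x h = xmult z y h" if "h \<in> carrier G" for h
          using that ZK[OF z(1) that] ZK[OF xZ that]
          by (simp add: y_def xmult_apply xinv_apply K.m_assoc[symmetric])
      qed
      ultimately show "x \<in> xmult z ` fib (restrict xone E)" by blast
    qed
    then show ?thesis using inv[OF z(1) det[OF fib_det, of "restrict xone E"]] by (simp add: c_def)
  qed
  have Z_sub: "patterns E Z \<subseteq> E \<rightarrow>\<^sub>E carrier K"
    using ZK E(2) by (force simp: patterns_def)
  have finZ: "finite (patterns E Z)"
    by (rule finite_subset[OF Z_sub]) (use E finite_K in \<open>auto intro!: finite_PiE\<close>)
  have sum: "measure M C = real (card (patterns E C)) * c" if C: "determined_by Z E C" for C
  proof -
    have CZ: "C \<subseteq> Z" using C by (rule determined_by_subset)
    then have sub: "patterns E C \<subseteq> patterns E Z" by (auto simp: patterns_def)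
    have "C = (\<Union>p\<in>patterns E C. fib p)"
    proof (intro Set.set_eqI iffI)
      fix x assume "x \<in> C" then show "x \<in> (\<Union>p\<in>patterns E C. fib p)"
        using CZ by (auto simp: patterns_def fib_def)
    next
      fix x assume "x \<in> (\<Union>p\<in>patterns E C. fib p)"
      then obtain y where "y \<in> C" "x \<in> Z" "restrict x E = restrict y E"
        by (auto simp: patterns_def fib_def)
      then show "x \<in> C" using C unfolding determined_by_def restrict_eq_iff by metis
    qed
    then have "measure M C = measure M (\<Union>p\<in>patterns E C. fib p)" by simp
    also have "\<dots> = (\<Sum>p\<in>patterns E C. measure M (fib p))"
    proof (rule finite_measure_finite_Union)
      show "finite (patterns E C)" using finZ sub by (rule finite_subset[rotated])
      show "fib ` patterns E C \<subseteq> sets M" using det fib_det by auto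
      show "disjoint_family_on fib (patterns E C)" by (auto simp: disjoint_family_on_def fib_def)
    qed
    also have "\<dots> = (\<Sum>p\<in>patterns E C. c)"
      using sub by (intro sum.cong fib_measure) auto
    finally show ?thesis by simp
  qed
  have one: "1 = real (card (patterns E Z)) * c"
    using sum[OF determined_by_UNIV] M(2) by simp
  then have "real (card (patterns E Z)) \<noteq> 0" by (metis mult_zero_left zero_neq_one)
  then show ?thesis using sum[OF C] one by (simp add: field_simps)
qed

end

definition independent_windows :: "('g \<Rightarrow> 'k) set \<Rightarrow> 'g set \<Rightarrow> 'g set \<Rightarrow> bool" where
  "independent_windows X E F \<longleftrightarrow>
     (\<forall>x\<in>X. \<forall>y\<in>X. \<exists>z\<in>X. (\<forall>e\<in>E. z e = x e) \<and> (\<forall>e\<in>F. z e = y e))"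

text \<open>Independence means that the pair of restrictions to \<open>E\<close> and \<open>F\<close> ranges over a full product.\<close>
lemma card_patterns_independent:
  assumes ind: "independent_windows X E F" and C: "determined_by X E C" and D: "determined_by X F D"
  shows "card (patterns (E \<union> F) (C \<inter> D)) = card (patterns E C) * card (patterns F D)"
proof -
  have "bij_betw (\<lambda>p. (restrict p E, restrict p F)) (patterns (E \<union> F) (C \<inter> D))
          (patterns E C \<times> patterns F D)"
    unfolding bij_betw_def
  proof
    show "inj_on (\<lambda>p. (restrict p E, restrict p F)) (patterns (E \<union> F) (C \<inter> D))"
      by (rule inj_onI) (auto simp: patterns_def restrict_eq_iff)
    show "(\<lambda>p. (restrict p E, restrict p F)) ` patterns (E \<union> F) (C \<inter> D) = patterns E C \<times> patterns F D"
    proof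
      show "(\<lambda>p. (restrict p E, restrict p F)) ` patterns (E \<union> F) (C \<inter> D) \<subseteq> patterns E C \<times> patterns F D"
        by (auto simp: patterns_def Int_absorb1 Un_Int_distrib2)
      show "patterns E C \<times> patterns F D \<subseteq> (\<lambda>p. (restrict p E, restrict p F)) ` patterns (E \<union> F) (C \<inter> D)"
      proof
        fix pq assume "pq \<in> patterns E C \<times> patterns F D"
        then obtain x y where xy: "x \<in> C" "y \<in> D" "pq = (restrict x E, restrict y F)"
          by (auto simp: patterns_def)
        have "x \<in> X" "y \<in> X" using xy C D by (auto dest: determined_by_subset)
        then obtain z where z: "z \<in> X" "\<forall>e\<in>E. z e = x e" "\<forall>e\<in>F. z e = y e"
          using ind unfolding independent_windows_def by blast
        then have "z \<in> C" "z \<in> D" using xy C D unfolding determined_by_def by metis+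
        then have "restrict z (E \<union> F) \<in> patterns (E \<union> F) (C \<inter> D)" by (auto simp: patterns_def)
        moreover have "pq = (restrict (restrict z (E \<union> F)) E, restrict (restrict z (E \<union> F)) F)"
          using z by (auto simp: xy restrict_eq_iff)
        ultimately show "pq \<in> (\<lambda>p. (restrict p E, restrict p F)) ` patterns (E \<union> F) (C \<inter> D)" by blast
      qed
    qed
  qed
  from bij_betw_same_card[OF this] show ?thesis by (simp only: card_cartesian_product)
qed

locale haar_subshift = alg_subshift G K X
  for G :: "('g, 'm) monoid_scheme" (structure) and K :: "('k, 'l) monoid_scheme" and X :: "('g \<Rightarrow> 'k) set" +
  fixes \<mu> :: "('g \<Rightarrow> 'k) measure"
  assumes haar: "haar_probability G K X \<mu>"
begin

lemma space_haar: "space \<mu> = X"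
  and sets_haar: "sets \<mu> = sigma_sets X {U. openin TX U}"
  and emeasure_haar: "emeasure \<mu> X = 1"
  using haar by (simp_all add: haar_probability_def)

sublocale finite_measure \<mu>
  by (rule finite_measureI) (simp add: space_haar emeasure_haar)

lemma measure_haar: "measure \<mu> X = 1"
  using emeasure_haar by (simp add: measure_def)

lemma haar_translate: "y \<in> X \<Longrightarrow> A \<in> sets \<mu> \<Longrightarrow> measure \<mu> (xmult y ` A) = measure \<mu> A"
proof -
  assume "y \<in> X" "A \<in> sets \<mu>"
  moreover have "y <#\<^bsub>full_shift G K\<^esub> A = xmult y ` A"
    by (auto simp: l_coset_def full_shift_def xmult_def)
  ultimately show ?thesis using haar unfolding haar_probability_def measure_def by metis
qed

lemma determined_sets:
  assumes "finite E" "E \<subseteq> carrier G" "determined_by X E C"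
  shows "C \<in> sets \<mu>"
  using openin_determined[OF assms] by (auto simp: sets_haar)

lemma haar_determined:
  assumes "finite E" "E \<subseteq> carrier G" "determined_by X E C"
  shows "measure \<mu> C = real (card (patterns E C)) / real (card (patterns E X))"
  by (rule measure_determined[OF pointwise_subgroup_X assms(1,2) finite_measure_axioms measure_haar
        determined_sets[OF assms(1,2)] haar_translate assms(3)])

lemma haar_determined_pos:
  assumes "finite E" "E \<subseteq> carrier G" "determined_by X E C" "C \<noteq> {}"
  shows "0 < measure \<mu> C"
proof -
  have "C \<subseteq> X" using assms by (auto dest: determined_by_subset)
  then have "0 < card (patterns E C)" "0 < card (patterns E X)"
    using patterns_finite[OF assms(1,2)] assms(4) X_nonempty by (auto simp: card_gt_0_iff patterns_def)
  then show ?thesis by (simp add: haar_determined[OF assms(1-3)])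
qed

lemma haar_independent:
  assumes E: "finite E" "E \<subseteq> carrier G" "determined_by X E C"
    and F: "finite F" "F \<subseteq> carrier G" "determined_by X F D"
    and ind: "independent_windows X E F"
  shows "measure \<mu> (C \<inter> D) = measure \<mu> C * measure \<mu> D"
proof -
  have "determined_by X (E \<union> F) (C \<inter> D)"
    using E F by (intro determined_by_Int) (auto elim: determined_by_mono)
  then have "measure \<mu> (C \<inter> D)
      = real (card (patterns (E \<union> F) (C \<inter> D))) / real (card (patterns (E \<union> F) X))"
    using E F by (intro haar_determined) auto
  then show ?thesis
    using card_patterns_independent[OF ind determined_by_UNIV determined_by_UNIV]
      card_patterns_independent[OF ind E(3) F(3)]
    by (simp add: haar_determined[OF E] haar_determined[OF F])
qed

section \<open>Invariance under the shift\<close>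

lemma sets_haar_determined:
  "sets \<mu> = sigma_sets X {C. \<exists>E. finite E \<and> E \<subseteq> carrier G \<and> determined_by X E C}" (is "_ = sigma_sets X ?D")
proof
  show "sigma_sets X ?D \<subseteq> sets \<mu>"
    using determined_sets space_haar sets.sigma_sets_subset[of ?D \<mu>] by auto
  have "U \<in> sigma_sets X ?D" if "openin TX U" for U
  proof -
    obtain E C where EC: "\<And>m::nat. finite (E m) \<and> E m \<subseteq> carrier G \<and> determined_by X (E m) (C m)"
      "U = (\<Union>m. C m)" using open_union_determined[OF \<open>openin TX U\<close>] by metis
    have "C m \<in> sigma_sets X ?D" for m using EC(1)[of m] by (intro sigma_sets.Basic) auto
    then show ?thesis unfolding EC(2) by (rule sigma_sets.Union)
  qed
  then show "sets \<mu> \<subseteq> sigma_sets X ?D"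
    unfolding sets_haar by (intro sigma_sets_mono) auto
qed

lemma measurable_shift:
  assumes g: "g \<in> carrier G"
  shows "shift G g \<in> measurable \<mu> \<mu>"
proof (rule measurable_sigma_sets[OF sets_haar])
  show "{U. openin TX U} \<subseteq> Pow X" using openin_subset[of TX] topspace_TX by auto
  show "shift G g \<in> space \<mu> \<rightarrow> X" using X_shift[OF g] by (auto simp: space_haar)
  fix U assume "U \<in> {U. openin TX U}"
  then have "openin TX {x \<in> topspace TX. shift G g x \<in> U}"
    using openin_continuous_map_preimage[OF continuous_shift[OF g]] by auto
  moreover have "shift G g -` U \<inter> space \<mu> = {x \<in> topspace TX. shift G g x \<in> U}"
    using X_sub by (auto simp: topspace_full space_haar)
  ultimately show "shift G g -` U \<inter> space \<mu> \<in> sets \<mu>" by (auto simp: sets_haar)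
qed

text \<open>Shifting a window together with the set only relabels the patterns. Since Haar measure of a
  finite-window set is a ratio of numbers of patterns, this yields the shift invariance of Haar
  measure.\<close>
lemma card_patterns_shift:
  assumes g: "g \<in> carrier G" and E: "E \<subseteq> carrier G" and C: "C \<subseteq> X"
  shows "card (patterns (translate g E) (shift G g ` C)) = card (patterns E C)"
proof -
  define tr where "tr p = (\<lambda>h\<in>translate g E. p (inv g \<otimes> h))" for p :: "'g \<Rightarrow> 'k"
  have cancel: "inv g \<otimes> (g \<otimes> e) = e" if "e \<in> E" for e
    using that g E by (auto simp: G.m_assoc[symmetric])
  have tr: "restrict (shift G g x) (translate g E) = tr (restrict x E)" for x
    using g E by (auto simp: tr_def restrict_def fun_eq_iff shift_def cancel subset_iff)
  have "patterns (translate g E) (shift G g ` C) = tr ` patterns E C"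
    by (simp add: patterns_def image_image tr)
  moreover have "inj_on tr (patterns E C)"
  proof (rule inj_onI)
    fix p q assume p: "p \<in> patterns E C" and q: "q \<in> patterns E C" and eq: "tr p = tr q"
    have "p e = q e" if "e \<in> E" for e
      using fun_cong[OF eq, of "g \<otimes> e"] that by (simp add: tr_def cancel)
    then show "p = q" using p q by (auto simp: patterns_def restrict_eq_iff)
  qed
  ultimately show ?thesis by (simp add: card_image)
qed

lemma haar_shift_determined:
  assumes g: "g \<in> carrier G" and E: "finite E" "E \<subseteq> carrier G" and C: "determined_by X E C"
  shows "measure \<mu> (shift G g ` C) = measure \<mu> C"
proof -
  have gE: "finite (translate g E)" "translate g E \<subseteq> carrier G" using E g by auto
  have "shift G g ` X = X"
    using shift_image_eq[OF g, of X] g by (auto intro: X_shift)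
  then show ?thesis
    using haar_determined[OF gE determined_by_shift[OF g E(2) C]] haar_determined[OF E C]
      card_patterns_shift[OF g E(2) determined_by_subset[OF C]] card_patterns_shift[OF g E(2), of X]
    by simp
qed

lemma haar_shift_invariant:
  assumes g: "g \<in> carrier G" and A: "A \<in> sets \<mu>"
  shows "measure \<mu> {x \<in> X. shift G g x \<in> A} = measure \<mu> A"
proof -
  let ?D = "{C. \<exists>E. finite E \<and> E \<subseteq> carrier G \<and> determined_by X E C}"
  have ig: "inv g \<in> carrier G" using g by auto
  have "distr \<mu> \<mu> (shift G g) = \<mu>"
  proof (rule measure_eqI_generator_eq[where E = ?D and \<Omega> = X and A = "\<lambda>_. X"])
    show "Int_stable ?D"
    proof (rule Int_stableI, clarify)
      fix C D E F
      assume "finite E" "E \<subseteq> carrier G" "determined_by X E C"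
        "finite F" "F \<subseteq> carrier G" "determined_by X F D"
      then show "\<exists>E. finite E \<and> E \<subseteq> carrier G \<and> determined_by X E (C \<inter> D)"
        by (intro exI[of _ "E \<union> F"] conjI determined_by_Int) (auto elim: determined_by_mono)
    qed
    show "?D \<subseteq> Pow X" by (auto dest: determined_by_subset)
    show "emeasure (distr \<mu> \<mu> (shift G g)) C = emeasure \<mu> C" if "C \<in> ?D" for C
    proof -
      obtain E where E: "finite E" "E \<subseteq> carrier G" "determined_by X E C" using \<open>C \<in> ?D\<close> by blast
      have "shift G g -` C \<inter> space \<mu> = shift G (inv g) ` C"
        using shift_image_eq[OF ig determined_by_subset[OF E(3)]] g by (auto simp: space_haar)
      then show ?thesis
        using haar_shift_determined[OF ig E] determined_sets[OF E]
        by (simp add: emeasure_distr[OF measurable_shift[OF g]] emeasure_eq_measure)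
    qed
    show "sets (distr \<mu> \<mu> (shift G g)) = sigma_sets X ?D" using sets_haar_determined by simp
    show "sets \<mu> = sigma_sets X ?D" by (rule sets_haar_determined)
    show "range (\<lambda>_::nat. X) \<subseteq> ?D" by (auto intro!: exI[of _ "{}"] determined_by_UNIV)
    show "emeasure (distr \<mu> \<mu> (shift G g)) X \<noteq> \<infinity>" for i :: nat
      by (subst emeasure_distr[OF measurable_shift[OF g]])
        (auto simp: space_haar[symmetric])
  qed auto
  then have "measure \<mu> A = measure (distr \<mu> \<mu> (shift G g)) A" by simp
  also have "\<dots> = measure \<mu> (shift G g -` A \<inter> space \<mu>)"
    by (rule measure_distr[OF measurable_shift[OF g] A])
  also have "shift G g -` A \<inter> space \<mu> = {x \<in> X. shift G g x \<in> A}" by (auto simp: space_haar)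
  finally show ?thesis by simp
qed

section \<open>Approximation by sets with a finite window\<close>

text \<open>The sets approximable in measure by finite-window sets form a \<open>\<sigma>\<close>-algebra that contains the
  finite-window sets, so they are all the Borel sets.\<close>
definition window_approximable :: "('g \<Rightarrow> 'k) set \<Rightarrow> bool" where
  "window_approximable A \<longleftrightarrow> A \<in> sets \<mu> \<and>
     (\<forall>\<epsilon>>0. \<exists>E C. finite E \<and> E \<subseteq> carrier G \<and> determined_by X E C \<and> measure \<mu> ((A - C) \<union> (C - A)) < \<epsilon>)"

lemma window_approximable_determined:
  assumes "finite E" "E \<subseteq> carrier G" "determined_by X E C"
  shows "window_approximable C"
  unfolding window_approximable_def
  using determined_sets[OF assms] assms by (auto intro!: exI[of _ E] exI[of _ C])

lemma window_approximable_Compl: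
  assumes "window_approximable A"
  shows "window_approximable (X - A)"
  unfolding window_approximable_def
proof (intro conjI allI impI)
  have A: "A \<in> sets \<mu>" using assms by (simp add: window_approximable_def)
  then show "X - A \<in> sets \<mu>" using sets.compl_sets[of A \<mu>] by (simp add: space_haar)
  fix \<epsilon> :: real assume "\<epsilon> > 0"
  then obtain E C where E: "finite E" "E \<subseteq> carrier G" "determined_by X E C"
    "measure \<mu> ((A - C) \<union> (C - A)) < \<epsilon>"
    using assms unfolding window_approximable_def by blast
  have "((X - A) - (X - C)) \<union> ((X - C) - (X - A)) = (A - C) \<union> (C - A)"
    using determined_by_subset[OF E(3)] sets.sets_into_space[OF A] by (auto simp: space_haar)
  then show "\<exists>E C. finite E \<and> E \<subseteq> carrier G \<and> determined_by X E C \<and>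
      measure \<mu> (((X - A) - C) \<union> (C - (X - A))) < \<epsilon>"
    using E determined_by_Diff[OF E(3)] by (intro exI[of _ E] exI[of _ "X - C"]) simp
qed

lemma window_approximable_Union:
  assumes A: "\<And>m::nat. window_approximable (A m)"
  shows "window_approximable (\<Union>m. A m)"
  unfolding window_approximable_def
proof (intro conjI allI impI)
  have Am: "A m \<in> sets \<mu>" for m using A by (simp add: window_approximable_def)
  then show UA: "(\<Union>m. A m) \<in> sets \<mu>" by auto
  fix \<epsilon> :: real assume "\<epsilon> > 0"
  have "(\<lambda>n. measure \<mu> (\<Union>m<n. A m)) \<longlonglongrightarrow> measure \<mu> (\<Union>n. \<Union>m<n. A m)"
    by (rule finite_Lim_measure_incseq)
      (use Am in \<open>auto simp: incseq_def intro: less_le_trans\<close>)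
  moreover have "(\<Union>n. \<Union>m<n. A m) = (\<Union>m. A m)" by auto
  ultimately have "(\<lambda>n. measure \<mu> (\<Union>m<n. A m)) \<longlonglongrightarrow> measure \<mu> (\<Union>m. A m)" by simp
  then have "\<forall>\<^sub>F n in sequentially. measure \<mu> (\<Union>m. A m) - \<epsilon> / 2 < measure \<mu> (\<Union>m<n. A m)"
    using \<open>\<epsilon> > 0\<close> by (intro order_tendstoD) auto
  then obtain n where n: "measure \<mu> (\<Union>m. A m) - \<epsilon> / 2 < measure \<mu> (\<Union>m<n. A m)"
    by (auto simp: eventually_sequentially)
  define \<delta> where "\<delta> = \<epsilon> / (2 * (real n + 1))"
  have "\<delta> > 0" using \<open>\<epsilon> > 0\<close> by (simp add: \<delta>_def)
  then have "\<forall>m. \<exists>E C. finite E \<and> E \<subseteq> carrier G \<and> determined_by X E C \<and>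
      measure \<mu> ((A m - C) \<union> (C - A m)) < \<delta>"
    using A unfolding window_approximable_def by blast
  then obtain E C where EC: "\<And>m. finite (E m)" "\<And>m. E m \<subseteq> carrier G" "\<And>m. determined_by X (E m) (C m)"
    "\<And>m. measure \<mu> ((A m - C m) \<union> (C m - A m)) < \<delta>" by metis
  have Cm: "C m \<in> sets \<mu>" for m by (rule determined_sets[OF EC(1-3)])
  define D where "D = (\<Union>m<n. C m)"
  have D: "determined_by X (\<Union>m<n. E m) D"
    unfolding D_def determined_by_def
  proof (intro conjI ballI impI)
    show "(\<Union>m<n. C m) \<subseteq> X" using EC(3) by (auto dest: determined_by_subset)
    fix x y assume "x \<in> (\<Union>m<n. C m)" "y \<in> X" "\<forall>e\<in>(\<Union>m<n. E m). x e = y e"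
    then show "y \<in> (\<Union>m<n. C m)" using EC(3) unfolding determined_by_def by (metis UN_iff)
  qed
  have Dm: "D \<in> sets \<mu>" unfolding D_def using Cm by auto
  let ?S = "\<lambda>m. (A m - C m) \<union> (C m - A m)"
  have "((\<Union>m. A m) - D) \<union> (D - (\<Union>m. A m)) \<subseteq> ((\<Union>m. A m) - (\<Union>m<n. A m)) \<union> (\<Union>m<n. ?S m)"
    unfolding D_def by blast
  then have "measure \<mu> (((\<Union>m. A m) - D) \<union> (D - (\<Union>m. A m)))
      \<le> measure \<mu> (((\<Union>m. A m) - (\<Union>m<n. A m)) \<union> (\<Union>m<n. ?S m))"
    using Am Cm by (intro finite_measure_mono) auto
  also have "\<dots> \<le> measure \<mu> ((\<Union>m. A m) - (\<Union>m<n. A m)) + measure \<mu> (\<Union>m<n. ?S m)"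
    using Am Cm UA by (intro measure_Un_le) auto
  also have "measure \<mu> ((\<Union>m. A m) - (\<Union>m<n. A m)) = measure \<mu> (\<Union>m. A m) - measure \<mu> (\<Union>m<n. A m)"
    using Am UA by (intro finite_measure_Diff) auto
  also have "measure \<mu> (\<Union>m<n. ?S m) \<le> (\<Sum>m<n. measure \<mu> (?S m))"
    using Am Cm by (intro measure_UNION_le) auto
  also have "(\<Sum>m<n. measure \<mu> (?S m)) \<le> (\<Sum>m<n. \<delta>)"
    using EC(4) by (intro sum_mono less_imp_le)
  also have "(\<Sum>m<n. \<delta>) \<le> \<epsilon> / 2"
    using \<open>\<epsilon> > 0\<close> by (simp add: \<delta>_def field_simps)
  finally have "measure \<mu> (((\<Union>m. A m) - D) \<union> (D - (\<Union>m. A m))) < \<epsilon>" using n by linarith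
  then show "\<exists>E C. finite E \<and> E \<subseteq> carrier G \<and> determined_by X E C \<and>
      measure \<mu> (((\<Union>m. A m) - C) \<union> (C - (\<Union>m. A m))) < \<epsilon>"
    using D EC(1,2) by (intro exI[of _ "\<Union>m<n. E m"] exI[of _ D]) auto
qed

lemma window_approximable: 
  assumes "A \<in> sets \<mu>" shows "window_approximable A"
  using assms unfolding sets_haar_determined
proof (induction rule: sigma_sets.induct)
  case (Basic C) then show ?case by (auto intro: window_approximable_determined)
next
  case Empty then show ?case
    by (rule window_approximable_determined[of "{}"]) (auto simp: determined_by_def)
next
  case (Compl A) then show ?case by (intro window_approximable_Compl)
next
  case (Union A) then show ?case by (intro window_approximable_Union)
qed

definition window_function :: "'g set \<Rightarrow> (('g \<Rightarrow> 'k) \<Rightarrow> 'a) \<Rightarrow> bool" where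
  "window_function E f \<longleftrightarrow> finite E \<and> E \<subseteq> carrier G \<and> (\<forall>x\<in>X. \<forall>y\<in>X. (\<forall>e\<in>E. x e = y e) \<longrightarrow> f x = f y)"

lemma window_function_determined: "window_function E f \<Longrightarrow> determined_by X E {x \<in> X. f x \<in> S}"
  unfolding window_function_def determined_by_def by (metis (mono_tags, lifting) mem_Collect_eq subsetI)

lemma window_function_measurable:
  assumes "window_function E f" "\<And>x. x \<in> X \<Longrightarrow> f x \<in> A"
  shows "f \<in> measurable \<mu> (count_space A)"
proof (rule measurableI)
  fix S assume "S \<in> sets (count_space A)"
  have "f -` S \<inter> space \<mu> = {x \<in> X. f x \<in> S}" by (auto simp: space_haar)
  then show "f -` S \<inter> space \<mu> \<in> sets \<mu>"
    using window_function_determined[OF assms(1), of S] determined_sets[of E] assms(1)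
    by (simp add: window_function_def)
qed (use assms in \<open>auto simp: space_haar\<close>)

text \<open>The approximating function can be chosen to refine any finite-window function that the given
  one refines: where the first choice of a value is incompatible, another value is taken.\<close>
lemma window_function_approx:
  assumes A: "finite A" and \<alpha>: "\<alpha> \<in> measurable \<mu> (count_space A)"
    and \<beta>: "window_function E0 \<beta>" and \<theta>: "\<And>x. x \<in> X \<Longrightarrow> \<theta> (\<alpha> x) = \<beta> x"
    and \<epsilon>: "\<epsilon> > 0"
  shows "\<exists>E \<alpha>'. window_function E \<alpha>' \<and> (\<forall>x\<in>X. \<alpha>' x \<in> A \<and> \<theta> (\<alpha>' x) = \<beta> x) \<and>
           measure \<mu> {x \<in> X. \<alpha> x \<noteq> \<alpha>' x} \<le> \<epsilon>"
proof -
  have \<alpha>A: "\<alpha> x \<in> A" if "x \<in> X" for x using measurable_space[OF \<alpha>, of x] that by (simp add: space_haar)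
  define L where "L a = {x \<in> X. \<alpha> x = a}" for a
  have L: "L a \<in> sets \<mu>" if "a \<in> A" for a
  proof -
    have "L a = \<alpha> -` {a} \<inter> space \<mu>" by (auto simp: L_def space_haar)
    then show ?thesis using measurable_sets[OF \<alpha>, of "{a}"] that by simp
  qed
  have cardA: "card A > 0" using A \<alpha>A X_nonempty by (auto simp: card_gt_0_iff)
  have "\<forall>a. \<exists>E C. a \<in> A \<longrightarrow> finite E \<and> E \<subseteq> carrier G \<and> determined_by X E C \<and>
      measure \<mu> ((L a - C) \<union> (C - L a)) < \<epsilon> / card A"
    using window_approximable[OF L] \<epsilon> cardA unfolding window_approximable_def
    by (meson divide_pos_pos of_nat_0_less_iff)
  then obtain E C where EC: "\<And>a. a \<in> A \<Longrightarrow> finite (E a)" "\<And>a. a \<in> A \<Longrightarrow> E a \<subseteq> carrier G"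
    "\<And>a. a \<in> A \<Longrightarrow> determined_by X (E a) (C a)"
    "\<And>a. a \<in> A \<Longrightarrow> measure \<mu> ((L a - C a) \<union> (C a - L a)) < \<epsilon> / card A" by metis
  have Cs: "C a \<in> sets \<mu>" if "a \<in> A" for a by (rule determined_sets[OF EC(1-3)[OF that]])
  define Q where "Q x a \<longleftrightarrow> a \<in> A \<and> x \<in> C a \<and> \<theta> a = \<beta> x" for x a
  define \<alpha>' where "\<alpha>' x = (if Ex (Q x) then Eps (Q x) else SOME a. a \<in> A \<and> \<theta> a = \<beta> x)" for x
  let ?E = "E0 \<union> (\<Union>a\<in>A. E a)"
  have "window_function ?E \<alpha>'"
    unfolding window_function_def
  proof (intro conjI ballI impI)
    show "finite ?E" "?E \<subseteq> carrier G" using A EC \<beta> by (auto simp: window_function_def)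
    fix x y assume xy: "x \<in> X" "y \<in> X" "\<forall>e\<in>?E. x e = y e"
    have b: "\<beta> x = \<beta> y" using xy \<beta> unfolding window_function_def by blast
    have "x \<in> C a \<longleftrightarrow> y \<in> C a" if "a \<in> A" for a
      using EC(3)[OF that] xy that unfolding determined_by_def by (metis UN_I UnI2)
    then have Q_eq: "Q x = Q y" using b by (auto simp: Q_def fun_eq_iff)
    show "\<alpha>' x = \<alpha>' y" by (simp only: \<alpha>'_def Q_eq b)
  qed
  moreover have \<alpha>': "\<alpha>' x \<in> A \<and> \<theta> (\<alpha>' x) = \<beta> x" if "x \<in> X" for x
  proof (cases "Ex (Q x)")
    case True
    then have "Q x (\<alpha>' x)" unfolding \<alpha>'_def by (simp add: someI_ex)
    then show ?thesis by (simp add: Q_def)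
  next
    case False
    then have "\<alpha>' x = (SOME a. a \<in> A \<and> \<theta> a = \<beta> x)" by (simp only: \<alpha>'_def if_False)
    then show ?thesis
      using someI[of "\<lambda>a. a \<in> A \<and> \<theta> a = \<beta> x" "\<alpha> x"] \<alpha>A[OF that] \<theta>[OF that] by simp
  qed
  moreover have "measure \<mu> {x \<in> X. \<alpha> x \<noteq> \<alpha>' x} \<le> \<epsilon>"
  proof -
    let ?S = "\<lambda>a. (L a - C a) \<union> (C a - L a)"
    have "{x \<in> X. \<alpha> x \<noteq> \<alpha>' x} \<subseteq> (\<Union>a\<in>A. ?S a)"
    proof (rule subsetI, rule ccontr)
      fix x assume x: "x \<in> {x \<in> X. \<alpha> x \<noteq> \<alpha>' x}" and nx: "x \<notin> (\<Union>a\<in>A. ?S a)"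
      have iff: "x \<in> C a \<longleftrightarrow> \<alpha> x = a" if "a \<in> A" for a
      proof -
        have "x \<notin> ?S a" using nx that by blast
        moreover have "x \<in> L a \<longleftrightarrow> \<alpha> x = a" using x by (simp add: L_def)
        ultimately show ?thesis by blast
      qed
      have Q\<alpha>: "Q x (\<alpha> x)" using \<alpha>A \<theta> x iff by (simp add: Q_def)
      have "Q x (\<alpha>' x)" unfolding \<alpha>'_def if_P[OF exI[of "Q x", OF Q\<alpha>]] by (rule someI[of "Q x", OF Q\<alpha>])
      then have "\<alpha>' x \<in> A \<and> x \<in> C (\<alpha>' x)" by (simp add: Q_def)
      then show False using iff x by auto
    qed
    then have "measure \<mu> {x \<in> X. \<alpha> x \<noteq> \<alpha>' x} \<le> measure \<mu> (\<Union>a\<in>A. ?S a)"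
      using L Cs A by (intro finite_measure_mono sets.finite_UN) auto
    also have "\<dots> \<le> (\<Sum>a\<in>A. measure \<mu> (?S a))"
      using L Cs A by (intro measure_UNION_le) auto
    also have "\<dots> \<le> (\<Sum>a\<in>A. \<epsilon> / card A)"
      using EC(4) by (intro sum_mono less_imp_le) auto
    also have "\<dots> = \<epsilon>" using cardA by simp
    finally show ?thesis .
  qed
  ultimately show ?thesis by blast
qed

end

section \<open>Ergodicity and independent windows\<close>

context alg_subshift
begin

lemma shift_xone: "g \<in> carrier G \<Longrightarrow> shift G g xone = xone"
  by (auto simp: shift_def fun_eq_iff)

lemma translate_inverse:
  assumes "g \<in> carrier G" "E \<subseteq> carrier G"
  shows "translate (inv g) (translate g E) = E"
proof -
  have "inv g \<otimes> (g \<otimes> e) = e" if "e \<in> E" for e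
    using that assms by (auto simp: G.m_assoc[symmetric])
  then show ?thesis by (simp add: image_image)
qed

text \<open>The product of the kernels of the projections to \<open>E\<close> and to \<open>F\<close>. Left multiplication by the first kernel
  and right multiplication by the second preserve it, so membership depends only on \<open>E\<close>, and also only
  on \<open>F\<close>.\<close>
definition kernel_product :: "'g set \<Rightarrow> 'g set \<Rightarrow> ('g \<Rightarrow> 'k) set" where
  "kernel_product E F = {xmult u v | u v. u \<in> X \<and> v \<in> X \<and> (\<forall>e\<in>E. u e = \<one>\<^bsub>K\<^esub>) \<and> (\<forall>e\<in>F. v e = \<one>\<^bsub>K\<^esub>)}"

lemma xone_kernel_product:
  assumes "E \<subseteq> carrier G" "F \<subseteq> carrier G" shows "xone \<in> kernel_product E F"
proof -
  have "xone = xmult xone xone" by (auto simp: xmult_def)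
  then show ?thesis using assms X_one unfolding kernel_product_def
    by (intro CollectI exI[of _ xone]) (auto simp: subset_iff)
qed

lemma kernel_product_determined_left:
  assumes E: "E \<subseteq> carrier G"
  shows "determined_by X E (kernel_product E F)"
  unfolding determined_by_def
proof (intro conjI ballI impI)
  show "kernel_product E F \<subseteq> X" by (auto simp: kernel_product_def X_mult)
  fix x y assume "x \<in> kernel_product E F" and y: "y \<in> X" and eq: "\<forall>e\<in>E. x e = y e"
  then obtain u v where uv: "x = xmult u v" "u \<in> X" "v \<in> X" "\<forall>e\<in>E. u e = \<one>\<^bsub>K\<^esub>" "\<forall>e\<in>F. v e = \<one>\<^bsub>K\<^esub>"
    unfolding kernel_product_def by blast
  define w where "w = xmult y (xinv v)"
  have w: "w \<in> X" using y uv by (simp add: w_def X_mult X_inv)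
  have "y = xmult w v"
  proof (rule X_ext)
    show "y h = xmult w v h" if "h \<in> carrier G" for h
      using that X_K[OF y that] X_K[OF uv(3) that]
      by (simp add: w_def xmult_apply xinv_apply K.m_assoc)
  qed (use y w uv in \<open>auto intro: X_mult\<close>)
  moreover have "w e = \<one>\<^bsub>K\<^esub>" if "e \<in> E" for e
  proof -
    have eG: "e \<in> carrier G" using that E by auto
    have "y e = v e" using eq[rule_format, OF that] uv(4) that eG X_K[OF uv(3) eG]
      by (simp add: uv(1) xmult_apply)
    then show ?thesis using eG X_K[OF uv(3) eG] by (simp add: w_def xmult_apply xinv_apply)
  qed
  ultimately show "y \<in> kernel_product E F" unfolding kernel_product_def using w uv by blast
qed

lemma kernel_product_determined_right:
  assumes F: "F \<subseteq> carrier G"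
  shows "determined_by X F (kernel_product E F)"
  unfolding determined_by_def
proof (intro conjI ballI impI)
  show "kernel_product E F \<subseteq> X" by (auto simp: kernel_product_def X_mult)
  fix x y assume "x \<in> kernel_product E F" and y: "y \<in> X" and eq: "\<forall>e\<in>F. x e = y e"
  then obtain u v where uv: "x = xmult u v" "u \<in> X" "v \<in> X" "\<forall>e\<in>E. u e = \<one>\<^bsub>K\<^esub>" "\<forall>e\<in>F. v e = \<one>\<^bsub>K\<^esub>"
    unfolding kernel_product_def by blast
  define w where "w = xmult (xinv u) y"
  have w: "w \<in> X" using y uv by (simp add: w_def X_mult X_inv)
  have "y = xmult u w"
  proof (rule X_ext)
    show "y h = xmult u w h" if "h \<in> carrier G" for h
      using that X_K[OF y that] X_K[OF uv(2) that]
      by (simp add: w_def xmult_apply xinv_apply K.m_assoc[symmetric])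
  qed (use y w uv in \<open>auto intro: X_mult\<close>)
  moreover have "w e = \<one>\<^bsub>K\<^esub>" if "e \<in> F" for e
  proof -
    have eG: "e \<in> carrier G" using that F by auto
    have "y e = u e" using eq[rule_format, OF that] uv(5) that eG X_K[OF uv(2) eG]
      by (simp add: uv(1) xmult_apply)
    then show ?thesis using eG X_K[OF uv(2) eG] by (simp add: w_def xmult_apply xinv_apply)
  qed
  ultimately show "y \<in> kernel_product E F" unfolding kernel_product_def using w uv by blast
qed

text \<open>To prescribe \<open>x\<close> on \<open>E\<close> and \<open>y\<close> on \<open>F\<close>, write \<open>y\<inverse> x = u v\<close> with \<open>u\<close> trivial on \<open>E\<close> and
  \<open>v\<close> trivial on \<open>F\<close>; then \<open>y v\<close> is as required.\<close>
lemma independent_windows_kernel_product: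
  assumes "E \<subseteq> carrier G" "F \<subseteq> carrier G" and full: "kernel_product E F = X"
  shows "independent_windows X E F"
  unfolding independent_windows_def
proof (intro ballI)
  fix x y assume x: "x \<in> X" and y: "y \<in> X"
  have "xmult (xinv y) x \<in> kernel_product E F" using x y full by (simp add: X_mult X_inv)
  then obtain u v where uv: "xmult (xinv y) x = xmult u v" "u \<in> X" "v \<in> X"
    "\<forall>e\<in>E. u e = \<one>\<^bsub>K\<^esub>" "\<forall>e\<in>F. v e = \<one>\<^bsub>K\<^esub>"
    unfolding kernel_product_def by blast
  have "xmult y v \<in> X" using y uv by (intro X_mult)
  moreover have "xmult y v e = x e" if "e \<in> E" for e
  proof -
    have eG: "e \<in> carrier G" using that assms by auto
    have "inv\<^bsub>K\<^esub> y e \<otimes>\<^bsub>K\<^esub> x e = v e"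
      using fun_cong[OF uv(1), of e] eG uv(4) that X_K[OF uv(3) eG] by (simp add: xmult_apply xinv_apply)
    then have "xmult y v e = y e \<otimes>\<^bsub>K\<^esub> (inv\<^bsub>K\<^esub> y e \<otimes>\<^bsub>K\<^esub> x e)" using eG by (simp add: xmult_apply)
    then show ?thesis using X_K[OF x eG] X_K[OF y eG] by (simp add: K.m_assoc[symmetric])
  qed
  moreover have "xmult y v e = y e" if "e \<in> F" for e
  proof -
    have eG: "e \<in> carrier G" using that assms by auto
    then show ?thesis using uv(5) that X_K[OF y eG] by (simp add: xmult_apply)
  qed
  ultimately show "\<exists>z\<in>X. (\<forall>e\<in>E. z e = x e) \<and> (\<forall>e\<in>F. z e = y e)" by blast
qed

end

context haar_subshift
begin

text \<open>The condition \<open>xone \<in> M\<close> is invariant under the shift, and it keeps intersections of translates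
  nonempty.\<close>
definition pointed_window_sets :: "('g \<Rightarrow> 'k) set set" where
  "pointed_window_sets = {M. (\<exists>E. finite E \<and> E \<subseteq> carrier G \<and> determined_by X E M) \<and> xone \<in> M \<and> M \<noteq> X}"

lemma shift_pointed_window_sets:
  assumes g: "g \<in> carrier G" and M: "M \<in> pointed_window_sets"
  shows "shift G g ` M \<in> pointed_window_sets"
proof -
  obtain E where E: "finite E" "E \<subseteq> carrier G" "determined_by X E M" and one: "xone \<in> M" and ne: "M \<noteq> X"
    using M by (auto simp: pointed_window_sets_def)
  have MX: "M \<subseteq> X" using E(3) by (rule determined_by_subset)
  have "\<exists>E. finite E \<and> E \<subseteq> carrier G \<and> determined_by X E (shift G g ` M)"
    using determined_by_shift[OF g E(2,3)] E g by (intro exI[of _ "translate g E"]) auto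
  moreover have "xone \<in> shift G g ` M" using one shift_xone[OF g] by (metis imageI)
  moreover have "shift G g ` M \<noteq> X"
  proof
    assume eq: "shift G g ` M = X"
    have "x \<in> M" if x: "x \<in> X" for x
    proof -
      have "shift G g x \<in> shift G g ` M" using eq X_shift[OF g x] by simp
      then show ?thesis
        using shift_image_eq[OF g MX] shift_inv_cancel(2)[OF g X_extensional[OF x]] by simp
    qed
    then show False using MX ne by blast
  qed
  ultimately show ?thesis by (simp add: pointed_window_sets_def)
qed

text \<open>The intersection of a finite orbit would be an invariant set with a finite window, which contains
  the identity and is not all of \<open>X\<close>; such a set has measure strictly between 0 and 1. This is the only
  use of ergodicity.\<close>
lemma infinite_orbit_pointed_window_set:
  assumes erg: "ergodic_action G (shift G) \<mu>" and M: "M \<in> pointed_window_sets"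
  shows "infinite ((\<lambda>g. shift G g ` M) ` carrier G)"
proof
  assume "finite ((\<lambda>g. shift G g ` M) ` carrier G)"
  then obtain T where T: "T \<subseteq> carrier G" "finite T"
    "(\<lambda>g. shift G g ` M) ` carrier G = (\<lambda>g. shift G g ` M) ` T"
    using finite_subset_image[of "(\<lambda>g. shift G g ` M) ` carrier G" "\<lambda>g. shift G g ` M" "carrier G"] by blast
  obtain E where E: "finite E" "E \<subseteq> carrier G" "determined_by X E M" and one: "xone \<in> M" and ne: "M \<noteq> X"
    using M by (auto simp: pointed_window_sets_def)
  have MX: "M \<subseteq> X" using E(3) by (rule determined_by_subset)
  define I where "I = (\<Inter>g\<in>carrier G. shift G g ` M)"
  have I_T: "I = (\<Inter>g\<in>T. shift G g ` M)" unfolding I_def using T(3) by simp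
  have I_iff: "x \<in> I \<longleftrightarrow> x \<in> X \<and> (\<forall>g\<in>carrier G. shift G (inv g) x \<in> M)" for x
    unfolding I_def using shift_image_eq[OF _ MX] by auto
  define E' where "E' = (\<Union>g\<in>T. translate g E)"
  have E': "finite E'" "E' \<subseteq> carrier G" using T E by (auto simp: E'_def)
  have I_det: "determined_by X E' I"
    unfolding determined_by_def
  proof (intro conjI ballI impI)
    show "I \<subseteq> X" by (auto simp: I_iff)
    fix x y assume x: "x \<in> I" and y: "y \<in> X" and eq: "\<forall>e\<in>E'. x e = y e"
    show "y \<in> I" unfolding I_T
    proof
      fix g assume g: "g \<in> T"
      then have "\<forall>e\<in>translate g E. x e = y e" using eq by (auto simp: E'_def)
      moreover have "x \<in> shift G g ` M" using x g I_T by auto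
      ultimately show "y \<in> shift G g ` M"
        using determined_by_shift[of g E M] g T E y unfolding determined_by_def by blast
    qed
  qed
  have I_sets: "I \<in> sets \<mu>" by (rule determined_sets[OF E' I_det])
  have "shift G h ` I = I" if h: "h \<in> carrier G" for h
  proof -
    have IX: "I \<subseteq> X" using I_det by (rule determined_by_subset)
    have "shift G (inv h) x \<in> I \<longleftrightarrow> x \<in> I" if x: "x \<in> X" for x
    proof -
      have eq: "shift G (inv g) (shift G (inv h) x) = shift G (inv (h \<otimes> g)) x"
        if "g \<in> carrier G" for g
        using that h by (simp add: shift_mult[symmetric] G.inv_mult_group)
      have surj: "\<exists>g\<in>carrier G. k = h \<otimes> g" if "k \<in> carrier G" for k
        using that h by (intro bexI[of _ "inv h \<otimes> k"]) (auto simp: G.m_assoc[symmetric])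
      have "(\<forall>g\<in>carrier G. shift G (inv (h \<otimes> g)) x \<in> M) \<longleftrightarrow> (\<forall>k\<in>carrier G. shift G (inv k) x \<in> M)"
        using surj h by (metis G.m_closed)
      then show ?thesis using x h X_shift[of "inv h" x] by (simp add: I_iff eq)
    qed
    then show ?thesis using shift_image_eq[OF h IX] IX by auto
  qed
  then have "emeasure \<mu> I = 0 \<or> emeasure \<mu> (X - I) = 0"
    using erg I_sets by (simp add: ergodic_action_def space_haar)
  moreover have "I \<noteq> {}" "X - I \<noteq> {}"
  proof -
    have "xone \<in> I" using X_one one by (auto simp: I_iff shift_xone)
    then show "I \<noteq> {}" by auto
    have "I \<subseteq> M"
      using I_iff shift_one X_extensional G.one_closed G.inv_one by (metis subsetI)
    then show "X - I \<noteq> {}" using MX ne by blast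
  qed
  ultimately show False
    using haar_determined_pos[OF E' I_det] haar_determined_pos[OF E' determined_by_Diff[OF I_det]]
    by (auto simp: measure_def)
qed

text \<open>Suppose \<open>f 0, \<dots>, f (k - 1)\<close> are chosen. The family \<open>L\<close> of proper pointed sets with window \<open>E\<close> is finite. If \<open>g\<close>
  moves \<open>L\<close> away from all \<open>f j ` L\<close>, the kernel product of the windows \<open>g E\<close> and \<open>f j E\<close> must be \<open>X\<close>, since
  otherwise it would belong to both \<open>g ` L\<close> and \<open>f j ` L\<close>. If \<open>L\<close> is empty, the elements \<open>f i\<close>
  may coincide, since then every window \<open>g E\<close> is independent of itself.\<close>
lemma independent_translates:
  assumes erg: "ergodic_action G (shift G) \<mu>" and E: "finite E" "E \<subseteq> carrier G"
  shows "\<exists>f. (\<forall>i. f i \<in> carrier G) \<and> (\<forall>i<k::nat. \<forall>j<i.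
           independent_windows X (translate (f i) E) (translate (f j) E))"
proof (induction k)
  case 0
  then show ?case by (intro exI[of _ "\<lambda>_. \<one>"]) auto
next
  case (Suc k)
  then obtain f where f: "\<And>i. f i \<in> carrier G"
    "\<And>i j. i < k \<Longrightarrow> j < i \<Longrightarrow> independent_windows X (translate (f i) E) (translate (f j) E)" by auto
  define L where "L = {M. determined_by X E M \<and> xone \<in> M \<and> M \<noteq> X}"
  have L_sub: "L \<subseteq> pointed_window_sets" using E by (auto simp: L_def pointed_window_sets_def)
  have "finite L"
  proof (rule finite_imageD)
    show "inj_on (patterns E) L" by (rule inj_onI, rule determined_by_eqI[of X E]) (simp_all add: L_def)
    have "patterns E ` L \<subseteq> Pow (patterns E X)" by (auto simp: L_def patterns_def dest: determined_by_subset)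
    then show "finite (patterns E ` L)"
      using patterns_finite[OF E subset_refl] by (meson finite_Pow_iff finite_subset)
  qed
  define \<Delta> where "\<Delta> = (\<Union>i<k. (\<lambda>M. shift G (f i) ` M) ` L)"
  have "finite \<Delta>" using \<open>finite L\<close> by (auto simp: \<Delta>_def)
  have "\<exists>g\<in>carrier G. \<forall>M\<in>L. shift G g ` M \<notin> \<Delta>"
  proof (rule G.neumann_separation[where \<Omega> = pointed_window_sets and act = "\<lambda>g M. shift G g ` M"])
    show "shift G \<one> ` M = M" if "M \<in> pointed_window_sets" for M
    proof -
      have "M \<subseteq> X" using that by (auto simp: pointed_window_sets_def dest: determined_by_subset)
      then have "shift G \<one> x = x" if "x \<in> M" for x using that X_extensional shift_one by blast
      then show ?thesis by simp
    qed
  qed (use \<open>finite L\<close> L_sub \<open>finite \<Delta>\<close> shift_image_mult shift_pointed_window_sets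
        infinite_orbit_pointed_window_set[OF erg] in \<open>simp_all\<close>)
  then obtain g where g: "g \<in> carrier G" "\<And>M. M \<in> L \<Longrightarrow> shift G g ` M \<notin> \<Delta>" by blast
  have ind: "independent_windows X (translate g E) (translate (f j) E)" if j: "j < k" for j
  proof (rule independent_windows_kernel_product)
    let ?gE = "translate g E" and ?fE = "translate (f j) E"
    let ?P = "kernel_product ?gE ?fE"
    show sub: "?gE \<subseteq> carrier G" "?fE \<subseteq> carrier G" using g f E by auto
    show "?P = X"
    proof (rule ccontr)
      assume ne: "?P \<noteq> X"
      have PX: "?P \<subseteq> X" using kernel_product_determined_left[OF sub(1)] by (rule determined_by_subset)
      have in_L: "shift G (inv h) ` ?P \<in> L"
        if h: "h \<in> carrier G" and det: "determined_by X (translate h E) ?P" for h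
      proof -
        have hi: "inv h \<in> carrier G" using h by auto
        have hE: "finite (translate h E)" "translate h E \<subseteq> carrier G" using h E by auto
        have "?P \<in> pointed_window_sets"
          unfolding pointed_window_sets_def using det hE ne xone_kernel_product[OF sub] by blast
        then have "shift G (inv h) ` ?P \<in> pointed_window_sets" by (rule shift_pointed_window_sets[OF hi])
        moreover have "determined_by X E (shift G (inv h) ` ?P)"
          using determined_by_shift[OF hi hE(2) det] by (simp only: translate_inverse[OF h E(2)])
        ultimately show ?thesis by (simp add: L_def pointed_window_sets_def)
      qed
      have cancel: "shift G h ` shift G (inv h) ` ?P = ?P" if h: "h \<in> carrier G" for h
      proof -
        have "shift G h (shift G (inv h) x) = x" if "x \<in> ?P" for x
          using that PX h by (intro shift_inv_cancel X_extensional) auto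
        then show ?thesis by (simp add: image_image)
      qed
      have "?P \<notin> \<Delta>"
        using g(2)[OF in_L[OF g(1) kernel_product_determined_left[OF sub(1)]]] by (simp only: cancel[OF g(1)]) simp
      moreover have "?P \<in> \<Delta>"
        unfolding \<Delta>_def using j in_L[OF f(1) kernel_product_determined_right[OF sub(2)]]
        by (intro UN_I[of j] image_eqI[of _ _ "shift G (inv f j) ` ?P"]) (simp_all only: cancel[OF f(1)] lessThan_iff)
      ultimately show False by blast
    qed
  qed
  show ?case
  proof (intro exI[of _ "f(k := g)"] conjI allI impI)
    show "(f(k := g)) i \<in> carrier G" for i using f g by simp
    fix i j assume "i < Suc k" "j < i"
    then show "independent_windows X (translate ((f(k := g)) i) E) (translate ((f(k := g)) j) E)"
      using f(2) ind by (cases "i = k") auto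
  qed
qed

end

section \<open>Periodic points as configurations on the cosets\<close>

context alg_subshift
begin

text \<open>At \<open>h\<close> this reads \<open>a\<close> at the coset to which the sofic approximation sends \<open>i\<close> under the inverse of \<open>h\<close>. The
  inverse matches the one in the definition of the shift, so that the pullback is equivariant.\<close>
definition pullback :: "('g set \<Rightarrow> 'k) \<Rightarrow> 'g set \<Rightarrow> 'g \<Rightarrow> 'k" where
  "pullback a i = (\<lambda>h\<in>carrier G. a (i #> h))"

definition periodic_configs :: "'g set \<Rightarrow> ('g set \<Rightarrow> 'k) set" where
  "periodic_configs H = {a \<in> (rcosets H) \<rightarrow>\<^sub>E carrier K. \<forall>i\<in>rcosets H. pullback a i \<in> X}"

lemma pullback_apply: "h \<in> carrier G \<Longrightarrow> pullback a i h = a (i #> h)"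
  by (simp add: pullback_def)

end

locale finite_quotient = alg_subshift G K X
  for G :: "('g, 'm) monoid_scheme" (structure) and K :: "('k, 'l) monoid_scheme" and X :: "('g \<Rightarrow> 'k) set" +
  fixes H :: "'g set"
  assumes normal: "H \<lhd> G" and finite_index: "finite (rcosets H)"
begin

abbreviation D :: "'g set set" where "D \<equiv> rcosets H"

lemma subgroup_H: "subgroup H G"
  using normal by (simp add: normal_def)

lemma H_sub: "H \<subseteq> carrier G"
  using subgroup_H by (rule subgroup.subset)

lemma D_sub: "i \<in> D \<Longrightarrow> i \<subseteq> carrier G"
  using subgroup.rcosets_carrier[OF subgroup_H G.is_group] by simp

lemma D_ex: "i \<in> D \<Longrightarrow> \<exists>u\<in>carrier G. i = H #> u"
  by (auto simp: RCOSETS_def)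

lemma D_translate: "i \<in> D \<Longrightarrow> h \<in> carrier G \<Longrightarrow> i #> h \<in> D"
  using D_ex[of i] H_sub by (auto simp: G.coset_mult_assoc intro!: G.rcosetsI)

lemma D_translate_mult:
  "i \<in> D \<Longrightarrow> g \<in> carrier G \<Longrightarrow> h \<in> carrier G \<Longrightarrow> (i #> g) #> h = i #> (g \<otimes> h)"
  by (simp add: G.coset_mult_assoc D_sub)

lemma D_translate_one: "i \<in> D \<Longrightarrow> i #> \<one> = i"
  by (simp add: G.coset_mult_one D_sub)

lemma D_transitive:
  assumes "i \<in> D" "j \<in> D" shows "\<exists>w\<in>carrier G. j = i #> w"
proof -
  obtain u v where uv: "u \<in> carrier G" "i = H #> u" "v \<in> carrier G" "j = H #> v"
    using D_ex assms by metis
  then have "j = i #> (inv u \<otimes> v)"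
    using H_sub by (simp add: G.coset_mult_assoc G.m_assoc[symmetric])
  then show ?thesis using uv by blast
qed

lemma D_nonempty: "D \<noteq> {}"
  using G.rcosetsI[OF H_sub G.one_closed] by auto

lemma card_D_pos: "0 < card D"
  using D_nonempty finite_index by (simp add: card_gt_0_iff)

lemma bij_D_translate:
  assumes g: "g \<in> carrier G" shows "bij_betw (\<lambda>i. i #> g) D D"
  by (rule bij_betw_byWitness[where f' = "\<lambda>i. i #> inv g"])
    (use g in \<open>auto simp: D_translate_mult D_translate_one intro: D_translate\<close>)

text \<open>By normality; this is why pullbacks of configurations are fixed by \<open>H\<close>.\<close>
lemma D_absorb:
  assumes i: "i \<in> D" and g: "g \<in> H" shows "i #> g = i"
proof -
  obtain u where u: "u \<in> carrier G" "i = H #> u" using D_ex[OF i] by blast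
  have gG: "g \<in> carrier G" using g H_sub by auto
  have "u \<otimes> g \<otimes> inv u \<in> H" using normal.inv_op_closed2[OF normal] u g by simp
  then have "H #> (u \<otimes> g \<otimes> inv u) = H"
    using subgroup.rcos_const[OF subgroup_H G.is_group] by simp
  then have "H #> (u \<otimes> g \<otimes> inv u) #> u = i" using u by simp
  moreover have "H #> (u \<otimes> g \<otimes> inv u) #> u = i #> g"
    using u gG H_sub by (simp add: G.coset_mult_assoc G.m_assoc)
  ultimately show ?thesis by simp
qed

lemma coset_sofic_D: "i \<in> D \<Longrightarrow> g \<in> carrier G \<Longrightarrow> coset_sofic G g i \<in> D"
  by (simp add: coset_sofic_def D_translate)

lemma pullback_equivariant:
  assumes "i \<in> D" "g \<in> carrier G"
  shows "pullback a (coset_sofic G g i) = shift G g (pullback a i)"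
  using assms by (auto simp: pullback_def shift_def coset_sofic_def D_translate_mult fun_eq_iff)

lemma pullback_full: "a \<in> D \<rightarrow>\<^sub>E carrier K \<Longrightarrow> i \<in> D \<Longrightarrow> pullback a i \<in> carrier G \<rightarrow>\<^sub>E carrier K"
  by (auto simp: pullback_def intro: D_translate)

lemma periodic_configs_finite: "finite (periodic_configs H)"
  by (rule finite_subset[of _ "D \<rightarrow>\<^sub>E carrier K"])
    (auto simp: periodic_configs_def intro: finite_PiE finite_index finite_K)

text \<open>For every base coset \<open>i\<close>, not only for \<open>H\<close> itself; this is what permits averaging over \<open>i\<close> in the variance
  estimate. For surjectivity, a fixed point \<open>x\<close> is constant along the cosets after a translation, so its
  values at arbitrary representatives define the configuration.\<close>
lemma bij_pullback:
  assumes i: "i \<in> D"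
  shows "bij_betw (\<lambda>a. pullback a i) (periodic_configs H) (fixed_points G H X)"
  unfolding bij_betw_def
proof
  show "inj_on (\<lambda>a. pullback a i) (periodic_configs H)"
  proof (rule inj_onI)
    fix a b assume a: "a \<in> periodic_configs H" and b: "b \<in> periodic_configs H"
      and eq: "pullback a i = pullback b i"
    show "a = b"
    proof (rule extensionalityI)
      show "a \<in> extensional D" "b \<in> extensional D" using a b by (auto simp: periodic_configs_def PiE_def)
      fix j assume "j \<in> D"
      then obtain w where "w \<in> carrier G" "j = i #> w" using D_transitive[OF i] by blast
      then show "a j = b j" using fun_cong[OF eq, of w] by (simp add: pullback_apply)
    qed
  qed
  show "(\<lambda>a. pullback a i) ` periodic_configs H = fixed_points G H X"
  proof
    show "(\<lambda>a. pullback a i) ` periodic_configs H \<subseteq> fixed_points G H X"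
    proof
      fix x assume "x \<in> (\<lambda>a. pullback a i) ` periodic_configs H"
      then obtain a where a: "a \<in> periodic_configs H" "x = pullback a i" by blast
      have "shift G g x = x" if g: "g \<in> H" for g
      proof -
        have gG: "g \<in> carrier G" using g H_sub by auto
        have "coset_sofic G g i = i"
          using D_absorb[OF i] subgroup.m_inv_closed[OF subgroup_H g] by (simp add: coset_sofic_def)
        then show ?thesis using pullback_equivariant[OF i gG, of a] a by simp
      qed
      then show "x \<in> fixed_points G H X" using a i by (auto simp: fixed_points_def periodic_configs_def)
    qed
    show "fixed_points G H X \<subseteq> (\<lambda>a. pullback a i) ` periodic_configs H"
    proof
      fix x assume "x \<in> fixed_points G H X"
      then have x: "x \<in> X" and fx: "\<And>g. g \<in> H \<Longrightarrow> shift G g x = x" by (auto simp: fixed_points_def)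
      have xH: "x (n \<otimes> h) = x h" if "n \<in> H" "h \<in> carrier G" for n h
      proof -
        have n: "inv n \<in> H" "n \<in> carrier G" using that H_sub subgroup.m_inv_closed[OF subgroup_H] by auto
        show ?thesis using fun_cong[OF fx[OF n(1)], of h] that n by (simp add: shift_apply)
      qed
      obtain u where u: "u \<in> carrier G" "i = H #> u" using D_ex[OF i] by blast
      define r where "r j = (SOME r. r \<in> j)" for j :: "'g set"
      define a where "a = (\<lambda>j\<in>D. x (inv u \<otimes> r j))"
      have ax: "a (H #> w) = x (inv u \<otimes> w)" if w: "w \<in> carrier G" for w
      proof -
        have "w \<in> H #> w" using G.rcos_self[OF w subgroup_H] .
        then have "r (H #> w) \<in> H #> w" unfolding r_def by (rule someI)
        then obtain n where n: "n \<in> H" "r (H #> w) = n \<otimes> w" by (auto simp: r_coset_def)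
        have nG: "n \<in> carrier G" using n H_sub by auto
        have nn: "inv u \<otimes> n \<otimes> u \<in> H" using normal.inv_op_closed1[OF normal] u n by simp
        have "inv u \<otimes> (n \<otimes> w) = (inv u \<otimes> n \<otimes> u) \<otimes> (inv u \<otimes> w)"
        proof -
          have "u \<otimes> (inv u \<otimes> w) = w" using u w by (simp add: G.m_assoc[symmetric])
          then show ?thesis using u nG w by (simp add: G.m_assoc)
        qed
        then have "x (inv u \<otimes> (n \<otimes> w)) = x (inv u \<otimes> w)"
          using xH[OF nn, of "inv u \<otimes> w"] u w by simp
        then show ?thesis using w n H_sub by (simp add: a_def G.rcosetsI)
      qed
      have pb: "pullback a i = x"
      proof (rule extensionalityI)
        show "pullback a i \<in> extensional (carrier G)" by (simp add: pullback_def)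
        show "x \<in> extensional (carrier G)" using X_extensional x .
        fix h assume h: "h \<in> carrier G"
        have "pullback a i h = a (H #> (u \<otimes> h))"
          using h u H_sub by (simp add: pullback_apply G.coset_mult_assoc)
        also have "\<dots> = x h" using ax[of "u \<otimes> h"] u h by (simp add: G.m_assoc[symmetric])
        finally show "pullback a i h = x h" .
      qed
      have "a \<in> D \<rightarrow>\<^sub>E carrier K"
      proof (rule PiE_I)
        fix j assume "j \<in> D"
        then obtain w where "w \<in> carrier G" "j = H #> w" using D_ex by blast
        then show "a j \<in> carrier K" using ax u X_K[OF x] by simp
      qed (simp add: a_def)
      moreover have "pullback a j \<in> X" if j: "j \<in> D" for j
      proof -
        obtain w where w: "w \<in> carrier G" "j = i #> w" using D_transitive[OF i j] by blast
        have "pullback a j = shift G (inv w) x"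
          using pullback_equivariant[OF i, of "inv w" a] w pb by (simp add: coset_sofic_def)
        then show ?thesis using X_shift x w by simp
      qed
      ultimately have "a \<in> periodic_configs H" by (simp add: periodic_configs_def)
      then show "x \<in> (\<lambda>a. pullback a i) ` periodic_configs H" using pb by blast
    qed
  qed
qed

lemma finite_fixed: "finite (fixed_points G H X)"
  and card_fixed: "card (fixed_points G H X) = card (periodic_configs H)"
  using D_nonempty bij_pullback periodic_configs_finite bij_betw_finite bij_betw_same_card by (metis ex_in_conv)+

lemma pointwise_subgroup_fixed: "pointwise_subgroup (fixed_points G H X)"
  unfolding pointwise_subgroup_def
proof (intro conjI ballI)
  have gG: "g \<in> carrier G" if "g \<in> H" for g using that H_sub by auto
  show "fixed_points G H X \<subseteq> carrier G \<rightarrow>\<^sub>E carrier K" using X_sub by (auto simp: fixed_points_def)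
  show "xone \<in> fixed_points G H X" using X_one shift_xone gG by (auto simp: fixed_points_def)
  fix x assume x: "x \<in> fixed_points G H X"
  have "shift G g (xinv x) = xinv (shift G g x)" if "g \<in> H" for g
    using gG[OF that] by (auto simp: shift_def xinv_def fun_eq_iff)
  then show "xinv x \<in> fixed_points G H X" using x X_inv by (auto simp: fixed_points_def)
  fix y assume y: "y \<in> fixed_points G H X"
  have "shift G g (xmult x y) = xmult (shift G g x) (shift G g y)" if "g \<in> H" for g
    using gG[OF that] by (auto simp: shift_def xmult_def fun_eq_iff)
  then show "xmult x y \<in> fixed_points G H X" using x y X_mult by (auto simp: fixed_points_def)
qed

lemma fixed_nonempty: "fixed_points G H X \<noteq> {}"
  using pointwise_subgroup_fixed by (auto simp: pointwise_subgroup_def)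

lemma card_periodic_pos: "0 < card (periodic_configs H)"
  using fixed_nonempty finite_fixed card_fixed by (metis card_gt_0_iff)

lemma xmult_inj: "y \<in> X \<Longrightarrow> inj_on (xmult y) X"
proof (rule inj_onI)
  fix u v assume y: "y \<in> X" and uv: "u \<in> X" "v \<in> X" and eq: "xmult y u = xmult y v"
  show "u = v"
  proof (rule X_ext)
    fix h assume h: "h \<in> carrier G"
    then show "u h = v h"
      using fun_cong[OF eq, of h] X_K[OF y h] X_K[OF uv(1) h] X_K[OF uv(2) h] by (simp add: xmult_apply)
  qed (use uv in auto)
qed

text \<open>Once the periodic points realise all patterns on the window, they are equidistributed there with
  respect to Haar measure: both proportions count patterns.\<close>
lemma card_fixed_determined:
  assumes E: "finite E" "E \<subseteq> carrier G" and pat: "patterns E (fixed_points G H X) = patterns E X"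
    and C: "determined_by X E C"
  shows "real (card (C \<inter> fixed_points G H X)) / real (card (fixed_points G H X))
      = real (card (patterns E C)) / real (card (patterns E X))"
proof -
  let ?Z = "fixed_points G H X"
  have ZX: "?Z \<subseteq> X" by (auto simp: fixed_points_def)
  have Cdet: "determined_by ?Z E (C \<inter> ?Z)"
    unfolding determined_by_def
  proof (intro conjI ballI impI)
    fix x y assume "x \<in> C \<inter> ?Z" "y \<in> ?Z" "\<forall>e\<in>E. x e = y e"
    then show "y \<in> C \<inter> ?Z" using C ZX unfolding determined_by_def by blast
  qed auto
  have "measure (uniform_count_measure ?Z) (C \<inter> ?Z) = real (card (patterns E (C \<inter> ?Z))) / real (card (patterns E ?Z))"
  proof (rule measure_determined[OF pointwise_subgroup_fixed E])
    show "finite_measure (uniform_count_measure ?Z)"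
      using finite_fixed fixed_nonempty
      by (intro finite_measureI) (simp add: space_uniform_count_measure emeasure_uniform_count_measure)
    show "measure (uniform_count_measure ?Z) ?Z = 1"
      using finite_fixed fixed_nonempty by (simp add: measure_uniform_count_measure)
    show "C \<in> sets (uniform_count_measure ?Z)" if "determined_by ?Z E C" for C
      using determined_by_subset[OF that] by (simp add: sets_uniform_count_measure)
    show "measure (uniform_count_measure ?Z) (xmult y ` A) = measure (uniform_count_measure ?Z) A"
      if y: "y \<in> ?Z" and A: "A \<in> sets (uniform_count_measure ?Z)" for y A
    proof -
      have A: "A \<subseteq> ?Z" using A by (simp add: sets_uniform_count_measure)
      have "xmult y ` A \<subseteq> ?Z" using y A pointwise_subgroup_fixed by (auto simp: pointwise_subgroup_def)
      moreover have "card (xmult y ` A) = card A"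
        using y A ZX by (intro card_image inj_on_subset[OF xmult_inj[of y]]) auto
      ultimately show ?thesis using A finite_fixed by (simp add: measure_uniform_count_measure)
    qed
    show "determined_by ?Z E (C \<inter> ?Z)" by (rule Cdet)
  qed
  moreover have "patterns E (C \<inter> ?Z) = patterns E C"
  proof
    show "patterns E (C \<inter> ?Z) \<subseteq> patterns E C" by (auto simp: patterns_def)
    show "patterns E C \<subseteq> patterns E (C \<inter> ?Z)"
    proof
      fix p assume "p \<in> patterns E C"
      then obtain x where x: "x \<in> C" "p = restrict x E" by (auto simp: patterns_def)
      then have "p \<in> patterns E ?Z" using pat determined_by_subset[OF C] by (auto simp: patterns_def)
      then obtain z where z: "z \<in> ?Z" "p = restrict z E" by (auto simp: patterns_def)
      then have "\<forall>e\<in>E. x e = z e" using x by (simp add: restrict_eq_iff[symmetric])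
      then have "z \<in> C" using C x z ZX unfolding determined_by_def by blast
      then show "p \<in> patterns E (C \<inter> ?Z)" using z by (auto simp: patterns_def)
    qed
  qed
  ultimately show ?thesis using pat finite_fixed by (simp add: measure_uniform_count_measure)
qed

end

section \<open>Equidistribution of periodic orbits\<close>

definition (in alg_subshift) visit_frequency :: "'g set \<Rightarrow> ('g set \<Rightarrow> 'k) \<Rightarrow> ('g \<Rightarrow> 'k) set \<Rightarrow> real" where
  "visit_frequency H a C =
     real (card {i \<in> rcosets H. pullback a i \<in> C}) / real (card (rcosets H))"

locale haar_quotient = haar_subshift G K X \<mu> + finite_quotient G K X H
  for G :: "('g, 'm) monoid_scheme" (structure) and K :: "('k, 'l) monoid_scheme" and X :: "('g \<Rightarrow> 'k) set"
    and \<mu> :: "('g \<Rightarrow> 'k) measure" and H :: "'g set"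
begin

lemma card_fixed_haar:
  assumes E: "finite E" "E \<subseteq> carrier G" "patterns E (fixed_points G H X) = patterns E X"
    and C: "determined_by X E C"
  shows "(\<Sum>x\<in>fixed_points G H X. indicator C x) = measure \<mu> C * real (card (fixed_points G H X))"
proof -
  have "(\<Sum>x\<in>fixed_points G H X. indicator C x) = real (card (C \<inter> fixed_points G H X))"
    using finite_fixed by (simp add: indicator_def sum.If_cases Int_commute)
  moreover have "0 < card (fixed_points G H X)" using card_periodic_pos card_fixed by simp
  ultimately show ?thesis
    using card_fixed_determined[OF E C] haar_determined[OF E(1,2) C] by (simp add: field_simps)
qed

text \<open>Independent events are orthogonal after centring, so only the diagonal terms of the second
  moment survive.\<close>
lemma second_moment:
  assumes E: "finite E" "E \<subseteq> carrier G" and C: "determined_by X E C"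
    and f: "\<And>i. f i \<in> carrier G"
    and ind: "\<And>i j. i < k \<Longrightarrow> j < i \<Longrightarrow>
      independent_windows X (translate (f i) E) (translate (f j) E)"
    and E': "finite E'" "E' \<subseteq> carrier G" "patterns E' (fixed_points G H X) = patterns E' X"
    and sub: "(\<Union>i<k. translate (f i) E) \<subseteq> E'"
  shows "(\<Sum>x\<in>fixed_points G H X. (\<Sum>i<k. indicator (shift G (f i) ` C) x - measure \<mu> C)\<^sup>2)
      \<le> real k * real (card (fixed_points G H X))"
proof -
  let ?Z = "fixed_points G H X"
  define c where "c = measure \<mu> C"
  define A where "A i = shift G (f i) ` C" for i
  define d where "d i x = indicator (A i) x - c" for i x
  have c: "0 \<le> c" "c \<le> 1"
    using finite_measure_mono[of C X] determined_by_subset[OF C] measure_haar sets.top[of \<mu>]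
    by (auto simp: c_def space_haar)
  have win: "finite (translate (f i) E)" "translate (f i) E \<subseteq> carrier G" for i
    using E f by auto
  have det: "determined_by X (translate (f i) E) (A i)" for i
    unfolding A_def by (rule determined_by_shift[OF f E(2) C])
  have det': "determined_by X E' (A i)" if "i < k" for i
    by (rule determined_by_mono[OF det]) (use that sub in blast)
  have \<mu>A: "measure \<mu> (A i) = c" for i
    unfolding A_def c_def by (rule haar_shift_determined[OF f E C])
  have sumA: "(\<Sum>x\<in>?Z. indicator (A i) x) = c * real (card ?Z)" if "i < k" for i
    using card_fixed_haar[OF E' det'[OF that]] by (simp add: \<mu>A)
  have cov: "(\<Sum>x\<in>?Z. d i x * d j x) = 0" if "i < k" "j < i" for i j
  proof -
    have "measure \<mu> (A i \<inter> A j) = c * c"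
      using haar_independent[OF win det win det ind[OF that]] by (simp add: \<mu>A)
    then have "(\<Sum>x\<in>?Z. indicator (A i \<inter> A j) x) = c * c * real (card ?Z)"
      using card_fixed_haar[OF E' determined_by_Int[OF det' det']] that by simp
    moreover have "(\<Sum>x\<in>?Z. d i x * d j x) = (\<Sum>x\<in>?Z. indicator (A i \<inter> A j) x)
        - c * (\<Sum>x\<in>?Z. indicator (A i) x) - c * (\<Sum>x\<in>?Z. indicator (A j) x) + c * c * real (card ?Z)"
      by (simp add: d_def indicator_inter_arith algebra_simps sum.distrib sum_subtractf sum_distrib_left)
    ultimately show ?thesis using sumA[of i] sumA[of j] that by simp
  qed
  have cov': "(\<Sum>x\<in>?Z. d i x * d j x) \<le> (if i = j then real (card ?Z) else 0)" if "i < k" "j < k" for i j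
  proof (cases "i = j")
    case True
    have "d i x * d i x \<le> 1" for x
      using c by (cases "x \<in> A i") (auto simp: d_def intro!: mult_le_one)
    then have "(\<Sum>x\<in>?Z. d i x * d i x) \<le> (\<Sum>x\<in>?Z. 1)" by (intro sum_mono)
    then show ?thesis using True by simp
  next
    case False
    then consider "j < i" | "i < j" by linarith
    then show ?thesis
    proof cases
      case 1 then show ?thesis using cov[of i j] that by simp
    next
      case 2 then show ?thesis using cov[of j i] that by (simp add: mult.commute)
    qed
  qed
  have "(\<Sum>x\<in>?Z. (\<Sum>i<k. d i x)\<^sup>2) = (\<Sum>x\<in>?Z. \<Sum>i<k. \<Sum>j<k. d i x * d j x)"
    by (simp add: power2_eq_square sum_product)
  also have "\<dots> = (\<Sum>i<k. \<Sum>j<k. \<Sum>x\<in>?Z. d i x * d j x)"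
    by (subst sum.swap, rule sum.cong[OF refl], rule sum.swap)
  also have "\<dots> \<le> (\<Sum>i<k. \<Sum>j<k. if i = j then real (card ?Z) else 0)"
    by (intro sum_mono cov') auto
  also have "\<dots> = real k * real (card ?Z)" by simp
  finally show ?thesis by (simp add: d_def A_def c_def)
qed

text \<open>The visit frequency does not change when \<open>C\<close> is replaced by a translate, so its deviation is the mean over
  the base coset \<open>i\<close> of the averaged deviation \<open>s\<close> over \<open>k\<close> translates. By the Cauchy-Schwarz inequality its
  variance is at most the mean of the second moments of \<open>s\<close>, and each of these is computed on the fixed
  points through \<open>bij_pullback\<close>.\<close>
lemma visit_frequency_variance:
  assumes E: "finite E" "E \<subseteq> carrier G" and C: "determined_by X E C"
    and f: "\<And>i. f i \<in> carrier G"
    and ind: "\<And>i j. i < k \<Longrightarrow> j < i \<Longrightarrow>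
      independent_windows X (translate (f i) E) (translate (f j) E)"
    and E': "finite E'" "E' \<subseteq> carrier G" "patterns E' (fixed_points G H X) = patterns E' X"
    and sub: "(\<Union>i<k. translate (f i) E) \<subseteq> E'"
    and k: "0 < k"
  shows "real k * (\<Sum>a\<in>periodic_configs H. (visit_frequency H a C - measure \<mu> C)\<^sup>2)
      \<le> real (card (periodic_configs H))"
proof -
  let ?P = "periodic_configs H" and ?Z = "fixed_points G H X"
  define c where "c = measure \<mu> C"
  define m where "m = real (card D)"
  have m: "0 < m" using card_D_pos by (simp add: m_def)
  define s where "s x = (\<Sum>j<k. indicator (shift G (f j) ` C) x - c)" for x
  have CX: "C \<subseteq> X" by (rule determined_by_subset[OF C])
  have sum_s: "(\<Sum>i\<in>D. s (pullback a i)) = real k * m * (visit_frequency H a C - c)" if a: "a \<in> ?P" for a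
  proof -
    have aX: "pullback a i \<in> X" if "i \<in> D" for i using a that by (auto simp: periodic_configs_def)
    have "(\<Sum>i\<in>D. indicator (shift G (f j) ` C) (pullback a i)) = m * visit_frequency H a C" for j
    proof -
      have "(\<Sum>i\<in>D. indicator (shift G (f j) ` C) (pullback a i))
          = (\<Sum>i\<in>D. indicator C (pullback a (i #> f j)) :: real)"
      proof (rule sum.cong[OF refl])
        fix i assume i: "i \<in> D"
        have "shift G (inv f j) (pullback a i) = pullback a (i #> f j)"
          using pullback_equivariant[OF i, of "inv f j" a] f by (simp add: coset_sofic_def)
        then show "indicator (shift G (f j) ` C) (pullback a i) = (indicator C (pullback a (i #> f j)) :: real)"
          using aX[OF i] by (simp add: shift_image_eq[OF f CX] indicator_def)
      qed
      also have "\<dots> = (\<Sum>i\<in>D. indicator C (pullback a i))"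
        by (rule sum.reindex_bij_betw[OF bij_D_translate[OF f], of "\<lambda>i. indicator C (pullback a i)"])
      also have "\<dots> = real (card {i \<in> D. pullback a i \<in> C})"
        using finite_index by (simp add: indicator_def sum.If_cases Int_def)
      finally show ?thesis using m by (simp add: visit_frequency_def m_def)
    qed
    then have "(\<Sum>j<k. \<Sum>i\<in>D. indicator (shift G (f j) ` C) (pullback a i) - c)
        = (\<Sum>j<k. m * visit_frequency H a C - m * c)"
      by (simp add: sum_subtractf m_def)
    then show ?thesis unfolding s_def by (subst sum.swap) (simp add: algebra_simps)
  qed
  have "(\<Sum>a\<in>?P. (real k * m * (visit_frequency H a C - c))\<^sup>2) = (\<Sum>a\<in>?P. (\<Sum>i\<in>D. s (pullback a i))\<^sup>2)"
    using sum_s by simp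
  also have "\<dots> \<le> (\<Sum>a\<in>?P. (\<Sum>i\<in>D. (s (pullback a i))\<^sup>2) * m)"
    unfolding m_def by (intro sum_mono sum_squared_le_sum_of_squares)
  also have "\<dots> = m * (\<Sum>i\<in>D. \<Sum>a\<in>?P. (s (pullback a i))\<^sup>2)"
    by (subst sum.swap) (simp add: sum_distrib_left mult.commute)
  also have "(\<Sum>i\<in>D. \<Sum>a\<in>?P. (s (pullback a i))\<^sup>2) = (\<Sum>i\<in>D. \<Sum>x\<in>?Z. (s x)\<^sup>2)"
    by (intro sum.cong[OF refl] sum.reindex_bij_betw[OF bij_pullback, of _ "\<lambda>x. (s x)\<^sup>2"])
  also have "\<dots> \<le> (\<Sum>i\<in>D. real k * real (card ?Z))"
    using second_moment[OF E C f ind E' sub] by (intro sum_mono) (simp add: s_def c_def)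
  also have "\<dots> = m * (real k * real (card ?P))" by (simp add: m_def card_fixed)
  finally have "(\<Sum>a\<in>?P. (real k * m * (visit_frequency H a C - c))\<^sup>2) \<le> m * (m * (real k * real (card ?P)))"
    using m by (simp add: mult_left_mono)
  moreover have "(\<Sum>a\<in>?P. (real k * m * (visit_frequency H a C - c))\<^sup>2)
      = (m * m * real k) * (real k * (\<Sum>a\<in>?P. (visit_frequency H a C - c)\<^sup>2))"
    by (simp add: sum_distrib_left power2_eq_square ac_simps)
  moreover have "0 < m * m * real k" using m k by simp
  ultimately have "(m * m * real k) * (real k * (\<Sum>a\<in>?P. (visit_frequency H a C - c)\<^sup>2))
      \<le> (m * m * real k) * real (card ?P)" by (simp add: mult.assoc)
  then show ?thesis using \<open>0 < m * m * real k\<close> unfolding c_def by (simp only: mult_le_cancel_left_pos)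
qed

end

context haar_subshift
begin

text \<open>Chebyshev's inequality, with \<open>k\<close> independent translates for \<open>k\<close> exceeding \<open>1 / (\<eta> \<epsilon>\<^sup>2)\<close>. The window \<open>E'\<close> is the
  union of the translated windows.\<close>
lemma equidistribution:
  assumes erg: "ergodic_action G (shift G) \<mu>"
    and E: "finite E" "E \<subseteq> carrier G" and C: "determined_by X E C" and pos: "0 < \<epsilon>" "0 < \<eta>"
  shows "\<exists>E'. finite E' \<and> E' \<subseteq> carrier G \<and>
    (\<forall>H. finite_quotient G K X H \<longrightarrow> patterns E' (fixed_points G H X) = patterns E' X \<longrightarrow>
      real (card {a \<in> periodic_configs H. \<epsilon> < \<bar>visit_frequency H a C - measure \<mu> C\<bar>})
        \<le> \<eta> * real (card (periodic_configs H)))"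
proof -
  obtain k :: nat where k: "1 / (\<eta> * \<epsilon>\<^sup>2) < real k" using reals_Archimedean2 by blast
  moreover have "0 < 1 / (\<eta> * \<epsilon>\<^sup>2)" using pos by simp
  ultimately have k0: "0 < k" by (metis less_trans of_nat_0_less_iff)
  obtain f where f: "\<And>i. f i \<in> carrier G"
    "\<And>i j. i < k \<Longrightarrow> j < i \<Longrightarrow> independent_windows X (translate (f i) E) (translate (f j) E)"
    using independent_translates[OF erg E, of k] by blast
  define E' where "E' = (\<Union>i<k. translate (f i) E)"
  have E': "finite E'" "E' \<subseteq> carrier G" using E f by (auto simp: E'_def)
  have sub: "(\<Union>i<k. translate (f i) E) \<subseteq> E'" by (simp add: E'_def)
  have "real (card {a \<in> periodic_configs H. \<epsilon> < \<bar>visit_frequency H a C - measure \<mu> C\<bar>})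
        \<le> \<eta> * real (card (periodic_configs H))"
    if H: "finite_quotient G K X H" and pat: "patterns E' (fixed_points G H X) = patterns E' X" for H
  proof -
    interpret finite_quotient G K X H by (rule H)
    interpret haar_quotient G K X \<mu> H ..
    let ?P = "periodic_configs H" and ?v = "\<lambda>a. visit_frequency H a C - measure \<mu> C"
    let ?bad = "{a \<in> ?P. \<epsilon> < \<bar>?v a\<bar>}"
    have "real (card ?bad) * \<epsilon>\<^sup>2 = (\<Sum>a\<in>?bad. \<epsilon>\<^sup>2)" by simp
    also have "\<dots> \<le> (\<Sum>a\<in>?bad. (?v a)\<^sup>2)"
      using pos by (intro sum_mono) (simp add: abs_le_square_iff[symmetric])
    also have "\<dots> \<le> (\<Sum>a\<in>?P. (?v a)\<^sup>2)"
      using periodic_configs_finite by (intro sum_mono2) auto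
    finally have "real k * (real (card ?bad) * \<epsilon>\<^sup>2) \<le> real k * (\<Sum>a\<in>?P. (?v a)\<^sup>2)"
      by (rule mult_left_mono) simp
    also have "\<dots> \<le> real (card ?P)"
      by (rule visit_frequency_variance[OF E C f E' pat sub k0])
    finally have *: "real k * \<epsilon>\<^sup>2 * real (card ?bad) \<le> real (card ?P)" by (simp add: ac_simps)
    have "1 \<le> real k * \<epsilon>\<^sup>2 * \<eta>" using k pos by (simp add: field_simps)
    then have "real (card ?bad) \<le> (real k * \<epsilon>\<^sup>2 * \<eta>) * real (card ?bad)"
      using mult_right_mono[of 1 "real k * \<epsilon>\<^sup>2 * \<eta>" "real (card ?bad)"] by simp
    also have "\<dots> = \<eta> * (real k * \<epsilon>\<^sup>2 * real (card ?bad))" by simp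
    also have "\<dots> \<le> \<eta> * real (card ?P)" using * pos by (intro mult_left_mono) auto
    finally show ?thesis .
  qed
  then show ?thesis using E' by blast
qed

lemma equidistribution_family:
  assumes erg: "ergodic_action G (shift G) \<mu>"
    and fam: "finite \<C>" and E: "finite E" "E \<subseteq> carrier G" and C: "\<And>C. C \<in> \<C> \<Longrightarrow> determined_by X E C"
    and pos: "0 < \<epsilon>" "0 < \<eta>"
  shows "\<exists>E'. finite E' \<and> E' \<subseteq> carrier G \<and>
    (\<forall>H. finite_quotient G K X H \<longrightarrow> patterns E' (fixed_points G H X) = patterns E' X \<longrightarrow>
      real (card {a \<in> periodic_configs H. \<exists>C\<in>\<C>. \<epsilon> < \<bar>visit_frequency H a C - measure \<mu> C\<bar>})
        \<le> \<eta> * real (card (periodic_configs H)))"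
proof -
  define \<eta>' where "\<eta>' = \<eta> / (real (card \<C>) + 1)"
  have \<eta>': "0 < \<eta>'" using pos by (simp add: \<eta>'_def)
  let ?bad = "\<lambda>H C. {a \<in> periodic_configs H. \<epsilon> < \<bar>visit_frequency H a C - measure \<mu> C\<bar>}"
  define equi where "equi C F \<longleftrightarrow> finite F \<and> F \<subseteq> carrier G \<and>
    (\<forall>H. finite_quotient G K X H \<longrightarrow> patterns F (fixed_points G H X) = patterns F X \<longrightarrow>
      real (card (?bad H C)) \<le> \<eta>' * real (card (periodic_configs H)))" for C F
  have "\<exists>F. equi C F" if "C \<in> \<C>" for C
    unfolding equi_def by (rule equidistribution[OF erg E C[OF that] pos(1) \<eta>'])
  then have "\<forall>C\<in>\<C>. \<exists>F. equi C F" by blast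
  from bchoice[OF this] obtain W where equi: "\<forall>C\<in>\<C>. equi C (W C)" ..
  have W: "finite (W C)" "W C \<subseteq> carrier G"
    "\<lbrakk>finite_quotient G K X H; patterns (W C) (fixed_points G H X) = patterns (W C) X\<rbrakk> \<Longrightarrow>
      real (card (?bad H C)) \<le> \<eta>' * real (card (periodic_configs H))" if "C \<in> \<C>" for C H
    using equi[rule_format, OF that] unfolding equi_def by (blast, blast, blast)
  define E' where "E' = (\<Union>C\<in>\<C>. W C)"
  have E': "finite E'" "E' \<subseteq> carrier G" using fam W by (auto simp: E'_def)
  have "real (card {a \<in> periodic_configs H. \<exists>C\<in>\<C>. \<epsilon> < \<bar>visit_frequency H a C - measure \<mu> C\<bar>})
        \<le> \<eta> * real (card (periodic_configs H))"
    if H: "finite_quotient G K X H" and pat: "patterns E' (fixed_points G H X) = patterns E' X" for H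
  proof -
    have sub_pat: "patterns F (fixed_points G H X) = patterns F X" if "F \<subseteq> E'" for F
    proof -
      have "patterns F Y = (\<lambda>p. restrict p F) ` patterns E' Y" for Y :: "('g \<Rightarrow> 'k) set"
        using that by (simp add: patterns_def image_image Int_absorb1)
      then show ?thesis using pat by simp
    qed
    have fin: "finite (periodic_configs H)" by (rule finite_quotient.periodic_configs_finite[OF H])
    have bound: "real (card (?bad H C)) \<le> \<eta>' * real (card (periodic_configs H))" if "C \<in> \<C>" for C
      by (rule W(3)[OF that H sub_pat]) (use that in \<open>auto simp: E'_def\<close>)
    have eq: "{a \<in> periodic_configs H. \<exists>C\<in>\<C>. \<epsilon> < \<bar>visit_frequency H a C - measure \<mu> C\<bar>} = (\<Union>C\<in>\<C>. ?bad H C)"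
      by auto
    have "real (card {a \<in> periodic_configs H. \<exists>C\<in>\<C>. \<epsilon> < \<bar>visit_frequency H a C - measure \<mu> C\<bar>})
        \<le> real (\<Sum>C\<in>\<C>. card (?bad H C))"
      unfolding eq by (rule of_nat_mono[OF card_UN_le[OF fam]])
    also have "\<dots> = (\<Sum>C\<in>\<C>. real (card (?bad H C)))" by simp
    also have "\<dots> \<le> (\<Sum>C\<in>\<C>. \<eta>' * real (card (periodic_configs H)))" by (intro sum_mono bound)
    also have "\<dots> = (real (card \<C>) * \<eta>') * real (card (periodic_configs H))" by simp
    also have "\<dots> \<le> \<eta> * real (card (periodic_configs H))"
      using pos by (intro mult_right_mono) (simp_all add: \<eta>'_def field_simps)
    finally show ?thesis .
  qed
  then show ?thesis using E' by blast
qed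

end

section \<open>Counting configurations with few defects\<close>

lemma sum_power_card_Pow:
  fixes t :: real
  assumes "finite D"
  shows "(\<Sum>B\<in>Pow D. t ^ card B) = (1 + t) ^ card D"
  using prod_add[OF assms, of "\<lambda>_. t" "\<lambda>_. 1"] by (simp add: add.commute)

text \<open>A Chernoff type bound: \<open>(c / t) ^ card B \<le> (c / t) powr r\<close> on the range of summation, and the remaining
  weights \<open>t ^ card B\<close> sum to \<open>(1 + t) ^ card D\<close> over all subsets.\<close>
lemma sum_power_card_small:
  fixes t c r :: real
  assumes "finite D" and t: "0 < t" "t \<le> 1" and c: "1 \<le> c"
  shows "(\<Sum>B | B \<subseteq> D \<and> real (card B) \<le> r. c ^ card B) \<le> (c / t) powr r * (1 + t) ^ card D"
proof -
  have ct: "1 \<le> c / t" using t c by (simp add: field_simps)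
  have "(\<Sum>B | B \<subseteq> D \<and> real (card B) \<le> r. c ^ card B)
      \<le> (\<Sum>B | B \<subseteq> D \<and> real (card B) \<le> r. (c / t) powr r * t ^ card B)"
  proof (rule sum_mono)
    fix B assume "B \<in> {B. B \<subseteq> D \<and> real (card B) \<le> r}"
    then have "(c / t) ^ card B \<le> (c / t) powr r"
      using ct powr_mono[of "real (card B)" r "c / t"] by (simp add: powr_realpow)
    then have "(c / t) ^ card B * t ^ card B \<le> (c / t) powr r * t ^ card B"
      using t by (intro mult_right_mono) auto
    moreover have "(c / t) ^ card B * t ^ card B = c ^ card B"
      using t by (simp add: power_divide)
    ultimately show "c ^ card B \<le> (c / t) powr r * t ^ card B" by simp
  qed
  also have "\<dots> \<le> (\<Sum>B\<in>Pow D. (c / t) powr r * t ^ card B)"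
    using assms by (intro sum_mono2) auto
  also have "\<dots> = (c / t) powr r * (1 + t) ^ card D"
    using assms by (simp add: sum_distrib_left[symmetric] sum_power_card_Pow)
  finally show ?thesis .
qed

text \<open>The sum weights each possible defect set \<open>B\<close> by the number of choices on it. Allowing \<open>\<eta> m\<close> defects among \<open>m\<close> positions, with boundedly many choices at each, costs an
  exponential rate that vanishes with \<open>\<eta>\<close>.\<close>
lemma small_defect_rate:
  fixes c \<epsilon> :: real
  assumes c: "1 \<le> c" and \<epsilon>: "0 < \<epsilon>"
  shows "\<exists>\<eta>>0. \<forall>D :: 'd set. finite D \<longrightarrow>
    (\<Sum>B | B \<subseteq> D \<and> real (card B) \<le> \<eta> * real (card D). c ^ card B) \<le> exp (\<epsilon> * real (card D))"
proof -
  define t where "t = min 1 (\<epsilon> / 2)"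
  have t: "0 < t" "t \<le> 1" "t \<le> \<epsilon> / 2" using \<epsilon> by (auto simp: t_def)
  have ct: "1 \<le> c / t" using t c by (simp add: field_simps)
  then have l: "0 \<le> ln (c / t)" by simp
  define \<eta> where "\<eta> = \<epsilon> / 2 / (ln (c / t) + 1)"
  have \<eta>: "0 < \<eta>" "\<eta> * ln (c / t) \<le> \<epsilon> / 2"
    using \<epsilon> l by (auto simp: \<eta>_def field_simps intro!: divide_pos_pos)
  have "(\<Sum>B | B \<subseteq> D \<and> real (card B) \<le> \<eta> * real (card D). c ^ card B) \<le> exp (\<epsilon> * real (card D))"
    if "finite D" for D :: "'d set"
  proof -
    let ?m = "real (card D)"
    have "(c / t) powr (\<eta> * ?m) = exp ((\<eta> * ln (c / t)) * ?m)"
      using t c by (simp add: powr_def ac_simps)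
    also have "\<dots> \<le> exp (\<epsilon> / 2 * ?m)" unfolding exp_le_cancel_iff using \<eta> by (intro mult_right_mono) auto
    finally have 1: "(c / t) powr (\<eta> * ?m) \<le> exp (\<epsilon> / 2 * ?m)" .
    have "(1 + t) ^ card D \<le> exp t ^ card D" using t by (intro power_mono) auto
    also have "\<dots> = exp (t * ?m)" by (simp add: exp_of_nat_mult[symmetric] mult.commute)
    also have "\<dots> \<le> exp (\<epsilon> / 2 * ?m)" unfolding exp_le_cancel_iff using t by (intro mult_right_mono) auto
    finally have 2: "(1 + t) ^ card D \<le> exp (\<epsilon> / 2 * ?m)" .
    have "(\<Sum>B | B \<subseteq> D \<and> real (card B) \<le> \<eta> * ?m. c ^ card B) \<le> (c / t) powr (\<eta> * ?m) * (1 + t) ^ card D"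
      by (rule sum_power_card_small[OF that t(1,2) c])
    also have "\<dots> \<le> exp (\<epsilon> / 2 * ?m) * exp (\<epsilon> / 2 * ?m)"
      using 1 2 t by (intro mult_mono) auto
    also have "\<dots> = exp (\<epsilon> * ?m)" by (simp add: exp_add[symmetric] field_simps)
    finally show ?thesis .
  qed
  then show ?thesis using \<eta> by blast
qed

lemma card_le_fibres:
  assumes T: "finite T" "f ` S \<subseteq> T"
    and fib: "\<And>t. t \<in> T \<Longrightarrow> finite {x \<in> S. f x = t} \<and> card {x \<in> S. f x = t} \<le> m"
  shows "finite S" "card S \<le> card T * m"
proof -
  have S: "S = (\<Union>t\<in>T. {x \<in> S. f x = t})" using T by auto
  have "finite (\<Union>t\<in>T. {x \<in> S. f x = t})" using T fib by blast
  then show "finite S" using S by simp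
  have "card S \<le> (\<Sum>t\<in>T. card {x \<in> S. f x = t})" using card_UN_le[OF T(1)] S by metis
  also have "\<dots> \<le> (\<Sum>t\<in>T. m)" using fib by (intro sum_mono) auto
  finally show "card S \<le> card T * m" by simp
qed

context alg_subshift
begin

text \<open>Finite type in terms of the patterns that occur in \<open>X\<close>, instead of a list of allowed patterns. In
  this form the window may be enlarged, and the allowed patterns form a group.\<close>
definition window_rule :: "'g set \<Rightarrow> bool" where
  "window_rule V \<longleftrightarrow> finite V \<and> V \<subseteq> carrier G \<and>
     (\<forall>x\<in>carrier G \<rightarrow>\<^sub>E carrier K. (\<forall>g\<in>carrier G. \<exists>y\<in>X. \<forall>v\<in>V. shift G g x v = y v) \<longrightarrow> x \<in> X)"

lemma window_rule_mono:
  assumes V: "window_rule V" and V': "finite V'" "V \<subseteq> V'" "V' \<subseteq> carrier G"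
  shows "window_rule V'"
  unfolding window_rule_def
proof (intro conjI ballI impI V'(1,3))
  fix x assume x: "x \<in> carrier G \<rightarrow>\<^sub>E carrier K" "\<forall>g\<in>carrier G. \<exists>y\<in>X. \<forall>v\<in>V'. shift G g x v = y v"
  have "\<exists>y\<in>X. \<forall>v\<in>V. shift G g x v = y v" if "g \<in> carrier G" for g
    using x(2)[rule_format, OF that] V'(2) by (meson subsetD)
  then show "x \<in> X" using V x(1) by (simp add: window_rule_def)
qed

lemma finite_type_window_rule:
  assumes "finite_type G K X" shows "\<exists>V. window_rule V"
proof -
  obtain W P where W: "finite W" "W \<subseteq> carrier G"
    and X_eq: "X = {x \<in> carrier (full_shift G K).
              \<forall>g\<in>carrier G. \<exists>p\<in>P. \<forall>w\<in>W. shift G (w \<otimes> g) x \<one> = p w}"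
    using assms unfolding finite_type_def by blast
  define V where "V = (\<lambda>w. inv w) ` W"
  have read: "shift G (w \<otimes> g) x \<one> = shift G g x (inv w)" if "w \<in> W" "g \<in> carrier G" for w g x
    using that W by (auto simp: shift_def G.inv_mult_group subset_iff)
  have "x \<in> X" if x: "x \<in> carrier G \<rightarrow>\<^sub>E carrier K"
    and rule: "\<forall>g\<in>carrier G. \<exists>y\<in>X. \<forall>v\<in>V. shift G g x v = y v" for x
  proof -
    have "\<exists>p\<in>P. \<forall>w\<in>W. shift G (w \<otimes> g) x \<one> = p w" if g: "g \<in> carrier G" for g
    proof -
      obtain y where y: "y \<in> X" "\<forall>v\<in>V. shift G g x v = y v" using rule g by blast
      have "\<exists>p\<in>P. \<forall>w\<in>W. shift G (w \<otimes> \<one>) y \<one> = p w"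
        using y(1) X_eq G.one_closed by blast
      then obtain p where p: "p \<in> P" "\<forall>w\<in>W. shift G (w \<otimes> \<one>) y \<one> = p w" by blast
      have "shift G (w \<otimes> g) x \<one> = p w" if w: "w \<in> W" for w
      proof -
        have "shift G (w \<otimes> g) x \<one> = y (inv w)"
          unfolding read[OF w g] using y(2) w by (simp add: V_def)
        also have "\<dots> = shift G (w \<otimes> \<one>) y \<one>"
          using read[OF w G.one_closed, of y] shift_one[OF X_extensional[OF y(1)]] by simp
        finally show ?thesis using p(2) w by simp
      qed
      then show ?thesis using p(1) by blast
    qed
    then show "x \<in> X" using x by (subst X_eq) (simp add: full_carrier)
  qed
  moreover have "finite V" "V \<subseteq> carrier G" using W by (auto simp: V_def)
  ultimately show ?thesis unfolding window_rule_def by (intro exI[of _ V] conjI ballI impI)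
qed

definition legal :: "'g set \<Rightarrow> ('g set \<Rightarrow> 'k) \<Rightarrow> 'g set \<Rightarrow> bool" where
  "legal V a i \<longleftrightarrow> (\<exists>y\<in>X. \<forall>v\<in>V. pullback a i v = y v)"

end

context finite_quotient
begin

lemma legal_everywhere:
  assumes V: "window_rule V" and a: "a \<in> D \<rightarrow>\<^sub>E carrier K" and legal: "\<And>i. i \<in> D \<Longrightarrow> legal V a i"
  shows "a \<in> periodic_configs H"
proof -
  have "pullback a i \<in> X" if i: "i \<in> D" for i
  proof -
    have "\<exists>y\<in>X. \<forall>v\<in>V. shift G g (pullback a i) v = y v" if g: "g \<in> carrier G" for g
      using legal[OF coset_sofic_D[OF i g]] pullback_equivariant[OF i g] by (simp add: legal_def)
    then show ?thesis using V pullback_full[OF a i] by (simp add: window_rule_def)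
  qed
  then show ?thesis using a by (simp add: periodic_configs_def)
qed

text \<open>Two configurations that are legal off \<open>B\<close> and show the same patterns on \<open>B\<close> differ by a periodic
  configuration: the quotient is legal off \<open>B\<close> since \<open>X\<close> is a group, and trivial on \<open>B\<close>.\<close>
lemma card_legal_off:
  assumes V: "window_rule V" and B: "B \<subseteq> D"
  defines "Y \<equiv> {a \<in> D \<rightarrow>\<^sub>E carrier K. \<forall>i\<in>D - B. legal V a i}"
  shows "finite Y" "card Y \<le> (card (carrier K) ^ card V) ^ card B * card (periodic_configs H)"
proof -
  have Vf: "finite V" "V \<subseteq> carrier G" using V by (auto simp: window_rule_def)
  have Bf: "finite B" using B finite_index by (rule finite_subset)
  define f where "f a = (\<lambda>i\<in>B. restrict (pullback a i) V)" for a
  let ?T = "B \<rightarrow>\<^sub>E (V \<rightarrow>\<^sub>E carrier K)"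
  have T: "finite ?T" using Bf Vf finite_K by (intro finite_PiE) auto
  have cT: "card ?T = (card (carrier K) ^ card V) ^ card B"
    using Bf Vf by (simp add: card_funcsetE)
  have im: "f ` Y \<subseteq> ?T"
  proof (intro subsetI)
    fix p assume "p \<in> f ` Y"
    then obtain a where a: "a \<in> D \<rightarrow>\<^sub>E carrier K" "p = f a" by (auto simp: Y_def)
    have "pullback a i v \<in> carrier K" if "i \<in> B" "v \<in> V" for i v
      using PiE_mem[OF pullback_full[OF a(1), of i], of v] that B Vf by auto
    then show "p \<in> ?T" by (auto simp: a(2) f_def)
  qed
  have fib: "finite {a \<in> Y. f a = p} \<and> card {a \<in> Y. f a = p} \<le> card (periodic_configs H)" for p
  proof (cases "{a \<in> Y. f a = p} = {}")
    case False
    then obtain b where b: "b \<in> Y" "f b = p" by blast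
    define q where "q a = (\<lambda>i\<in>D. inv\<^bsub>K\<^esub> (b i) \<otimes>\<^bsub>K\<^esub> a i)" for a
    have bK: "b i \<in> carrier K" if "i \<in> D" for i using b that by (auto simp: Y_def)
    have q: "q a \<in> periodic_configs H" if a: "a \<in> Y" "f a = p" for a
    proof (rule legal_everywhere[OF V])
      have aK: "a i \<in> carrier K" if "i \<in> D" for i using a that by (auto simp: Y_def)
      show "q a \<in> D \<rightarrow>\<^sub>E carrier K" using aK bK by (auto simp: q_def)
      fix i assume i: "i \<in> D"
      have pq: "pullback (q a) i v = inv\<^bsub>K\<^esub> (pullback b i v) \<otimes>\<^bsub>K\<^esub> pullback a i v" if "v \<in> V" for v
        using that Vf i D_translate[OF i, of v] by (auto simp: pullback_apply q_def subset_iff)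
      show "legal V (q a) i"
      proof (cases "i \<in> B")
        case True
        have "f a i = f b i" using a(2) b(2) by simp
        then have "pullback a i v = pullback b i v" if "v \<in> V" for v
          using True that by (auto simp: f_def restrict_eq_iff)
        moreover have "pullback b i v \<in> carrier K" if "v \<in> V" for v
          using that Vf bK[OF D_translate[OF i, of v]] by (auto simp: pullback_apply subset_iff)
        ultimately have "pullback (q a) i v = xone v" if "v \<in> V" for v
          using that Vf pq by (auto simp: subset_iff)
        then show ?thesis using X_one unfolding legal_def by blast
      next
        case False
        then obtain y z where y: "y \<in> X" "\<forall>v\<in>V. pullback a i v = y v"
          and z: "z \<in> X" "\<forall>v\<in>V. pullback b i v = z v"
          using a(1) b(1) i unfolding Y_def legal_def by blast
        have "pullback (q a) i v = xmult (xinv z) y v" if "v \<in> V" for v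
          using that Vf pq y z by (auto simp: xmult_apply xinv_apply subset_iff)
        then show ?thesis using X_mult[OF X_inv[OF z(1)] y(1)] unfolding legal_def by blast
      qed
    qed
    have inj: "inj_on q {a \<in> Y. f a = p}"
    proof (rule inj_onI)
      fix a a' assume a: "a \<in> {a \<in> Y. f a = p}" "a' \<in> {a \<in> Y. f a = p}" and eq: "q a = q a'"
      show "a = a'"
      proof (rule extensionalityI)
        show "a \<in> extensional D" "a' \<in> extensional D" using a by (auto simp: Y_def PiE_def)
        fix i assume i: "i \<in> D"
        have "a i \<in> carrier K" "a' i \<in> carrier K" using a i by (auto simp: Y_def)
        then show "a i = a' i" using fun_cong[OF eq, of i] i bK[OF i] by (simp add: q_def)
      qed
    qed
    have sub: "q ` {a \<in> Y. f a = p} \<subseteq> periodic_configs H" using q by blast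
    show ?thesis
      using inj sub periodic_configs_finite
      by (meson card_inj_on_le finite_imageD finite_subset)
  next
    case True
    then show ?thesis by (simp only: finite.emptyI card.empty le0 simp_thms)
  qed
  show "finite Y" by (rule card_le_fibres(1)[OF T im fib])
  show "card Y \<le> (card (carrier K) ^ card V) ^ card B * card (periodic_configs H)"
    using card_le_fibres(2)[OF T im fib] by (simp add: cT)
qed

text \<open>This is the common upper bound for both entropies: a microstate is coded by a configuration
  that is legal off a small set of positions, together with extra data on that set.\<close>
lemma coded_bound:
  fixes Q :: "'q set" and R :: "'r set" and conf :: "'q \<Rightarrow> 'g set \<Rightarrow> 'k"
    and bad :: "'q \<Rightarrow> 'g set set" and data :: "'q \<Rightarrow> 'g set \<Rightarrow> 'r"
  assumes V: "window_rule V" and R: "finite R" "R \<noteq> {}"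
    and conf: "\<And>q. q \<in> Q \<Longrightarrow> conf q \<in> D \<rightarrow>\<^sub>E carrier K"
    and bad: "\<And>q. q \<in> Q \<Longrightarrow> bad q \<subseteq> D" "\<And>q. q \<in> Q \<Longrightarrow> real (card (bad q)) \<le> r"
    and legal: "\<And>q i. \<lbrakk>q \<in> Q; i \<in> D; i \<notin> bad q\<rbrakk> \<Longrightarrow> legal V (conf q) i"
    and data: "\<And>q i. \<lbrakk>q \<in> Q; i \<in> bad q\<rbrakk> \<Longrightarrow> data q i \<in> R"
    and inj: "\<And>q q'. \<lbrakk>q \<in> Q; q' \<in> Q; conf q = conf q'; bad q = bad q';
      \<And>i. i \<in> bad q \<Longrightarrow> data q i = data q' i\<rbrakk> \<Longrightarrow> q = q'"
  shows "finite Q" "real (card Q) \<le> real (card (periodic_configs H)) *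
      (\<Sum>B | B \<subseteq> D \<and> real (card B) \<le> r. (real (card (carrier K)) ^ card V * real (card R)) ^ card B)"
proof -
  define Y where "Y B = {a \<in> D \<rightarrow>\<^sub>E carrier K. \<forall>i\<in>D - B. legal V a i}" for B
  let ?S = "{B. B \<subseteq> D \<and> real (card B) \<le> r}"
  let ?T = "Sigma ?S (\<lambda>B. Y B \<times> (B \<rightarrow>\<^sub>E R))"
  define code where "code q = (bad q, conf q, restrict (data q) (bad q))" for q
  have Bf: "finite B" if "B \<in> ?S" for B using that finite_index by (auto intro: finite_subset)
  have S: "finite ?S" by (rule finite_subset[of _ "Pow D"]) (use finite_index in auto)
  have Yf: "finite (Y B)" "card (Y B) \<le> (card (carrier K) ^ card V) ^ card B * card (periodic_configs H)"
    if "B \<in> ?S" for B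
    unfolding Y_def using that card_legal_off[OF V, of B] by auto
  have fin: "finite (Y B \<times> (B \<rightarrow>\<^sub>E R))" if "B \<in> ?S" for B
    using Yf(1)[OF that] Bf[OF that] R by (auto intro: finite_PiE)
  have T: "finite ?T" by (rule finite_SigmaI[OF S fin])
  have "code ` Q \<subseteq> ?T"
    using conf bad legal data by (auto simp: code_def Y_def)
  moreover have "inj_on code Q"
  proof (rule inj_onI)
    fix q q' assume q: "q \<in> Q" "q' \<in> Q" and "code q = code q'"
    then have eq: "conf q = conf q'" "bad q = bad q'"
      "restrict (data q) (bad q) = restrict (data q') (bad q')" by (auto simp: code_def)
    have "data q i = data q' i" if "i \<in> bad q" for i
      using fun_cong[OF eq(3), of i] that eq(2) by simp
    then show "q = q'" using inj[OF q eq(1,2)] by blast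
  qed
  ultimately show "finite Q" and "real (card Q) \<le> real (card (periodic_configs H)) *
      (\<Sum>B | B \<subseteq> D \<and> real (card B) \<le> r. (real (card (carrier K)) ^ card V * real (card R)) ^ card B)"
  proof -
    assume im: "code ` Q \<subseteq> ?T" and ic: "inj_on code Q"
    show "finite Q" using T im ic by (meson finite_imageD finite_subset)
    have "card Q \<le> card ?T" using T im ic by (meson card_inj_on_le)
    also have "card ?T = (\<Sum>B\<in>?S. card (Y B \<times> (B \<rightarrow>\<^sub>E R)))"
      by (rule card_SigmaI[OF S]) (intro ballI fin)
    also have "\<dots> = (\<Sum>B\<in>?S. card (Y B) * card R ^ card B)"
      by (rule sum.cong[OF refl]) (simp only: card_cartesian_product card_funcsetE[OF Bf])
    finally have "real (card Q) \<le> real (\<Sum>B\<in>?S. card (Y B) * card R ^ card B)"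
      by (rule of_nat_mono)
    also have "\<dots> = (\<Sum>B\<in>?S. real (card (Y B)) * real (card R) ^ card B)" by simp
    finally have "real (card Q) \<le> (\<Sum>B\<in>?S. real (card (Y B)) * real (card R) ^ card B)" .
    also have "\<dots> \<le> (\<Sum>B\<in>?S. ((real (card (carrier K)) ^ card V) ^ card B * real (card (periodic_configs H)))
        * real (card R) ^ card B)"
    proof (intro sum_mono mult_right_mono)
      fix B assume "B \<in> ?S"
      then show "real (card (Y B)) \<le> (real (card (carrier K)) ^ card V) ^ card B * real (card (periodic_configs H))"
        using of_nat_mono[OF Yf(2), of B, where 'a = real] by simp
    qed auto
    also have "\<dots> = real (card (periodic_configs H)) *
        (\<Sum>B\<in>?S. (real (card (carrier K)) ^ card V * real (card R)) ^ card B)"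
      by (simp add: sum_distrib_left power_mult_distrib ac_simps)
    finally show "real (card Q) \<le> real (card (periodic_configs H)) *
      (\<Sum>B\<in>?S. (real (card (carrier K)) ^ card V * real (card R)) ^ card B)" .
  qed
qed

end

section \<open>Topological entropy\<close>

context alg_subshift
begin

abbreviation TX2 :: "(('g \<Rightarrow> 'k) \<times> ('g \<Rightarrow> 'k)) topology" where
  "TX2 \<equiv> prod_topology TX TX"

lemma topspace_TX2: "topspace TX2 = X \<times> X"
  by (simp only: topspace_prod_topology topspace_TX)

lemma compact_TX2: "compact_space TX2"
  unfolding compact_space_prod_topology using compact_TX by simp

lemma openin_differ:
  assumes h: "h \<in> carrier G"
  shows "openin TX2 {z \<in> X \<times> X. fst z h \<noteq> snd z h}"
proof -
  have "{z \<in> X \<times> X. fst z h \<noteq> snd z h}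
      = (\<Union>k\<in>carrier K. {x \<in> X. x h \<in> {k}} \<times> {x \<in> X. x h \<in> - {k}})"
    using X_K[OF _ h] by auto
  also have "openin TX2 \<dots>"
    by (intro openin_Union, elim imageE)
      (simp only: openin_prod_Times_iff openin_coordinate[OF h, of "{_}"] openin_coordinate[OF h, of "- {_}"] simp_thms)
  finally show ?thesis .
qed

lemma closedin_differ:
  assumes h: "h \<in> carrier G"
  shows "closedin TX2 {z \<in> X \<times> X. fst z h \<noteq> snd z h}"
proof -
  have "X \<times> X - {z \<in> X \<times> X. fst z h \<noteq> snd z h} = (\<Union>k\<in>carrier K. {x \<in> X. x h \<in> {k}} \<times> {x \<in> X. x h \<in> {k}})"
    using X_K[OF _ h] by auto
  also have "openin TX2 \<dots>"
    by (intro openin_Union, elim imageE)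
      (simp only: openin_prod_Times_iff openin_coordinate[OF h, of "{_}"] openin_coordinate[OF h, of "- {_}"] simp_thms)
  finally show ?thesis unfolding closedin_def topspace_TX2 by blast
qed

lemma rho_continuous:
  assumes \<rho>: "continuous_generating_pseudometric G (shift G) TX \<rho>" and g: "g \<in> carrier G"
  shows "continuous_map TX2 euclideanreal (\<lambda>z. \<rho> (shift G g (fst z)) (shift G g (snd z)))"
proof -
  have "continuous_map TX2 TX2 (\<lambda>z. (shift G g (fst z), shift G g (snd z)))"
    using continuous_map_compose[OF continuous_map_fst continuous_shift[OF g], of TX]
      continuous_map_compose[OF continuous_map_snd continuous_shift[OF g], of TX]
    by (intro continuous_map_pairedI) (simp_all add: o_def)
  moreover have "continuous_map TX2 euclideanreal (\<lambda>(x, y). \<rho> x y)"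
    using \<rho> by (simp add: continuous_generating_pseudometric_def)
  ultimately have "continuous_map TX2 euclideanreal ((\<lambda>(x, y). \<rho> x y) \<circ> (\<lambda>z. (shift G g (fst z), shift G g (snd z))))"
    by (rule continuous_map_compose)
  then show ?thesis by (simp add: o_def)
qed

text \<open>A uniform version of the generating property. The pairs that differ at the identity form a compact
  set, covered by the open sets where some \<open>\<rho> (g x) (g y)\<close> exceeds \<open>1 / (m + 1)\<close>.\<close>
lemma generating_separation:
  assumes \<rho>: "continuous_generating_pseudometric G (shift G) TX \<rho>"
  shows "\<exists>F \<kappa>. finite F \<and> F \<subseteq> carrier G \<and> 0 < \<kappa> \<and>
    (\<forall>x\<in>X. \<forall>y\<in>X. x \<one> \<noteq> y \<one> \<longrightarrow> (\<exists>g\<in>F. \<kappa> \<le> \<rho> (shift G g x) (shift G g y)))"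
proof -
  define Z where "Z = {z \<in> X \<times> X. fst z \<one> \<noteq> snd z \<one>}"
  define U where "U = (\<lambda>(g, m::nat). {z \<in> topspace TX2.
      \<rho> (shift G g (fst z)) (shift G g (snd z)) \<in> {1 / (real m + 1)<..}})"
  have Z: "compactin TX2 Z"
    unfolding Z_def by (rule closedin_compact_space[OF compact_TX2 closedin_differ]) simp
  have "openin TX2 (U s)" if "s \<in> carrier G \<times> UNIV" for s
    using that openin_continuous_map_preimage[OF rho_continuous[OF \<rho>, of "fst s"], of "{1 / (real (snd s) + 1)<..}"]
    by (auto simp: U_def split_beta)
  then have op: "openin TX2 S" if "S \<in> U ` (carrier G \<times> UNIV)" for S using that by blast
  have cover: "Z \<subseteq> \<Union>(U ` (carrier G \<times> UNIV))"
  proof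
    fix z assume z: "z \<in> Z"
    then have zX: "fst z \<in> X" "snd z \<in> X" "fst z \<noteq> snd z" by (auto simp: Z_def)
    then obtain g where g: "g \<in> carrier G" "0 < \<rho> (shift G g (fst z)) (shift G g (snd z))"
      using \<rho> unfolding continuous_generating_pseudometric_def topspace_TX by blast
    obtain m :: nat where m: "inverse (real (Suc m)) < \<rho> (shift G g (fst z)) (shift G g (snd z))"
      using reals_Archimedean[OF g(2)] by blast
    have "z \<in> topspace TX2" using z by (simp only: topspace_TX2 Z_def mem_Collect_eq)
    then have "z \<in> U (g, m)" using m by (simp add: U_def inverse_eq_divide add.commute)
    then show "z \<in> \<Union>(U ` (carrier G \<times> UNIV))" using g(1) by blast
  qed
  have "\<exists>\<F>. finite \<F> \<and> \<F> \<subseteq> U ` (carrier G \<times> UNIV) \<and> Z \<subseteq> \<Union>\<F>"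
    by (rule compactinD[OF Z op cover])
  then obtain \<F> where \<F>: "finite \<F>" "\<F> \<subseteq> U ` (carrier G \<times> UNIV)" "Z \<subseteq> \<Union>\<F>"
    by (elim exE conjE)
  obtain S where S: "S \<subseteq> carrier G \<times> UNIV" "finite S" "\<F> = U ` S"
    using finite_subset_image[OF \<F>(1,2)] by metis
  define M where "M = Max (insert 0 (snd ` S))"
  have M: "m \<le> M" if "(g, m) \<in> S" for g m
    unfolding M_def using S(2) that by (intro Max_ge) force+
  show ?thesis
  proof (intro exI[of _ "fst ` S"] exI[of _ "1 / (real M + 1)"] conjI ballI impI)
    show "finite (fst ` S)" "fst ` S \<subseteq> carrier G" "0 < 1 / (real M + 1)" using S by auto
    fix x y assume "x \<in> X" "y \<in> X" "x \<one> \<noteq> y \<one>"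
    then have "(x, y) \<in> Z" by (simp add: Z_def)
    then obtain g m where s: "(g, m) \<in> S" "(x, y) \<in> U (g, m)" using \<F>(3) S(3) by auto
    have "1 / (real M + 1) \<le> 1 / (real m + 1)" using M[OF s(1)] by (simp add: frac_le)
    also have "\<dots> \<le> \<rho> (shift G g x) (shift G g y)" using s(2) by (simp add: U_def)
    finally show "\<exists>g\<in>fst ` S. 1 / (real M + 1) \<le> \<rho> (shift G g x) (shift G g y)"
      using s(1) by force
  qed
qed

text \<open>The pairs with \<open>\<rho> x y \<ge> \<kappa>\<close> form a compact set off the diagonal, covered by the open sets of pairs
  that differ at a given coordinate.\<close>
lemma continuity_window:
  assumes \<rho>: "continuous_generating_pseudometric G (shift G) TX \<rho>" and \<kappa>: "0 < \<kappa>"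
  shows "\<exists>E. finite E \<and> E \<subseteq> carrier G \<and> (\<forall>x\<in>X. \<forall>y\<in>X. (\<forall>e\<in>E. x e = y e) \<longrightarrow> \<rho> x y < \<kappa>)"
proof -
  define Z where "Z = {z \<in> topspace TX2. (\<lambda>(x, y). \<rho> x y) z \<in> {\<kappa>..}}"
  have cont: "continuous_map TX2 euclideanreal (\<lambda>(x, y). \<rho> x y)"
    using \<rho> by (simp add: continuous_generating_pseudometric_def)
  have "closedin TX2 Z"
    unfolding Z_def by (rule closedin_continuous_map_preimage[OF cont]) simp
  then have Z: "compactin TX2 Z" by (rule closedin_compact_space[OF compact_TX2])
  define U where "U h = {z \<in> X \<times> X. fst z h \<noteq> snd z h}" for h
  have op: "openin TX2 S" if "S \<in> U ` carrier G" for S using that openin_differ by (auto simp: U_def)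
  have cover: "Z \<subseteq> \<Union>(U ` carrier G)"
  proof
    fix z assume z: "z \<in> Z"
    then have zX: "z \<in> X \<times> X" unfolding Z_def topspace_TX2 by blast
    have "fst z \<noteq> snd z"
    proof
      assume eq: "fst z = snd z"
      have "\<rho> (fst z) (fst z) = 0"
        using \<rho> zX unfolding continuous_generating_pseudometric_def topspace_TX by (metis mem_Times_iff)
      then show False using z \<kappa> eq by (simp add: Z_def split_beta)
    qed
    then obtain h where "h \<in> carrier G" "fst z h \<noteq> snd z h"
      using X_ext[of "fst z" "snd z"] zX by (metis mem_Times_iff)
    then show "z \<in> \<Union>(U ` carrier G)" using zX by (auto simp: U_def)
  qed
  have "\<exists>\<F>. finite \<F> \<and> \<F> \<subseteq> U ` carrier G \<and> Z \<subseteq> \<Union>\<F>"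
    by (rule compactinD[OF Z op cover])
  then obtain \<F> where \<F>: "finite \<F>" "\<F> \<subseteq> U ` carrier G" "Z \<subseteq> \<Union>\<F>"
    by (elim exE conjE)
  obtain E where E: "E \<subseteq> carrier G" "finite E" "\<F> = U ` E"
    using finite_subset_image[OF \<F>(1,2)] by metis
  have "\<rho> x y < \<kappa>" if xy: "x \<in> X" "y \<in> X" "\<forall>e\<in>E. x e = y e" for x y
  proof (rule ccontr)
    assume "\<not> \<rho> x y < \<kappa>"
    then have "(x, y) \<in> Z" unfolding Z_def topspace_TX2 using xy by simp
    then obtain e where "e \<in> E" "(x, y) \<in> U e" using \<F>(3) E(3) by auto
    then show False using xy(3) by (simp add: U_def)
  qed
  then show ?thesis using E by blast
qed

end

lemma sum_squares_defect_count:
  fixes r :: "'d \<Rightarrow> real"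
  assumes "finite D" "0 < c" "(\<Sum>i\<in>D. (r i)\<^sup>2) \<le> s"
  shows "real (card {i \<in> D. c \<le> r i}) * c\<^sup>2 \<le> s"
proof -
  have "real (card {i \<in> D. c \<le> r i}) * c\<^sup>2 = (\<Sum>i\<in>{i \<in> D. c \<le> r i}. c\<^sup>2)" by simp
  also have "\<dots> \<le> (\<Sum>i\<in>{i \<in> D. c \<le> r i}. (r i)\<^sup>2)"
    using assms by (intro sum_mono power_mono) auto
  also have "\<dots> \<le> (\<Sum>i\<in>D. (r i)\<^sup>2)" using assms by (intro sum_mono2) auto
  finally show ?thesis using assms by linarith
qed

context finite_quotient
begin

text \<open>The separated set consists of the orbit maps \<open>i \<mapsto> pullback a i\<close>, which are exactly equivariant. If \<open>a\<close> and
  \<open>b\<close> differ at \<open>i\<close>, their pullbacks at \<open>i\<close> differ at the identity, and so are \<open>\<kappa>\<close> apart at the position to which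
  some \<open>g \<in> F0\<close> moves \<open>i\<close>.\<close>
lemma max_separated_ge_fixed:
  assumes \<rho>: "continuous_generating_pseudometric G (shift G) TX \<rho>"
    and F0: "F0 \<subseteq> carrier G"
    and sep: "\<And>x y. \<lbrakk>x \<in> X; y \<in> X; x \<one> \<noteq> y \<one>\<rbrakk> \<Longrightarrow> \<exists>g\<in>F0. \<kappa> \<le> \<rho> (shift G g x) (shift G g y)"
    and F: "F \<subseteq> carrier G" and \<delta>: "0 < \<delta>"
  shows "enat (card (fixed_points G H X)) \<le> max_separated (rho_inf \<rho> D) \<kappa>
           (top_microstates (shift G) X \<rho> F \<delta> D (coset_sofic G))"
proof -
  let ?M = "top_microstates (shift G) X \<rho> F \<delta> D (coset_sofic G)"
  define \<Phi> where "\<Phi> a = (\<lambda>i\<in>D. pullback a i)" for a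
  have PX: "pullback a i \<in> X" if "a \<in> periodic_configs H" "i \<in> D" for a i
    using that by (auto simp: periodic_configs_def)
  have rho0: "\<rho> x x = 0" if "x \<in> X" for x
    using \<rho> that unfolding continuous_generating_pseudometric_def topspace_TX by blast
  have micro: "\<Phi> a \<in> ?M" if a: "a \<in> periodic_configs H" for a
    unfolding top_microstates_def
  proof (intro CollectI conjI ballI)
    show "\<Phi> a \<in> D \<rightarrow>\<^sub>E X" using PX[OF a] by (auto simp: \<Phi>_def)
    fix f assume "f \<in> F"
    then have f: "f \<in> carrier G" using F by auto
    have "\<rho> (\<Phi> a (coset_sofic G f i)) (shift G f (\<Phi> a i)) = 0" if i: "i \<in> D" for i
      using rho0[OF X_shift[OF f PX[OF a i]]] i coset_sofic_D[OF i f] pullback_equivariant[OF i f]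
      by (simp add: \<Phi>_def)
    then show "rho_2 \<rho> D (\<lambda>i. \<Phi> a (coset_sofic G f i)) (\<lambda>i. shift G f (\<Phi> a i)) < \<delta>"
      using \<delta> by (simp add: rho_2_def)
  qed
  have far: "\<kappa> \<le> rho_inf \<rho> D (\<Phi> a) (\<Phi> b)"
    if a: "a \<in> periodic_configs H" and b: "b \<in> periodic_configs H" and ne: "a \<noteq> b" for a b
  proof -
    have "\<exists>i\<in>D. a i \<noteq> b i"
    proof (rule ccontr)
      assume "\<not> ?thesis"
      then have "a = b" using a b unfolding periodic_configs_def by (auto intro: extensionalityI simp: PiE_def)
      then show False using ne by simp
    qed
    then obtain i where i: "i \<in> D" "a i \<noteq> b i" by blast
    then have "pullback a i \<one> \<noteq> pullback b i \<one>" by (simp add: pullback_apply D_translate_one)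
    then obtain g where g: "g \<in> F0" "\<kappa> \<le> \<rho> (shift G g (pullback a i)) (shift G g (pullback b i))"
      using sep[OF PX[OF a i(1)] PX[OF b i(1)]] by blast
    have gG: "g \<in> carrier G" using g(1) F0 by auto
    let ?j = "coset_sofic G g i"
    have j: "?j \<in> D" by (rule coset_sofic_D[OF i(1) gG])
    have "\<kappa> \<le> \<rho> (\<Phi> a ?j) (\<Phi> b ?j)"
      using g(2) j pullback_equivariant[OF i(1) gG] by (simp add: \<Phi>_def)
    also have "\<dots> \<le> rho_inf \<rho> D (\<Phi> a) (\<Phi> b)"
      unfolding rho_inf_def using finite_index j by (intro Max_ge) auto
    finally show ?thesis .
  qed
  have inj: "inj_on \<Phi> (periodic_configs H)"
  proof (rule inj_onI)
    fix a b assume a: "a \<in> periodic_configs H" and b: "b \<in> periodic_configs H" and eq: "\<Phi> a = \<Phi> b"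
    obtain i where i: "i \<in> D" using D_nonempty by blast
    have "pullback a i = pullback b i" using fun_cong[OF eq, of i] i by (simp add: \<Phi>_def)
    then show "a = b" using bij_betw_imp_inj_on[OF bij_pullback[OF i]] a b by (auto dest: inj_onD)
  qed
  have "card (fixed_points G H X) = card (\<Phi> ` periodic_configs H)"
    using inj by (simp add: card_image card_fixed)
  moreover have "\<Phi> ` periodic_configs H \<in> {S. S \<subseteq> ?M \<and> finite S \<and>
      (\<forall>\<phi>\<in>S. \<forall>\<psi>\<in>S. \<phi> \<noteq> \<psi> \<longrightarrow> \<kappa> \<le> rho_inf \<rho> D \<phi> \<psi>)}"
    using micro far periodic_configs_finite by auto
  then have "enat (card (\<Phi> ` periodic_configs H)) \<le> max_separated (rho_inf \<rho> D) \<kappa> ?M"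
    unfolding max_separated_def by (rule SUP_upper)
  ultimately show ?thesis by simp
qed

text \<open>Write \<open>g i\<close> for \<open>coset_sofic G g i\<close>, so that \<open>v\<inverse> i\<close> is \<open>i #> v\<close>. If \<open>\<phi> i\<close> and \<open>\<phi> (i #> v)\<close> do not match, some \<open>g \<in> F0\<close> witnesses it by a distance of at least \<open>\<kappa>0\<close> between
  \<open>g v\<inverse> \<phi>(i)\<close> and \<open>g \<phi>(v\<inverse> i)\<close>. By the triangle inequality through \<open>\<phi>(g v\<inverse> i)\<close>, equivariance fails by at least
  \<open>\<kappa>0 / 2\<close>, either for \<open>g v\<inverse>\<close> at \<open>i\<close> or for \<open>g\<close> at \<open>v\<inverse> i\<close>. Since \<open>rho_2\<close> is less than \<open>\<delta>\<close>, for given \<open>g\<close> and \<open>v\<close>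
  each of these happens for at most \<open>4 \<delta>\<^sup>2 / \<kappa>0\<^sup>2 card D\<close> positions.\<close>
lemma card_defects_le:
  assumes \<rho>: "continuous_generating_pseudometric G (shift G) TX \<rho>"
    and F0: "finite F0" "F0 \<subseteq> carrier G" and \<kappa>0: "0 < \<kappa>0"
    and sep: "\<And>x y. \<lbrakk>x \<in> X; y \<in> X; x \<one> \<noteq> y \<one>\<rbrakk> \<Longrightarrow> \<exists>g\<in>F0. \<kappa>0 \<le> \<rho> (shift G g x) (shift G g y)"
    and V: "finite V" "V \<subseteq> carrier G" and \<delta>: "0 < \<delta>"
    and F: "F = F0 \<union> (\<lambda>(g, v). g \<otimes> inv v) ` (F0 \<times> V)"
    and \<phi>: "\<phi> \<in> top_microstates (shift G) X \<rho> F \<delta> D (coset_sofic G)"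
  shows "real (card {i \<in> D. \<exists>v\<in>V. \<phi> i v \<noteq> \<phi> (i #> v) \<one>})
      \<le> 8 * real (card V * card F0) * \<delta>\<^sup>2 / \<kappa>0\<^sup>2 * real (card D)"
proof -
  have \<phi>X: "\<phi> i \<in> X" if "i \<in> D" for i using \<phi> that by (auto simp: top_microstates_def)
  define def where "def f = {i \<in> D. \<kappa>0 / 2 \<le> \<rho> (\<phi> (coset_sofic G f i)) (shift G f (\<phi> i))}" for f
  define b where "b = 4 * \<delta>\<^sup>2 / \<kappa>0\<^sup>2 * real (card D)"
  have def_card: "real (card (def f)) \<le> b" if f: "f \<in> F" for f
  proof -
    have "rho_2 \<rho> D (\<lambda>i. \<phi> (coset_sofic G f i)) (\<lambda>i. shift G f (\<phi> i)) < \<delta>"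
      using \<phi> f by (simp add: top_microstates_def)
    then have "(\<Sum>i\<in>D. (\<rho> (\<phi> (coset_sofic G f i)) (shift G f (\<phi> i)))\<^sup>2) / real (card D) < \<delta>\<^sup>2"
      unfolding rho_2_def using \<delta> by (metis less_eq_real_def real_sqrt_less_iff real_sqrt_unique)
    then have "(\<Sum>i\<in>D. (\<rho> (\<phi> (coset_sofic G f i)) (shift G f (\<phi> i)))\<^sup>2) \<le> \<delta>\<^sup>2 * real (card D)"
      using card_D_pos by (simp add: field_simps)
    from sum_squares_defect_count[OF finite_index _ this, of "\<kappa>0 / 2"]
    have "real (card (def f)) * (\<kappa>0 / 2)\<^sup>2 \<le> \<delta>\<^sup>2 * real (card D)" using \<kappa>0 by (simp add: def_def)
    then show ?thesis using \<kappa>0 by (simp add: b_def field_simps power2_eq_square)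
  qed
  have FG: "f \<in> carrier G" if "f \<in> F" for f using that F F0 V by auto
  define sh where "sh g v = {i \<in> D. coset_sofic G (inv v) i \<in> def g}" for g v
  have sh_card: "real (card (sh g v)) \<le> b" if g: "g \<in> F0" and v: "v \<in> V" for g v
  proof -
    have vG: "v \<in> carrier G" using v V by auto
    have "bij_betw (coset_sofic G (inv v)) D D"
      using bij_D_translate[OF vG] vG by (simp add: coset_sofic_def[abs_def])
    then have "inj_on (coset_sofic G (inv v)) (sh g v)"
      by (rule inj_on_subset[OF bij_betw_imp_inj_on]) (auto simp: sh_def)
    moreover have "coset_sofic G (inv v) ` sh g v \<subseteq> def g" by (auto simp: sh_def)
    moreover have "finite (def g)" using finite_index by (simp add: def_def)
    ultimately have "card (sh g v) \<le> card (def g)" by (rule card_inj_on_le)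
    then show ?thesis using def_card[of g] g F by (auto intro: order_trans[OF of_nat_mono])
  qed
  let ?B = "{i \<in> D. \<exists>v\<in>V. \<phi> i v \<noteq> \<phi> (i #> v) \<one>}"
  let ?U = "\<Union>(g, v)\<in>F0 \<times> V. sh g v \<union> def (g \<otimes> inv v)"
  have "?B \<subseteq> ?U"
  proof
    fix i assume "i \<in> ?B"
    then obtain v where i: "i \<in> D" and v: "v \<in> V" and ne: "\<phi> i v \<noteq> \<phi> (i #> v) \<one>" by blast
    have vG: "v \<in> carrier G" using v V by auto
    let ?f = "inv v"
    let ?j = "coset_sofic G ?f i"
    have j: "?j \<in> D" "?j = i #> v" using coset_sofic_D[OF i, of ?f] vG by (auto simp: coset_sofic_def)
    have "shift G ?f (\<phi> i) \<one> = \<phi> i v" using vG by (simp add: shift_apply)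
    then have "\<phi> ?j \<one> \<noteq> shift G ?f (\<phi> i) \<one>" using ne j(2) by simp
    moreover have fX: "shift G ?f (\<phi> i) \<in> X" using X_shift \<phi>X[OF i] vG by simp
    ultimately obtain g where g: "g \<in> F0" "\<kappa>0 \<le> \<rho> (shift G g (\<phi> ?j)) (shift G g (shift G ?f (\<phi> i)))"
      using sep[OF \<phi>X[OF j(1)]] by blast
    have gG: "g \<in> carrier G" using g(1) F0 by auto
    have gf: "coset_sofic G (g \<otimes> ?f) i = coset_sofic G g ?j"
      using gG vG i by (simp add: coset_sofic_def G.inv_mult_group D_translate_mult)
    let ?w = "\<phi> (coset_sofic G g ?j)"
    have pts: "?w \<in> X" "shift G g (\<phi> ?j) \<in> X" "shift G (g \<otimes> ?f) (\<phi> i) \<in> X"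
      using \<phi>X coset_sofic_D[OF j(1) gG] X_shift gG vG j(1) i by auto
    have tri: "\<rho> (shift G g (\<phi> ?j)) (shift G (g \<otimes> ?f) (\<phi> i))
        \<le> \<rho> (shift G g (\<phi> ?j)) ?w + \<rho> ?w (shift G (g \<otimes> ?f) (\<phi> i))"
      and symm: "\<rho> (shift G g (\<phi> ?j)) ?w = \<rho> ?w (shift G g (\<phi> ?j))"
      using \<rho> pts unfolding continuous_generating_pseudometric_def topspace_TX by blast+
    have "\<kappa>0 / 2 \<le> \<rho> ?w (shift G g (\<phi> ?j)) \<or> \<kappa>0 / 2 \<le> \<rho> ?w (shift G (g \<otimes> ?f) (\<phi> i))"
    proof (rule disjCI)
      have "shift G (g \<otimes> ?f) (\<phi> i) = shift G g (shift G ?f (\<phi> i))"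
        by (rule shift_mult) (use gG vG in auto)
      then have "\<kappa>0 \<le> \<rho> (shift G g (\<phi> ?j)) (shift G (g \<otimes> ?f) (\<phi> i))" using g(2) by (simp only:)
      moreover assume "\<not> \<kappa>0 / 2 \<le> \<rho> ?w (shift G (g \<otimes> ?f) (\<phi> i))"
      ultimately show "\<kappa>0 / 2 \<le> \<rho> ?w (shift G g (\<phi> ?j))" using tri symm by linarith
    qed
    then have "i \<in> sh g v \<union> def (g \<otimes> ?f)"
      using i j(1) gf by (auto simp: sh_def def_def)
    then show "i \<in> ?U" using g(1) v by blast
  qed
  moreover have "finite ?U" using F0 V finite_index by (auto simp: sh_def def_def)
  ultimately have "real (card ?B) \<le> real (card ?U)" by (intro of_nat_mono card_mono)
  also have "\<dots> \<le> real (\<Sum>(g, v)\<in>F0 \<times> V. card (sh g v \<union> def (g \<otimes> inv v)))"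
    using card_UN_le[of "F0 \<times> V" "\<lambda>(g, v). sh g v \<union> def (g \<otimes> inv v)"] F0 V
    by (intro of_nat_mono) (simp add: split_beta)
  also have "\<dots> = (\<Sum>(g, v)\<in>F0 \<times> V. real (card (sh g v \<union> def (g \<otimes> inv v))))"
    by (simp add: split_beta)
  also have "\<dots> \<le> (\<Sum>(g, v)\<in>F0 \<times> V. 2 * b)"
  proof (rule sum_mono, clarify)
    fix g v assume gv: "g \<in> F0" "v \<in> V"
    have "real (card (sh g v \<union> def (g \<otimes> inv v))) \<le> real (card (sh g v)) + real (card (def (g \<otimes> inv v)))"
      using card_Un_le by (metis of_nat_add of_nat_mono)
    also have "\<dots> \<le> b + b"
      using gv F by (intro add_mono sh_card def_card) auto
    finally show "real (card (sh g v \<union> def (g \<otimes> inv v))) \<le> 2 * b" by simp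
  qed
  also have "\<dots> = 8 * real (card V * card F0) * \<delta>\<^sup>2 / \<kappa>0\<^sup>2 * real (card D)"
    by (simp add: b_def card_cartesian_product)
  finally show ?thesis .
qed

end

context alg_subshift
begin

text \<open>The identity coordinates of \<open>\<phi>\<close> form a configuration which, off the defects, shows the patterns of the
  points \<open>\<phi> i\<close> of \<open>X\<close>. Together with the patterns of \<open>\<phi>\<close> at the defects it determines \<open>\<phi>\<close> on the window \<open>E\<close>, hence up
  to \<open>\<kappa>\<close> in the maximum metric.\<close>
lemma top_microstates_bound:
  assumes \<rho>: "continuous_generating_pseudometric G (shift G) TX \<rho>" and V0: "window_rule V0"
    and \<kappa>: "0 < \<kappa>" and \<epsilon>: "0 < \<epsilon>"
  shows "\<exists>\<delta>>0. \<exists>F. finite F \<and> F \<subseteq> carrier G \<and> (\<forall>H. finite_quotient G K X H \<longrightarrow>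
    (\<forall>S. S \<subseteq> top_microstates (shift G) X \<rho> F \<delta> (rcosets H) (coset_sofic G) \<longrightarrow>
      (\<forall>\<phi>\<in>S. \<forall>\<psi>\<in>S. \<phi> \<noteq> \<psi> \<longrightarrow> \<kappa> \<le> rho_inf \<rho> (rcosets H) \<phi> \<psi>) \<longrightarrow>
      real (card S) \<le> real (card (fixed_points G H X)) * exp (\<epsilon> * real (card (rcosets H)))))"
proof -
  obtain E where E: "finite E" "E \<subseteq> carrier G"
    and close: "\<And>x y. \<lbrakk>x \<in> X; y \<in> X; \<And>e. e \<in> E \<Longrightarrow> x e = y e\<rbrakk> \<Longrightarrow> \<rho> x y < \<kappa>"
    using continuity_window[OF \<rho> \<kappa>] by metis
  obtain F0 \<kappa>0 where F0: "finite F0" "F0 \<subseteq> carrier G" and \<kappa>0: "0 < \<kappa>0"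
    and sep: "\<And>x y. \<lbrakk>x \<in> X; y \<in> X; x \<one> \<noteq> y \<one>\<rbrakk> \<Longrightarrow> \<exists>g\<in>F0. \<kappa>0 \<le> \<rho> (shift G g x) (shift G g y)"
    using generating_separation[OF \<rho>] by metis
  define V where "V = V0 \<union> E"
  have V0f: "finite V0" "V0 \<subseteq> carrier G" using V0 by (auto simp: window_rule_def)
  have Vf: "finite V" "V \<subseteq> carrier G" using V0f E by (auto simp: V_def)
  have V: "window_rule V" by (rule window_rule_mono[OF V0 Vf(1) _ Vf(2)]) (simp add: V_def)
  define R where "R = V \<rightarrow>\<^sub>E carrier K"
  have R: "finite R" "R \<noteq> {}" using Vf finite_K by (auto simp: R_def PiE_eq_empty_iff intro: finite_PiE)
  define c where "c = real (card (carrier K)) ^ card V * real (card R)"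
  have "0 < card (carrier K)" "0 < card R" using finite_K R K.one_closed by (auto simp: card_gt_0_iff)
  then have "0 < card (carrier K) ^ card V * card R" by simp
  then have "1 \<le> card (carrier K) ^ card V * card R" by linarith
  then have c: "1 \<le> c" unfolding c_def by (metis of_nat_1 of_nat_le_iff of_nat_mult of_nat_power)
  from small_defect_rate[OF c \<epsilon>, where 'd = "'g set"]
  obtain \<eta> where \<eta>: "0 < \<eta>" and rate: "\<forall>D :: 'g set set. finite D \<longrightarrow>
    (\<Sum>B | B \<subseteq> D \<and> real (card B) \<le> \<eta> * real (card D). c ^ card B) \<le> exp (\<epsilon> * real (card D))"
    by (elim exE conjE)
  define n where "n = real (card V * card F0)"
  define \<delta> where "\<delta> = sqrt (\<eta> * \<kappa>0\<^sup>2 / (8 * (n + 1)))"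
  have n: "0 \<le> n" by (simp add: n_def)
  have \<delta>: "0 < \<delta>" using \<eta> \<kappa>0 n by (simp add: \<delta>_def)
  have \<delta>2: "\<delta>\<^sup>2 = \<eta> * \<kappa>0\<^sup>2 / (8 * (n + 1))" using \<eta> n by (simp add: \<delta>_def)
  have small: "8 * n * \<delta>\<^sup>2 / \<kappa>0\<^sup>2 \<le> \<eta>"
    using \<eta> \<kappa>0 n by (simp add: \<delta>2 divide_simps)
  define F where "F = F0 \<union> (\<lambda>(g, v). g \<otimes> inv v) ` (F0 \<times> V)"
  have F: "finite F" "F \<subseteq> carrier G" using F0 Vf by (auto simp: F_def)
  have "real (card S) \<le> real (card (fixed_points G H X)) * exp (\<epsilon> * real (card (rcosets H)))"
    if H: "finite_quotient G K X H"
      and S: "S \<subseteq> top_microstates (shift G) X \<rho> F \<delta> (rcosets H) (coset_sofic G)"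
      and far: "\<forall>\<phi>\<in>S. \<forall>\<psi>\<in>S. \<phi> \<noteq> \<psi> \<longrightarrow> \<kappa> \<le> rho_inf \<rho> (rcosets H) \<phi> \<psi>" for H S
  proof -
    interpret finite_quotient G K X H by (rule H)
    define conf where "conf \<phi> = (\<lambda>i\<in>D. \<phi> i \<one>)" for \<phi> :: "'g set \<Rightarrow> 'g \<Rightarrow> 'k"
    define bad where "bad \<phi> = {i \<in> D. \<exists>v\<in>V. \<phi> i v \<noteq> \<phi> (i #> v) \<one>}" for \<phi> :: "'g set \<Rightarrow> 'g \<Rightarrow> 'k"
    define data where "data \<phi> i = restrict (\<phi> i) V" for \<phi> :: "'g set \<Rightarrow> 'g \<Rightarrow> 'k" and i
    have \<phi>X: "\<phi> i \<in> X" if "\<phi> \<in> S" "i \<in> D" for \<phi> i using that S by (auto simp: top_microstates_def)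
    have pb: "pullback (conf \<phi>) i v = \<phi> i v" if "i \<in> D" "i \<notin> bad \<phi>" "v \<in> V" for \<phi> i v
      using that Vf D_translate[of i v] by (auto simp: pullback_apply conf_def bad_def subset_iff)
    have "real (card S) \<le> real (card (periodic_configs H)) *
      (\<Sum>B | B \<subseteq> D \<and> real (card B) \<le> \<eta> * real (card D). (real (card (carrier K)) ^ card V * real (card R)) ^ card B)"
    proof (rule coded_bound(2)[OF V R, where conf = conf and bad = bad and data = data])
      fix \<phi> assume \<phi>: "\<phi> \<in> S"
      show "conf \<phi> \<in> D \<rightarrow>\<^sub>E carrier K" using X_K[OF \<phi>X[OF \<phi>]] by (auto simp: conf_def)
      show "bad \<phi> \<subseteq> D" by (auto simp: bad_def)
      have "real (card (bad \<phi>)) \<le> 8 * n * \<delta>\<^sup>2 / \<kappa>0\<^sup>2 * real (card D)"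
        unfolding bad_def n_def
        by (rule card_defects_le[OF \<rho> F0 \<kappa>0 sep Vf \<delta> F_def]) (use \<phi> S in auto)
      also have "\<dots> \<le> \<eta> * real (card D)" using small by (intro mult_right_mono) auto
      finally show "real (card (bad \<phi>)) \<le> \<eta> * real (card D)" .
      show "legal V (conf \<phi>) i" if "i \<in> D" "i \<notin> bad \<phi>" for i
        unfolding legal_def using pb[OF that] \<phi>X[OF \<phi> that(1)] by blast
      show "data \<phi> i \<in> R" if "i \<in> bad \<phi>" for i
      proof -
        have "\<phi> i \<in> X" using that \<phi>X[OF \<phi>] by (simp add: bad_def)
        then show ?thesis using Vf X_K by (auto simp: data_def R_def)
      qed
      fix \<psi> assume \<psi>: "\<psi> \<in> S" and eq: "conf \<phi> = conf \<psi>" "bad \<phi> = bad \<psi>"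
        "\<And>i. i \<in> bad \<phi> \<Longrightarrow> data \<phi> i = data \<psi> i"
      have "\<rho> (\<phi> i) (\<psi> i) < \<kappa>" if i: "i \<in> D" for i
      proof (rule close[OF \<phi>X[OF \<phi> i] \<phi>X[OF \<psi> i]])
        fix e assume "e \<in> E"
        then have e: "e \<in> V" by (simp add: V_def)
        show "\<phi> i e = \<psi> i e"
        proof (cases "i \<in> bad \<phi>")
          case True
          then show ?thesis using fun_cong[OF eq(3), of i e] e by (simp add: data_def)
        next
          case False
          then show ?thesis using pb[OF i _ e, of \<phi>] pb[OF i _ e, of \<psi>] eq(1,2) by simp
        qed
      qed
      then have "rho_inf \<rho> D \<phi> \<psi> < \<kappa>"
        unfolding rho_inf_def using finite_index D_nonempty by (subst Max_less_iff) auto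
      then show "\<phi> = \<psi>" using far \<phi> \<psi> by (meson not_le)
    qed
    also have "\<dots> \<le> real (card (periodic_configs H)) * exp (\<epsilon> * real (card D))"
      using rate[rule_format, OF finite_index] by (intro mult_left_mono) (simp_all add: c_def)
    finally show ?thesis by (simp add: card_fixed)
  qed
  then show ?thesis using \<delta> F by (intro exI[of _ \<delta>] exI[of _ F] conjI allI impI) auto
qed

end

section \<open>Measured entropy\<close>

text \<open>This sums the defining estimate of a microstate over the patterns outside \<open>\<G>\<close>. It bounds the number of
  positions at which the microstate does not look like any point of a large set.\<close>
lemma meas_microstates_frequency:
  assumes D: "finite D" "D \<noteq> {}" and A: "finite A" and F: "finite F"
    and a: "a \<in> meas_microstates act \<mu> A \<alpha> F \<epsilon> D s"
    and s: "\<And>f i. \<lbrakk>f \<in> F; i \<in> D\<rbrakk> \<Longrightarrow> s f i \<in> D"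
    and \<alpha>: "\<And>f x. \<lbrakk>f \<in> F; x \<in> space \<mu>\<rbrakk> \<Longrightarrow> \<alpha> (act f x) \<in> A"
    and meas: "\<And>p. p \<in> F \<rightarrow>\<^sub>E A \<Longrightarrow> {x \<in> space \<mu>. \<forall>f\<in>F. \<alpha> (act f x) = p f} \<in> sets \<mu>"
    and fin: "finite_measure \<mu>"
  shows "real (card {i \<in> D. (\<lambda>f\<in>F. a (s f i)) \<notin> \<G>})
      \<le> (measure \<mu> {x \<in> space \<mu>. (\<lambda>f\<in>F. \<alpha> (act f x)) \<notin> \<G>} + \<epsilon> * real (card (F \<rightarrow>\<^sub>E A))) * real (card D)"
proof -
  interpret finite_measure \<mu> by (rule fin)
  let ?N = "(F \<rightarrow>\<^sub>E A) - \<G>"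
  define I where "I p = {i \<in> D. \<forall>f\<in>F. a (s f i) = p f}" for p
  define Y where "Y p = {x \<in> space \<mu>. \<forall>f\<in>F. \<alpha> (act f x) = p f}" for p
  have m: "0 < real (card D)" using D by (simp add: card_gt_0_iff)
  have N: "finite ?N" using A F by (auto intro: finite_PiE)
  have aD: "a j \<in> A" if "j \<in> D" for j using a that by (auto simp: meas_microstates_def)
  have eps: "0 \<le> \<epsilon>"
  proof -
    obtain j where "j \<in> D" using D by blast
    then have "(\<lambda>f\<in>F. a j) \<in> F \<rightarrow>\<^sub>E A" using aD by auto
    then show ?thesis using a unfolding meas_microstates_def by fastforce
  qed
  have I_le: "real (card (I p)) \<le> (measure \<mu> (Y p) + \<epsilon>) * real (card D)" if "p \<in> ?N" for p
  proof -
    have "\<bar>measure \<mu> (Y p) - real (card (I p)) / real (card D)\<bar> \<le> \<epsilon>"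
      using a that unfolding meas_microstates_def I_def Y_def by blast
    then have "real (card (I p)) / real (card D) \<le> measure \<mu> (Y p) + \<epsilon>" by linarith
    then show ?thesis using m by (simp add: pos_divide_le_eq)
  qed
  have "{i \<in> D. (\<lambda>f\<in>F. a (s f i)) \<notin> \<G>} \<subseteq> (\<Union>p\<in>?N. I p)"
  proof
    fix i assume i: "i \<in> {i \<in> D. (\<lambda>f\<in>F. a (s f i)) \<notin> \<G>}"
    then have "(\<lambda>f\<in>F. a (s f i)) \<in> ?N" using aD s by auto
    moreover have "i \<in> I (\<lambda>f\<in>F. a (s f i))" using i by (simp add: I_def)
    ultimately show "i \<in> (\<Union>p\<in>?N. I p)" by blast
  qed
  moreover have "finite (\<Union>p\<in>?N. I p)" using N D by (auto simp: I_def)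
  ultimately have "card {i \<in> D. (\<lambda>f\<in>F. a (s f i)) \<notin> \<G>} \<le> card (\<Union>p\<in>?N. I p)"
    by (intro card_mono)
  also have "\<dots> \<le> (\<Sum>p\<in>?N. card (I p))" by (rule card_UN_le[OF N])
  finally have "real (card {i \<in> D. (\<lambda>f\<in>F. a (s f i)) \<notin> \<G>}) \<le> real (\<Sum>p\<in>?N. card (I p))" by (rule of_nat_mono)
  also have "\<dots> = (\<Sum>p\<in>?N. real (card (I p)))" by simp
  also have "\<dots> \<le> (\<Sum>p\<in>?N. (measure \<mu> (Y p) + \<epsilon>) * real (card D))" by (rule sum_mono[OF I_le])
  also have "\<dots> = ((\<Sum>p\<in>?N. measure \<mu> (Y p)) + \<epsilon> * real (card ?N)) * real (card D)"
    by (simp add: sum_distrib_right[symmetric] sum.distrib)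
  also have "(\<Sum>p\<in>?N. measure \<mu> (Y p)) = measure \<mu> (\<Union>p\<in>?N. Y p)"
  proof (rule finite_measure_finite_Union[symmetric, OF N])
    show "Y ` ?N \<subseteq> sets \<mu>" using meas by (auto simp: Y_def)
    show "disjoint_family_on Y ?N"
      unfolding disjoint_family_on_def
    proof (intro ballI impI)
      fix p q assume p: "p \<in> ?N" and q: "q \<in> ?N" and ne: "p \<noteq> q"
      have "p = q" if "x \<in> Y p" "x \<in> Y q" for x
      proof (rule extensionalityI[of p F])
        show "p \<in> extensional F" "q \<in> extensional F" using p q by (auto simp: PiE_def)
        show "p f = q f" if "f \<in> F" for f using that \<open>x \<in> Y p\<close> \<open>x \<in> Y q\<close> by (simp add: Y_def)
      qed
      then show "Y p \<inter> Y q = {}" using ne by blast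
    qed
  qed
  also have "(\<Union>p\<in>?N. Y p) = {x \<in> space \<mu>. (\<lambda>f\<in>F. \<alpha> (act f x)) \<notin> \<G>}"
  proof (intro Set.set_eqI iffI)
    fix x assume "x \<in> (\<Union>p\<in>?N. Y p)"
    then obtain p where p: "p \<in> ?N" "x \<in> Y p" by blast
    have "(\<lambda>f\<in>F. \<alpha> (act f x)) = p"
      using p by (intro extensionalityI[of _ F]) (auto simp: Y_def PiE_def)
    then show "x \<in> {x \<in> space \<mu>. (\<lambda>f\<in>F. \<alpha> (act f x)) \<notin> \<G>}" using p by (simp add: Y_def)
  next
    fix x assume x: "x \<in> {x \<in> space \<mu>. (\<lambda>f\<in>F. \<alpha> (act f x)) \<notin> \<G>}"
    then have "(\<lambda>f\<in>F. \<alpha> (act f x)) \<in> ?N" using \<alpha> by auto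
    moreover have "x \<in> Y (\<lambda>f\<in>F. \<alpha> (act f x))" using x by (simp add: Y_def)
    ultimately show "x \<in> (\<Union>p\<in>?N. Y p)" by blast
  qed
  also have "(measure \<mu> {x \<in> space \<mu>. (\<lambda>f\<in>F. \<alpha> (act f x)) \<notin> \<G>} + \<epsilon> * real (card ?N)) * real (card D)
      \<le> (measure \<mu> {x \<in> space \<mu>. (\<lambda>f\<in>F. \<alpha> (act f x)) \<notin> \<G>} + \<epsilon> * real (card (F \<rightarrow>\<^sub>E A))) * real (card D)"
  proof -
    have "card ?N \<le> card (F \<rightarrow>\<^sub>E A)" using A F by (intro card_mono finite_PiE) auto
    then show ?thesis using eps by (intro mult_right_mono add_left_mono mult_left_mono) auto
  qed
  finally show ?thesis .
qed

context haar_subshift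
begin

lemma pattern_sets:
  assumes A: "\<alpha> \<in> measurable \<mu> (count_space A)" and F: "finite F" "F \<subseteq> carrier G" and p: "p \<in> F \<rightarrow>\<^sub>E A"
  shows "{x \<in> space \<mu>. \<forall>f\<in>F. \<alpha> (shift G f x) = p f} \<in> sets \<mu>"
proof -
  have "{x \<in> space \<mu>. \<alpha> (shift G f x) = p f} \<in> sets \<mu>" if f: "f \<in> F" for f
  proof -
    have "(\<lambda>x. \<alpha> (shift G f x)) \<in> measurable \<mu> (count_space A)"
      using measurable_compose[OF measurable_shift A] f F by auto
    moreover have "p f \<in> A" using p f by auto
    moreover have "{x \<in> space \<mu>. \<alpha> (shift G f x) = p f} = (\<lambda>x. \<alpha> (shift G f x)) -` {p f} \<inter> space \<mu>" by auto
    ultimately show ?thesis by (simp add: measurable_sets)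
  qed
  then show ?thesis using F by (intro sets.sets_Collect_finite_All) auto
qed

text \<open>The partition \<open>\<beta>\<close> is refined by the identity coordinate, and approximated by a function \<open>\<beta>'\<close> with a
  finite window. At all but few positions, the coordinate part of a microstate shows a pattern of \<open>X\<close>
  and its \<open>\<beta>\<close> part is the value of \<open>\<beta>'\<close> on this pattern. So the \<open>\<beta>\<close> part, which is what the entropy counts, is
  coded by the coordinate part and its own values at the exceptional positions.\<close>
lemma meas_microstates_bound:
  assumes V0: "window_rule V0" and B: "finite B" and \<beta>: "\<beta> \<in> measurable \<mu> (count_space B)" and \<epsilon>0: "0 < \<epsilon>0"
  shows "\<exists>A \<alpha> \<theta> \<epsilon> F. (A, \<alpha>, \<theta>) \<in> finite_refinements \<mu> B \<beta> \<and> 0 < \<epsilon> \<and> finite F \<and> F \<subseteq> carrier G \<and>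
    (\<forall>H. finite_quotient G K X H \<longrightarrow>
      real (card (compose (rcosets H) \<theta> ` meas_microstates (shift G) \<mu> A \<alpha> F \<epsilon> (rcosets H) (coset_sofic G)))
        \<le> real (card (fixed_points G H X)) * exp (\<epsilon>0 * real (card (rcosets H))))"
proof -
  have \<beta>B: "\<beta> x \<in> B" if "x \<in> X" for x using measurable_space[OF \<beta>, of x] that by (simp add: space_haar)
  have Bne: "B \<noteq> {}" using \<beta>B X_one by auto
  have V0f: "finite V0" "V0 \<subseteq> carrier G" using V0 by (auto simp: window_rule_def)
  \<comment> \<open>The extra data of the code are values in \<open>B\<close>, and legality is counted on the window \<open>V0\<close>. So \<open>c\<close> does not
    depend on the window of \<open>\<beta>'\<close>, which can only be chosen after \<open>\<eta>\<close>.\<close>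
  define c where "c = real (card (carrier K)) ^ card V0 * real (card B)"
  have "0 < card (carrier K)" "0 < card B" using finite_K B Bne K.one_closed by (auto simp: card_gt_0_iff)
  then have "0 < card (carrier K) ^ card V0 * card B" by simp
  then have "1 \<le> card (carrier K) ^ card V0 * card B" by linarith
  then have c: "1 \<le> c" unfolding c_def by (metis of_nat_1 of_nat_le_iff of_nat_mult of_nat_power)
  from small_defect_rate[OF c \<epsilon>0, where 'd = "'g set"]
  obtain \<eta> where \<eta>: "0 < \<eta>" and rate: "\<forall>D :: 'g set set. finite D \<longrightarrow>
    (\<Sum>B | B \<subseteq> D \<and> real (card B) \<le> \<eta> * real (card D). c ^ card B) \<le> exp (\<epsilon>0 * real (card D))"
    by (elim exE conjE)
  have "window_function {} (\<lambda>_. ())" by (simp add: window_function_def)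
  from window_function_approx[OF B \<beta> this, of "\<lambda>_. ()" "\<eta> / 2"] \<eta>
  obtain E \<beta>' where \<beta>': "window_function E \<beta>'" "measure \<mu> {x \<in> X. \<beta> x \<noteq> \<beta>' x} \<le> \<eta> / 2" by auto
  have E: "finite E" "E \<subseteq> carrier G" using \<beta>'(1) by (auto simp: window_function_def)
  define V where "V = V0 \<union> E"
  have Vf: "finite V" "V \<subseteq> carrier G" using V0f E by (auto simp: V_def)
  define enc where "enc = to_nat_on (carrier K)"
  have enc: "inj_on enc (carrier K)" unfolding enc_def by (intro inj_on_to_nat_on countable_finite finite_K)
  define A where "A = prod_encode ` (B \<times> enc ` carrier K)"
  define \<alpha> where "\<alpha> x = prod_encode (\<beta> x, enc (x \<one>))" for x
  define \<theta> where "\<theta> n = fst (prod_decode n)" for n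
  have A: "finite A" using B finite_K by (simp add: A_def)
  have \<alpha>A: "\<alpha> x \<in> A" if "x \<in> X" for x
    using \<beta>B[OF that] X_K[OF that G.one_closed] by (simp add: \<alpha>_def A_def)
  have \<theta>\<alpha>: "\<theta> (\<alpha> x) = \<beta> x" for x by (simp add: \<theta>_def \<alpha>_def)
  have \<alpha>_meas: "\<alpha> \<in> measurable \<mu> (count_space A)"
    unfolding measurable_count_space_eq2[OF A]
  proof (intro conjI ballI)
    show "\<alpha> \<in> space \<mu> \<rightarrow> A" using \<alpha>A by (auto simp: space_haar)
    fix n assume "n \<in> A"
    then obtain b k where bk: "b \<in> B" "n = prod_encode (b, k)" by (auto simp: A_def)
    have "\<alpha> -` {n} \<inter> space \<mu> = (\<beta> -` {b} \<inter> space \<mu>) \<inter> {x \<in> X. x \<one> \<in> {y. enc y = k}}"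
      by (auto simp: \<alpha>_def bk space_haar)
    moreover have "{x \<in> X. x \<one> \<in> {y. enc y = k}} \<in> sets \<mu>"
      by (rule determined_sets[of "{\<one>}"]) (auto simp: determined_by_def)
    ultimately show "\<alpha> -` {n} \<inter> space \<mu> \<in> sets \<mu>" using measurable_sets[OF \<beta>, of "{b}"] bk by auto
  qed
  have ref: "(A, \<alpha>, \<theta>) \<in> finite_refinements \<mu> B \<beta>"
    using A \<alpha>_meas \<theta>\<alpha> by (auto simp: finite_refinements_def A_def \<theta>_def)
  define F where "F = insert \<one> ((\<lambda>v. inv v) ` V)"
  have F: "finite F" "F \<subseteq> carrier G" using Vf by (auto simp: F_def)
  define \<epsilon> where "\<epsilon> = \<eta> / 2 / (real (card (F \<rightarrow>\<^sub>E A)) + 1)"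
  have \<epsilon>: "0 < \<epsilon>" "\<epsilon> * real (card (F \<rightarrow>\<^sub>E A)) \<le> \<eta> / 2"
    using \<eta> by (auto simp: \<epsilon>_def field_simps intro!: divide_pos_pos)
  define \<G> where "\<G> = (\<lambda>x. \<lambda>f\<in>F. \<alpha> (shift G f x)) ` {x \<in> X. \<beta> x = \<beta>' x}"
  have good_measure: "measure \<mu> {x \<in> space \<mu>. (\<lambda>f\<in>F. \<alpha> (shift G f x)) \<notin> \<G>} \<le> \<eta> / 2"
  proof -
    have "{x \<in> X. \<beta> x \<noteq> \<beta>' x} \<in> sets \<mu>"
    proof -
      have "{x \<in> X. \<beta> x \<noteq> \<beta>' x} = (\<Union>b\<in>B. (\<beta> -` {b} \<inter> space \<mu>) \<inter> {x \<in> X. \<beta>' x \<in> - {b}})"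
        using \<beta>B by (auto simp: space_haar)
      moreover have "(\<beta> -` {b} \<inter> space \<mu>) \<inter> {x \<in> X. \<beta>' x \<in> - {b}} \<in> sets \<mu>" if "b \<in> B" for b
        using measurable_sets[OF \<beta>, of "{b}"] that
          determined_sets[OF E window_function_determined[OF \<beta>'(1), of "- {b}"]] by auto
      ultimately show ?thesis using B by auto
    qed
    moreover have "{x \<in> space \<mu>. (\<lambda>f\<in>F. \<alpha> (shift G f x)) \<notin> \<G>} \<subseteq> {x \<in> X. \<beta> x \<noteq> \<beta>' x}"
      by (auto simp: \<G>_def space_haar)
    ultimately have "measure \<mu> {x \<in> space \<mu>. (\<lambda>f\<in>F. \<alpha> (shift G f x)) \<notin> \<G>} \<le> measure \<mu> {x \<in> X. \<beta> x \<noteq> \<beta>' x}"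
      by (intro finite_measure_mono)
    then show ?thesis using \<beta>'(2) by linarith
  qed
  have "real (card (compose (rcosets H) \<theta> ` meas_microstates (shift G) \<mu> A \<alpha> F \<epsilon> (rcosets H) (coset_sofic G)))
        \<le> real (card (fixed_points G H X)) * exp (\<epsilon>0 * real (card (rcosets H)))"
    if H: "finite_quotient G K X H" for H
  proof -
    interpret finite_quotient G K X H by (rule H)
    let ?M = "meas_microstates (shift G) \<mu> A \<alpha> F \<epsilon> D (coset_sofic G)"
    let ?Q = "compose D \<theta> ` ?M"
    define m where "m q = (SOME a. a \<in> ?M \<and> compose D \<theta> a = q)" for q
    have m: "m q \<in> ?M" "compose D \<theta> (m q) = q" if "q \<in> ?Q" for q
      using someI_ex[of "\<lambda>a. a \<in> ?M \<and> compose D \<theta> a = q"] that unfolding m_def by blast+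
    define conf where "conf q = (\<lambda>i\<in>D. inv_into (carrier K) enc (snd (prod_decode (m q i))))" for q
    define bad where "bad q = {i \<in> D. (\<lambda>f\<in>F. m q (coset_sofic G f i)) \<notin> \<G>}" for q
    have mA: "m q i \<in> A" if "q \<in> ?Q" "i \<in> D" for q i
      using m(1)[OF that(1)] that(2) by (auto simp: meas_microstates_def)
    have q_eq: "q i = \<theta> (m q i)" if "q \<in> ?Q" "i \<in> D" for q i
      using fun_cong[OF m(2)[OF that(1)], of i] that(2) by (simp add: compose_def)
    \<comment> \<open>Off the bad positions, a microstate is modelled on a point \<open>x\<close> of \<open>X\<close> at which \<open>\<beta>\<close> is read off from
      the window.\<close>
    have good: "\<exists>x\<in>X. (\<forall>v\<in>V. pullback (conf q) i v = x v) \<and> q i = \<beta>' x"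
      if q: "q \<in> ?Q" and i: "i \<in> D" "i \<notin> bad q" for q i
    proof -
      obtain x where x: "x \<in> X" "\<beta> x = \<beta>' x"
        and eq: "(\<lambda>f\<in>F. m q (coset_sofic G f i)) = (\<lambda>f\<in>F. \<alpha> (shift G f x))"
        using i by (auto simp: bad_def \<G>_def)
      have eqf: "m q (coset_sofic G f i) = \<alpha> (shift G f x)" if "f \<in> F" for f
        using fun_cong[OF eq, of f] that by simp
      have "pullback (conf q) i v = x v" if v: "v \<in> V" for v
      proof -
        have vG: "v \<in> carrier G" using v Vf by auto
        have "m q (i #> v) = \<alpha> (shift G (inv v) x)"
          using eqf[of "inv v"] v vG by (simp add: F_def coset_sofic_def)
        then show ?thesis
          using vG D_translate[OF i(1) vG] X_K[OF x(1) vG] enc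
          by (simp add: pullback_apply conf_def \<alpha>_def shift_apply)
      qed
      moreover have "q i = \<beta>' x"
        using q_eq[OF q i(1)] eqf[of "\<one>"] x shift_one[OF X_extensional[OF x(1)]] D_translate_one[OF i(1)]
        by (simp add: F_def coset_sofic_def \<theta>\<alpha>)
      ultimately show ?thesis using x(1) by blast
    qed
    have "real (card ?Q) \<le> real (card (periodic_configs H)) *
      (\<Sum>S | S \<subseteq> D \<and> real (card S) \<le> \<eta> * real (card D). (real (card (carrier K)) ^ card V0 * real (card B)) ^ card S)"
    proof (rule coded_bound(2)[OF V0 B Bne, where conf = conf and bad = bad and data = "\<lambda>q. q"])
      fix q assume q: "q \<in> ?Q"
      show "conf q \<in> D \<rightarrow>\<^sub>E carrier K"
      proof (rule PiE_I)
        fix i assume i: "i \<in> D"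
        have "snd (prod_decode (m q i)) \<in> enc ` carrier K" using mA[OF q i] by (auto simp: A_def)
        then show "conf q i \<in> carrier K" using i by (simp add: conf_def inv_into_into)
      qed (simp add: conf_def)
      show "bad q \<subseteq> D" by (auto simp: bad_def)
      have "real (card (bad q))
          \<le> (measure \<mu> {x \<in> space \<mu>. (\<lambda>f\<in>F. \<alpha> (shift G f x)) \<notin> \<G>} + \<epsilon> * real (card (F \<rightarrow>\<^sub>E A))) * real (card D)"
        unfolding bad_def
      proof (rule meas_microstates_frequency[OF finite_index D_nonempty A F(1) m(1)[OF q]])
        show "coset_sofic G f i \<in> D" if "f \<in> F" "i \<in> D" for f i using that F coset_sofic_D by auto
        show "\<alpha> (shift G f x) \<in> A" if "f \<in> F" "x \<in> space \<mu>" for f x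
          using that F by (intro \<alpha>A X_shift) (auto simp: space_haar)
        show "{x \<in> space \<mu>. \<forall>f\<in>F. \<alpha> (shift G f x) = p f} \<in> sets \<mu>" if "p \<in> F \<rightarrow>\<^sub>E A" for p
          by (rule pattern_sets[OF \<alpha>_meas F that])
      qed (rule finite_measure_axioms)
      also have "\<dots> \<le> \<eta> * real (card D)"
        using good_measure \<epsilon>(2) by (intro mult_right_mono) auto
      finally show "real (card (bad q)) \<le> \<eta> * real (card D)" .
      show "legal V0 (conf q) i" if "i \<in> D" "i \<notin> bad q" for i
        using good[OF q that] unfolding legal_def V_def by blast
      show "q i \<in> B" if "i \<in> bad q" for i
      proof -
        have i: "i \<in> D" using that by (simp add: bad_def)
        show ?thesis using mA[OF q i] q_eq[OF q i] by (auto simp: A_def \<theta>_def)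
      qed
      fix q' assume q': "q' \<in> ?Q" and eq: "conf q = conf q'" "bad q = bad q'" "\<And>i. i \<in> bad q \<Longrightarrow> q i = q' i"
      show "q = q'"
      proof (rule extensionalityI[of _ D])
        show "q \<in> extensional D" "q' \<in> extensional D" using q q' by (auto simp: compose_def)
        fix i assume i: "i \<in> D"
        show "q i = q' i"
        proof (cases "i \<in> bad q")
          case False
          obtain x where x: "x \<in> X" "\<forall>v\<in>V. pullback (conf q) i v = x v" "q i = \<beta>' x"
            using good[OF q i False] by blast
          have False': "i \<notin> bad q'" using False eq(2) by simp
          obtain x' where x': "x' \<in> X" "\<forall>v\<in>V. pullback (conf q') i v = x' v" "q' i = \<beta>' x'"
            using good[OF q' i False'] by blast
          have "\<forall>v\<in>E. x v = x' v" using x(2) x'(2) eq(1) by (simp add: V_def)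
          then have "\<beta>' x = \<beta>' x'" using \<beta>'(1) x(1) x'(1) unfolding window_function_def by blast
          then show ?thesis using x(3) x'(3) by simp
        qed (rule eq(3))
      qed
    qed
    also have "\<dots> \<le> real (card (periodic_configs H)) * exp (\<epsilon>0 * real (card D))"
      using rate[rule_format, OF finite_index] by (intro mult_left_mono) (simp_all add: c_def)
    finally show ?thesis by (simp add: card_fixed)
  qed
  then show ?thesis
    using ref \<epsilon>(1) F
    by (intro exI[of _ A] exI[of _ \<alpha>] exI[of _ \<theta>] exI[of _ \<epsilon>] exI[of _ F] conjI allI impI) auto
qed

text \<open>The partition is the one by the identity coordinate, encoded in the natural numbers. An arbitrary
  refinement \<open>\<alpha>\<close> is replaced by a finite-window function \<open>\<alpha>'\<close> that refines the partition exactly: then the name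
  of a periodic configuration under \<open>\<alpha>'\<close> still determines the configuration, and by equidistribution it
  is a microstate for \<open>\<alpha>\<close> except for a proportion \<open>\<eta>\<close> of the configurations.\<close>
lemma meas_microstates_ge:
  assumes erg: "ergodic_action G (shift G) \<mu>"
    and enc: "inj_on enc (carrier K)"
    and ref: "(A, \<alpha>, \<theta>) \<in> finite_refinements \<mu> B (\<lambda>x. enc (x \<one>))"
    and \<epsilon>: "0 < \<epsilon>" and F: "finite F" "F \<subseteq> carrier G" and \<eta>: "0 < \<eta>"
  shows "\<exists>E'. finite E' \<and> E' \<subseteq> carrier G \<and>
    (\<forall>H. finite_quotient G K X H \<longrightarrow> patterns E' (fixed_points G H X) = patterns E' X \<longrightarrow>
      (1 - \<eta>) * real (card (fixed_points G H X)) \<le>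
      real (card (compose (rcosets H) \<theta> ` meas_microstates (shift G) \<mu> A \<alpha> F \<epsilon> (rcosets H) (coset_sofic G))))"
proof -
  have A: "finite A" and \<alpha>: "\<alpha> \<in> measurable \<mu> (count_space A)"
    and \<theta>: "\<And>x. x \<in> X \<Longrightarrow> \<theta> (\<alpha> x) = enc (x \<one>)"
    using ref by (simp_all add: finite_refinements_def space_haar)
  have "window_function {\<one>} (\<lambda>x. enc (x \<one>))" by (simp add: window_function_def)
  from window_function_approx[OF A \<alpha> this \<theta>, of "\<epsilon> / (2 * (real (card F) + 1))"] \<epsilon>
  obtain E \<alpha>' where \<alpha>': "window_function E \<alpha>'" "\<And>x. x \<in> X \<Longrightarrow> \<alpha>' x \<in> A" "\<And>x. x \<in> X \<Longrightarrow> \<theta> (\<alpha>' x) = enc (x \<one>)"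
    "measure \<mu> {x \<in> X. \<alpha> x \<noteq> \<alpha>' x} \<le> \<epsilon> / (2 * (real (card F) + 1))" by auto
  have E: "finite E" "E \<subseteq> carrier G" using \<alpha>'(1) by (auto simp: window_function_def)
  have \<alpha>'_meas: "\<alpha>' \<in> measurable \<mu> (count_space A)" by (rule window_function_measurable[OF \<alpha>'(1,2)])
  define Y where "Y p = {x \<in> X. \<forall>f\<in>F. \<alpha> (shift G f x) = p f}" for p
  define Y' where "Y' p = {x \<in> X. \<forall>f\<in>F. \<alpha>' (shift G f x) = p f}" for p
  define W where "W = (\<Union>f\<in>F. translate (inv f) E)"
  have W: "finite W" "W \<subseteq> carrier G" using E F by (auto simp: W_def)
  have Y'_det: "determined_by X W (Y' p)" for p
    unfolding determined_by_def
  proof (intro conjI ballI impI)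
    fix x y assume x: "x \<in> Y' p" and y: "y \<in> X" and eq: "\<forall>e\<in>W. x e = y e"
    have "\<alpha>' (shift G f y) = p f" if f: "f \<in> F" for f
    proof -
      have fG: "f \<in> carrier G" using f F by auto
      have "\<forall>e\<in>E. shift G f x e = shift G f y e"
        using eq f E by (auto simp: W_def shift_apply subset_iff)
      moreover have "shift G f x \<in> X" "shift G f y \<in> X" using x y X_shift[OF fG] by (auto simp: Y'_def)
      ultimately have "\<alpha>' (shift G f x) = \<alpha>' (shift G f y)" using \<alpha>'(1) unfolding window_function_def by blast
      then show ?thesis using x f by (simp add: Y'_def)
    qed
    then show "y \<in> Y' p" using y by (simp add: Y'_def)
  qed (auto simp: Y'_def)
  let ?C = "Y' ` (F \<rightarrow>\<^sub>E A)"
  have "finite ?C" using A F by (auto intro: finite_PiE)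
  have half: "0 < \<epsilon> / 2" using \<epsilon> by simp
  have "\<exists>E'. finite E' \<and> E' \<subseteq> carrier G \<and>
    (\<forall>H. finite_quotient G K X H \<longrightarrow> patterns E' (fixed_points G H X) = patterns E' X \<longrightarrow>
      real (card {a \<in> periodic_configs H. \<exists>C\<in>?C. \<epsilon> / 2 < \<bar>visit_frequency H a C - measure \<mu> C\<bar>})
        \<le> \<eta> * real (card (periodic_configs H)))"
    by (rule equidistribution_family[OF erg \<open>finite ?C\<close> W _ half \<eta>]) (use Y'_det in auto)
  then obtain E' where E': "finite E'" "E' \<subseteq> carrier G" and equi:
    "\<forall>H. finite_quotient G K X H \<longrightarrow> patterns E' (fixed_points G H X) = patterns E' X \<longrightarrow>
      real (card {a \<in> periodic_configs H. \<exists>C\<in>?C. \<epsilon> / 2 < \<bar>visit_frequency H a C - measure \<mu> C\<bar>})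
        \<le> \<eta> * real (card (periodic_configs H))" by (elim exE conjE)
  have dif_sets: "{x \<in> X. \<alpha> x \<noteq> \<alpha>' x} \<in> sets \<mu>"
  proof -
    have "{x \<in> X. \<alpha> x \<noteq> \<alpha>' x} = (\<Union>b\<in>A. (\<alpha> -` {b} \<inter> space \<mu>) \<inter> {x \<in> X. \<alpha>' x \<in> - {b}})"
      using measurable_space[OF \<alpha>] by (auto simp: space_haar)
    moreover have "(\<alpha> -` {b} \<inter> space \<mu>) \<inter> {x \<in> X. \<alpha>' x \<in> - {b}} \<in> sets \<mu>" if "b \<in> A" for b
      using measurable_sets[OF \<alpha>, of "{b}"] that
        determined_sets[OF E window_function_determined[OF \<alpha>'(1), of "- {b}"]] by auto
    ultimately show ?thesis using A by auto
  qed
  have YY': "\<bar>measure \<mu> (Y p) - measure \<mu> (Y' p)\<bar> \<le> \<epsilon> / 2" if p: "p \<in> F \<rightarrow>\<^sub>E A" for p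
  proof -
    have sets: "Y p \<in> sets \<mu>" "Y' p \<in> sets \<mu>"
      using pattern_sets[OF \<alpha> F p] pattern_sets[OF \<alpha>'_meas F p] by (simp_all add: Y_def Y'_def space_haar)
    define N where "N f = {x \<in> X. shift G f x \<in> {x \<in> X. \<alpha> x \<noteq> \<alpha>' x}}" for f
    have N_sets: "N f \<in> sets \<mu>" if "f \<in> F" for f
    proof -
      have "f \<in> carrier G" using that F by auto
      moreover have "N f = shift G f -` {x \<in> X. \<alpha> x \<noteq> \<alpha>' x} \<inter> space \<mu>" by (auto simp: N_def space_haar)
      ultimately show ?thesis using measurable_sets[OF measurable_shift dif_sets] by simp
    qed
    have N_meas: "measure \<mu> (N f) \<le> \<epsilon> / (2 * (real (card F) + 1))" if "f \<in> F" for f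
      using haar_shift_invariant[OF _ dif_sets, of f] that F \<alpha>'(4) by (auto simp: N_def)
    have UN: "measure \<mu> (\<Union>f\<in>F. N f) \<le> \<epsilon> / 2"
    proof -
      have "measure \<mu> (\<Union>f\<in>F. N f) \<le> (\<Sum>f\<in>F. measure \<mu> (N f))"
        by (rule measure_UNION_le[OF F(1) N_sets])
      also have "\<dots> \<le> (\<Sum>f\<in>F. \<epsilon> / (2 * (real (card F) + 1)))" by (rule sum_mono[OF N_meas])
      also have "\<dots> \<le> \<epsilon> / 2" using \<epsilon> by (simp add: divide_simps)
      finally show ?thesis .
    qed
    have UN_sets: "(\<Union>f\<in>F. N f) \<in> sets \<mu>" using F(1) N_sets by auto
    have sub: "Y p \<subseteq> Y' p \<union> (\<Union>f\<in>F. N f)" "Y' p \<subseteq> Y p \<union> (\<Union>f\<in>F. N f)"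
      using F X_shift by (auto simp: Y_def Y'_def N_def subset_iff)
    have "measure \<mu> (Y p) \<le> measure \<mu> (Y' p) + measure \<mu> (\<Union>f\<in>F. N f)"
      by (rule order_trans[OF finite_measure_mono[OF sub(1)] measure_Un_le]) (use sets UN_sets in auto)
    moreover have "measure \<mu> (Y' p) \<le> measure \<mu> (Y p) + measure \<mu> (\<Union>f\<in>F. N f)"
      by (rule order_trans[OF finite_measure_mono[OF sub(2)] measure_Un_le]) (use sets UN_sets in auto)
    ultimately show ?thesis using UN by linarith
  qed
  have "(1 - \<eta>) * real (card (fixed_points G H X)) \<le>
      real (card (compose (rcosets H) \<theta> ` meas_microstates (shift G) \<mu> A \<alpha> F \<epsilon> (rcosets H) (coset_sofic G)))"
    if H: "finite_quotient G K X H" and pat: "patterns E' (fixed_points G H X) = patterns E' X" for H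
  proof -
    interpret finite_quotient G K X H by (rule H)
    let ?M = "meas_microstates (shift G) \<mu> A \<alpha> F \<epsilon> D (coset_sofic G)"
    let ?bad = "{a \<in> periodic_configs H. \<exists>C\<in>?C. \<epsilon> / 2 < \<bar>visit_frequency H a C - measure \<mu> C\<bar>}"
    define b where "b a = (\<lambda>i\<in>D. \<alpha>' (pullback a i))" for a
    have PX: "pullback a i \<in> X" if "a \<in> periodic_configs H" "i \<in> D" for a i
      using that by (auto simp: periodic_configs_def)
    have micro: "b a \<in> ?M" if a: "a \<in> periodic_configs H - ?bad" for a
      unfolding meas_microstates_def
    proof (intro CollectI conjI ballI)
      have aP: "a \<in> periodic_configs H" using a by blast
      show "b a \<in> D \<rightarrow>\<^sub>E A" using \<alpha>'(2)[OF PX[OF aP]] by (auto simp: b_def)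
      fix p assume p: "p \<in> F \<rightarrow>\<^sub>E A"
      have "(\<forall>f\<in>F. b a (coset_sofic G f i) = p f) \<longleftrightarrow> pullback a i \<in> Y' p" if i: "i \<in> D" for i
      proof -
        have "b a (coset_sofic G f i) = \<alpha>' (shift G f (pullback a i))" if "f \<in> F" for f
          using that F coset_sofic_D[OF i, of f] pullback_equivariant[OF i, of f] by (auto simp: b_def)
        then show ?thesis using PX[OF aP i] by (simp add: Y'_def)
      qed
      then have "{i \<in> D. \<forall>f\<in>F. b a (coset_sofic G f i) = p f} = {i \<in> D. pullback a i \<in> Y' p}" by blast
      then have freq: "real (card {i \<in> D. \<forall>f\<in>F. b a (coset_sofic G f i) = p f}) / real (card D)
          = visit_frequency H a (Y' p)" by (simp add: visit_frequency_def)
      have Yp: "{x \<in> space \<mu>. \<forall>f\<in>F. \<alpha> (shift G f x) = p f} = Y p" by (simp add: Y_def space_haar)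
      have "\<bar>visit_frequency H a (Y' p) - measure \<mu> (Y' p)\<bar> \<le> \<epsilon> / 2" using a p by (auto simp: not_less)
      then show "\<bar>measure \<mu> {x \<in> space \<mu>. \<forall>f\<in>F. \<alpha> (shift G f x) = p f}
          - real (card {i \<in> D. \<forall>f\<in>F. b a (coset_sofic G f i) = p f}) / real (card D)\<bar> \<le> \<epsilon>"
        unfolding freq Yp using YY'[OF p] by linarith
    qed
    have comp: "compose D \<theta> (b a) = (\<lambda>i\<in>D. enc (a i))" if a: "a \<in> periodic_configs H" for a
    proof -
      have "\<theta> (\<alpha>' (pullback a i)) = enc (a i)" if i: "i \<in> D" for i
        using \<alpha>'(3)[OF PX[OF a i]] D_translate_one[OF i] by (simp add: pullback_apply)
      then show ?thesis by (auto simp: compose_def b_def fun_eq_iff)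
    qed
    have inj: "inj_on (\<lambda>a. compose D \<theta> (b a)) (periodic_configs H)"
    proof (rule inj_onI)
      fix a a' assume a: "a \<in> periodic_configs H" "a' \<in> periodic_configs H"
        and eq: "compose D \<theta> (b a) = compose D \<theta> (b a')"
      show "a = a'"
      proof (rule extensionalityI[of _ D])
        show "a \<in> extensional D" "a' \<in> extensional D" using a by (auto simp: periodic_configs_def PiE_def)
        fix i assume i: "i \<in> D"
        have "enc (a i) = enc (a' i)" using fun_cong[OF eq, of i] i by (simp add: comp a)
        moreover have "a i \<in> carrier K" "a' i \<in> carrier K" using a i by (auto simp: periodic_configs_def)
        ultimately show "a i = a' i" using enc by (auto dest: inj_onD)
      qed
    qed
    have "finite ?M"
      by (rule finite_subset[of _ "D \<rightarrow>\<^sub>E A"]) (use A finite_index in \<open>auto simp: meas_microstates_def intro: finite_PiE\<close>)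
    have "card (periodic_configs H - ?bad) = card ((\<lambda>a. compose D \<theta> (b a)) ` (periodic_configs H - ?bad))"
      by (rule card_image[symmetric, OF inj_on_subset[OF inj]]) blast
    also have "\<dots> \<le> card (compose D \<theta> ` ?M)"
      using micro \<open>finite ?M\<close> by (intro card_mono finite_imageI) auto
    finally have le: "card (periodic_configs H - ?bad) \<le> card (compose D \<theta> ` ?M)" .
    have bad_sub: "?bad \<subseteq> periodic_configs H" by blast
    have "card (periodic_configs H - ?bad) = card (periodic_configs H) - card ?bad"
      by (rule card_Diff_subset[OF finite_subset[OF bad_sub periodic_configs_finite] bad_sub])
    then have "real (card (periodic_configs H)) - real (card ?bad) \<le> real (card (compose D \<theta> ` ?M))"
      using le by linarith
    moreover have "real (card ?bad) \<le> \<eta> * real (card (periodic_configs H))"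
      using equi H pat by blast
    ultimately show ?thesis by (simp add: card_fixed algebra_simps)
  qed
  then show ?thesis using E' by (intro exI[of _ E'] conjI allI impI) auto
qed

end

section \<open>Hausdorff convergence and finite windows\<close>

context alg_subshift
begin

text \<open>There are finitely many patterns on \<open>E\<close>, and the points showing a given one form an open set. A ball
  around a representative stays inside it, and meets the fixed points once they are close to \<open>X\<close>. The
  metric is bounded by compactness, so the suprema in the Hausdorff distance are genuine.\<close>
lemma hausdorff_patterns:
  assumes d: "Metric_space (carrier (full_shift G K)) d"
    and top: "Metric_space.mtopology (carrier (full_shift G K)) d = full_shift_top G K"
    and E: "finite E" "E \<subseteq> carrier G"
  shows "\<exists>r>0. \<forall>H. finite_quotient G K X H \<longrightarrow> hausdorff_dist d (fixed_points G H X) X < r \<longrightarrow>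
    patterns E (fixed_points G H X) = patterns E X"
proof -
  interpret d: Metric_space "carrier (full_shift G K)" d by (rule d)
  have XM: "X \<subseteq> carrier (full_shift G K)" using X_sub by (simp add: full_carrier)
  have "compactin d.mtopology (carrier (full_shift G K))"
    unfolding top using compact_full by (simp only: compact_space_def topspace_full full_carrier)
  then have "d.mbounded (carrier (full_shift G K))" by (rule d.compactin_imp_mbounded)
  then obtain b where b: "\<And>x y. \<lbrakk>x \<in> X; y \<in> X\<rbrakk> \<Longrightarrow> d x y \<le> b"
    unfolding d.mbounded_alt using XM by blast
  have "\<forall>x\<in>X. \<exists>r>0. \<forall>y\<in>X. d y x < r \<longrightarrow> (\<forall>e\<in>E. y e = x e)"
  proof
    fix x assume x: "x \<in> X"
    have "openin TX {y \<in> X. \<forall>e\<in>E. y e = x e}"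
      by (rule openin_determined[OF E]) (auto simp: determined_by_def)
    then obtain S where S: "openin (full_shift_top G K) S" "{y \<in> X. \<forall>e\<in>E. y e = x e} = S \<inter> X"
      by (auto simp: openin_subtopology)
    have "x \<in> S" using S(2) x by blast
    then obtain r where r: "r > 0" "d.mball x r \<subseteq> S"
      using S(1) unfolding top[symmetric] d.openin_mtopology by blast
    have "\<forall>e\<in>E. y e = x e" if "y \<in> X" "d y x < r" for y
    proof -
      have "y \<in> d.mball x r" using that x XM d.commute by auto
      then show ?thesis using r(2) S(2) that(1) by blast
    qed
    then show "\<exists>r>0. \<forall>y\<in>X. d y x < r \<longrightarrow> (\<forall>e\<in>E. y e = x e)" using r(1) by blast
  qed
  from bchoice[OF this] obtain R where R: "\<forall>x\<in>X. 0 < R x \<and> (\<forall>y\<in>X. d y x < R x \<longrightarrow> (\<forall>e\<in>E. y e = x e))" ..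
  have "\<forall>p\<in>patterns E X. \<exists>x. x \<in> X \<and> p = restrict x E" by (auto simp: patterns_def)
  from bchoice[OF this] obtain rep where rep: "\<forall>p\<in>patterns E X. rep p \<in> X \<and> p = restrict (rep p) E" ..
  define r where "r = Min (insert 1 ((\<lambda>p. R (rep p)) ` patterns E X))"
  have fin: "finite (insert 1 ((\<lambda>p. R (rep p)) ` patterns E X))" using patterns_finite[OF E] by simp
  have r: "0 < r" unfolding r_def using fin R rep by (subst Min_gr_iff) auto
  have r_le: "r \<le> R (rep p)" if "p \<in> patterns E X" for p
    unfolding r_def using fin that by (intro Min_le) auto
  have "patterns E (fixed_points G H X) = patterns E X"
    if H: "finite_quotient G K X H" and close: "hausdorff_dist d (fixed_points G H X) X < r" for H
  proof
    let ?Z = "fixed_points G H X"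
    have ZX: "?Z \<subseteq> X" by (auto simp: fixed_points_def)
    have Zne: "?Z \<noteq> {}" by (rule finite_quotient.fixed_nonempty[OF H])
    show "patterns E ?Z \<subseteq> patterns E X" using ZX by (auto simp: patterns_def)
    show "patterns E X \<subseteq> patterns E ?Z"
    proof
      fix p assume p: "p \<in> patterns E X"
      define x where "x = rep p"
      have x: "x \<in> X" "p = restrict x E" using rep p by (auto simp: x_def)
      have bdd: "bdd_below ((\<lambda>z. d z y) ` ?Z)" for y by (rule bdd_belowI2[of _ 0]) simp
      obtain z0 where z0: "z0 \<in> ?Z" using Zne by blast
      have "bdd_above ((\<lambda>y. INF z\<in>?Z. d z y) ` X)"
      proof (rule bdd_aboveI2)
        fix y assume "y \<in> X"
        then show "(INF z\<in>?Z. d z y) \<le> b" using cINF_lower[OF bdd z0, of y] b[of z0 y] z0 ZX by auto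
      qed
      then have "(INF z\<in>?Z. d z x) \<le> (SUP y\<in>X. INF z\<in>?Z. d z y)" using x(1) by (rule cSUP_upper[rotated])
      also have "\<dots> < r" using close by (simp add: hausdorff_dist_def)
      finally obtain z where z: "z \<in> ?Z" "d z x < r" using cInf_lessD[of "(\<lambda>z. d z x) ` ?Z" r] Zne by auto
      then have "d z x < R x" using r_le[OF p] by (simp add: x_def)
      then have "\<forall>e\<in>E. z e = x e" using R x(1) z(1) ZX by blast
      then have "p = restrict z E" by (simp add: x(2) restrict_eq_iff)
      then show "p \<in> patterns E ?Z" using z(1) by (auto simp: patterns_def)
    qed
  qed
  then show ?thesis using r by (intro exI[of _ r] conjI allI impI) auto
qed

end

section \<open>Exponential growth rates\<close>

lemma log_card_rate_le:
  assumes c: "c \<le> enat k" and k: "real k \<le> f * exp (\<epsilon> * m)" and f: "0 < f" and m: "0 < m"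
  shows "log_card c / ereal m \<le> ereal (1 / m * ln f) + ereal \<epsilon>"
proof -
  obtain j where j: "c = enat j" "j \<le> k" using c by (cases c) auto
  show ?thesis
  proof (cases "j = 0")
    case True
    then show ?thesis using m by (simp add: log_card_def j)
  next
    case False
    have "ln (real j) \<le> ln (f * exp (\<epsilon> * m))" using False j(2) k f by (subst ln_le_cancel_iff) auto
    also have "\<dots> = ln f + \<epsilon> * m" using f by (simp add: ln_mult)
    finally have "ln (real j) / m \<le> ln f / m + \<epsilon>" using m by (simp add: divide_simps)
    then show ?thesis using False m by (simp add: log_card_def j)
  qed
qed

text \<open>Since \<open>ln q \<le> 0\<close> and \<open>m \<ge> 1\<close>, the factor \<open>q\<close> costs at most \<open>- ln q\<close> in the rate.\<close>
lemma log_card_rate_ge: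
  assumes c: "enat j \<le> c" and j: "q * f \<le> real j" and q: "0 < q" "q \<le> 1" and f: "0 < f" and m: "1 \<le> m"
  shows "ereal (1 / m * ln f) + ereal (ln q) \<le> log_card c / ereal m"
proof (cases c)
  case (enat i)
  have ji: "j \<le> i" using c enat by simp
  have qf: "0 < q * f" using q f by simp
  have i: "q * f \<le> real i" using j ji by (meson of_nat_mono order_trans)
  then have i0: "i \<noteq> 0" using qf by auto
  have "ln q * m \<le> ln q * 1" using q m by (intro mult_left_mono_neg) auto
  then have "ln q \<le> ln q / m" using m by (simp add: divide_simps)
  then have "1 / m * ln f + ln q \<le> (ln f + ln q) / m" using m by (simp add: add_divide_distrib)
  also have "ln f + ln q = ln (q * f)" using q f by (simp add: ln_mult)
  also have "ln (q * f) / m \<le> ln (real i) / m" using i qf m by (intro divide_right_mono) auto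
  finally show ?thesis using i0 m by (simp add: enat log_card_def)
next
  case infinity
  then show ?thesis using m by (simp add: log_card_def)
qed

section \<open>The two entropies\<close>

locale quotient_sequence = haar_subshift G K X \<mu>
  for G :: "('g, 'm) monoid_scheme" (structure) and K :: "('k, 'l) monoid_scheme" and X :: "('g \<Rightarrow> 'k) set"
    and \<mu> :: "('g \<Rightarrow> 'k) measure" +
  fixes N :: "nat \<Rightarrow> 'g set"
  assumes finite_type: "finite_type G K X"
    and quotients: "\<And>n. finite_quotient G K X (N n)"
begin

abbreviation D :: "nat \<Rightarrow> 'g set set" where "D n \<equiv> rcosets (N n)"
abbreviation index :: "nat \<Rightarrow> real" where "index n \<equiv> real (card (D n))"
abbreviation periodic :: "nat \<Rightarrow> real" where "periodic n \<equiv> real (card (fixed_points G (N n) X))"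

abbreviation separated_count :: "(('g \<Rightarrow> 'k) \<Rightarrow> ('g \<Rightarrow> 'k) \<Rightarrow> real) \<Rightarrow> real \<Rightarrow> real \<Rightarrow> 'g set \<Rightarrow> nat \<Rightarrow> enat" where
  "separated_count \<rho> \<kappa> \<delta> F n \<equiv>
     max_separated (rho_inf \<rho> (D n)) \<kappa> (top_microstates (shift G) X \<rho> F \<delta> (D n) (coset_sofic G))"

abbreviation name_count :: "nat set \<Rightarrow> (('g \<Rightarrow> 'k) \<Rightarrow> nat) \<Rightarrow> (nat \<Rightarrow> nat) \<Rightarrow> real \<Rightarrow> 'g set \<Rightarrow> nat \<Rightarrow> nat" where
  "name_count A \<alpha> \<theta> \<epsilon> F n \<equiv>
     card (compose (D n) \<theta> ` meas_microstates (shift G) \<mu> A \<alpha> F \<epsilon> (D n) (coset_sofic G))"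

definition periodic_growth :: ereal where
  "periodic_growth = limsup (\<lambda>n. ereal (1 / index n
                                * ln (periodic n)))"

lemma card_cosets_ge_1: "1 \<le> index n"
  using finite_quotient.card_D_pos[OF quotients[of n]] by (simp add: Suc_le_eq)

lemma card_fixed_pos: "0 < periodic n"
  using finite_quotient.finite_fixed[OF quotients[of n]] finite_quotient.fixed_nonempty[OF quotients[of n]]
  by (simp add: card_gt_0_iff)

lemma limsup_rate_le:
  assumes c: "\<And>n. c n \<le> enat (k n)"
    and k: "\<And>n. real (k n) \<le> periodic n * exp (\<epsilon> * index n)"
  shows "limsup (\<lambda>n. log_card (c n) / ereal (index n)) \<le> periodic_growth + ereal \<epsilon>"
proof -
  have "limsup (\<lambda>n. log_card (c n) / ereal (index n))
      \<le> limsup (\<lambda>n. ereal (1 / index n * ln (periodic n)) + ereal \<epsilon>)"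
  proof (rule Limsup_mono, rule always_eventually, rule allI)
    fix n
    show "log_card (c n) / ereal (index n)
        \<le> ereal (1 / index n * ln (periodic n)) + ereal \<epsilon>"
      using card_cosets_ge_1[of n] by (intro log_card_rate_le[OF c k card_fixed_pos]) linarith
  qed
  also have "\<dots> = periodic_growth + ereal \<epsilon>"
    unfolding periodic_growth_def by (rule Limsup_add_ereal_right) auto
  finally show ?thesis .
qed

lemma limsup_rate_ge:
  assumes c: "\<And>n. enat (j n) \<le> c n" and q: "0 < q" "q \<le> 1"
    and j: "\<forall>\<^sub>F n in sequentially. q * periodic n \<le> real (j n)"
  shows "periodic_growth + ereal (ln q) \<le> limsup (\<lambda>n. log_card (c n) / ereal (index n))"
proof -
  have "periodic_growth + ereal (ln q) = limsup (\<lambda>n. ereal (1 / index n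
        * ln (periodic n)) + ereal (ln q))"
    unfolding periodic_growth_def by (rule Limsup_add_ereal_right[symmetric]) auto
  also have "\<dots> \<le> limsup (\<lambda>n. log_card (c n) / ereal (index n))"
    by (rule Limsup_mono, rule eventually_mono[OF j])
      (rule log_card_rate_ge[OF c _ q card_fixed_pos card_cosets_ge_1])
  finally show ?thesis .
qed

lemma top_sofic_entropy_eq:
  assumes \<rho>: "continuous_generating_pseudometric G (shift G) TX \<rho>"
  shows "top_sofic_entropy G (shift G) X \<rho> (\<lambda>n. D n) (\<lambda>n. coset_sofic G) = periodic_growth"
proof (rule antisym)
  obtain V where V: "window_rule V" using finite_type_window_rule[OF finite_type] by blast
  show "top_sofic_entropy G (shift G) X \<rho> (\<lambda>n. D n) (\<lambda>n. coset_sofic G) \<le> periodic_growth"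
    unfolding top_sofic_entropy_def
  proof (rule SUP_least, rule ereal_le_epsilon2)
    fix \<kappa> \<epsilon> :: real assume "\<kappa> \<in> {0<..}" and \<epsilon>: "0 < \<epsilon>"
    then have \<kappa>: "0 < \<kappa>" by simp
    from top_microstates_bound[OF \<rho> V \<kappa> \<epsilon>] obtain \<delta> F where \<delta>: "0 < \<delta>" and F: "finite F" "F \<subseteq> carrier G"
      and bound: "\<forall>H. finite_quotient G K X H \<longrightarrow>
        (\<forall>S. S \<subseteq> top_microstates (shift G) X \<rho> F \<delta> (rcosets H) (coset_sofic G) \<longrightarrow>
          (\<forall>\<phi>\<in>S. \<forall>\<psi>\<in>S. \<phi> \<noteq> \<psi> \<longrightarrow> \<kappa> \<le> rho_inf \<rho> (rcosets H) \<phi> \<psi>) \<longrightarrow>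
          real (card S) \<le> real (card (fixed_points G H X)) * exp (\<epsilon> * real (card (rcosets H))))"
      by (elim exE conjE)
    define k where "k n = nat \<lfloor>periodic n * exp (\<epsilon> * index n)\<rfloor>" for n
    have "limsup (\<lambda>n. log_card (separated_count \<rho> \<kappa> \<delta> F n)
        / ereal (index n)) \<le> periodic_growth + ereal \<epsilon>"
    proof (rule limsup_rate_le)
      fix n
      show "real (k n) \<le> periodic n * exp (\<epsilon> * index n)"
        unfolding k_def by (rule of_nat_floor) simp
      show "separated_count \<rho> \<kappa> \<delta> F n \<le> enat (k n)"
        unfolding max_separated_def
      proof (rule SUP_least)
        fix S assume "S \<in> {S. S \<subseteq> top_microstates (shift G) X \<rho> F \<delta> (D n) (coset_sofic G) \<and>
          finite S \<and> (\<forall>\<phi>\<in>S. \<forall>\<psi>\<in>S. \<phi> \<noteq> \<psi> \<longrightarrow> \<kappa> \<le> rho_inf \<rho> (D n) \<phi> \<psi>)}"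
        then have "real (card S) \<le> periodic n * exp (\<epsilon> * index n)"
          using bound[rule_format, OF quotients] by simp
        then show "enat (card S) \<le> enat (k n)" by (simp add: k_def le_nat_floor)
      qed
    qed
    then show "(INF \<delta>\<in>{0<..}. INF F\<in>{F. finite F \<and> F \<subseteq> carrier G}.
        limsup (\<lambda>n. log_card (separated_count \<rho> \<kappa> \<delta> F n)
          / ereal (index n))) \<le> periodic_growth + ereal \<epsilon>"
      by (rule INF_lower2[of \<delta>, OF _ INF_lower2[of F], rotated -1]) (use \<delta> F in auto)
  qed
  show "periodic_growth \<le> top_sofic_entropy G (shift G) X \<rho> (\<lambda>n. D n) (\<lambda>n. coset_sofic G)"
  proof -
    obtain F0 \<kappa> where F0: "F0 \<subseteq> carrier G" and \<kappa>: "0 < \<kappa>"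
      and sep: "\<And>x y. \<lbrakk>x \<in> X; y \<in> X; x \<one> \<noteq> y \<one>\<rbrakk> \<Longrightarrow> \<exists>g\<in>F0. \<kappa> \<le> \<rho> (shift G g x) (shift G g y)"
      using generating_separation[OF \<rho>] by metis
    show ?thesis
      unfolding top_sofic_entropy_def
    proof (rule SUP_upper2[of \<kappa>], simp add: \<kappa>, intro INF_greatest)
      fix \<delta> :: real and F :: "'g set" assume "\<delta> \<in> {0<..}" "F \<in> {F. finite F \<and> F \<subseteq> carrier G}"
      then have \<delta>: "0 < \<delta>" and F: "F \<subseteq> carrier G" by auto
      have "periodic_growth + ereal (ln 1) \<le> limsup (\<lambda>n. log_card (separated_count \<rho> \<kappa> \<delta> F n) / ereal (index n))"
        by (rule limsup_rate_ge[OF finite_quotient.max_separated_ge_fixed[OF quotients \<rho> F0 sep F \<delta>]]) simp_all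
      then show "periodic_growth \<le> limsup (\<lambda>n. log_card (separated_count \<rho> \<kappa> \<delta> F n) / ereal (index n))"
        by simp
    qed
  qed
qed

lemma meas_sofic_entropy_le:
  "meas_sofic_entropy G (shift G) \<mu> (\<lambda>n. D n) (\<lambda>n. coset_sofic G) \<le> periodic_growth"
  unfolding meas_sofic_entropy_def
proof (rule SUP_least, rule ereal_le_epsilon2)
  fix B\<beta> :: "nat set \<times> (('g \<Rightarrow> 'k) \<Rightarrow> nat)" and \<epsilon>0 :: real
  assume "B\<beta> \<in> {(B, \<beta>). finite B \<and> \<beta> \<in> measurable \<mu> (count_space B)}" and \<epsilon>0: "0 < \<epsilon>0"
  then obtain B \<beta> where B\<beta>: "B\<beta> = (B, \<beta>)" and B: "finite B" and \<beta>: "\<beta> \<in> measurable \<mu> (count_space B)" by auto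
  obtain V where V: "window_rule V" using finite_type_window_rule[OF finite_type] by blast
  from meas_microstates_bound[OF V B \<beta> \<epsilon>0] obtain A \<alpha> \<theta> \<epsilon> F
    where ref: "(A, \<alpha>, \<theta>) \<in> finite_refinements \<mu> B \<beta>" and \<epsilon>: "0 < \<epsilon>" and F: "finite F" "F \<subseteq> carrier G"
    and bound: "\<forall>H. finite_quotient G K X H \<longrightarrow>
      real (card (compose (rcosets H) \<theta> ` meas_microstates (shift G) \<mu> A \<alpha> F \<epsilon> (rcosets H) (coset_sofic G)))
        \<le> real (card (fixed_points G H X)) * exp (\<epsilon>0 * real (card (rcosets H)))"
    by (elim exE conjE)
  have *: "limsup (\<lambda>n. log_card (enat (name_count A \<alpha> \<theta> \<epsilon> F n))
      / ereal (index n)) \<le> periodic_growth + ereal \<epsilon>0"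
    by (rule limsup_rate_le[OF order_refl bound[rule_format, OF quotients]])
  have "(INF (A, \<alpha>, \<theta>)\<in>finite_refinements \<mu> B \<beta>. INF \<epsilon>\<in>{0<..}. INF F\<in>{F. finite F \<and> F \<subseteq> carrier G}.
      limsup (\<lambda>n. log_card (enat (name_count A \<alpha> \<theta> \<epsilon> F n))
        / ereal (index n))) \<le> periodic_growth + ereal \<epsilon>0"
    by (rule INF_lower2[OF ref], unfold prod.case, rule INF_lower2[of \<epsilon>], simp add: \<epsilon>, rule INF_lower2[of F])
      (use F * in auto)
  then show "(case B\<beta> of (B, \<beta>) \<Rightarrow> INF (A, \<alpha>, \<theta>)\<in>finite_refinements \<mu> B \<beta>. INF \<epsilon>\<in>{0<..}. INF F\<in>{F. finite F \<and> F \<subseteq> carrier G}.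
      limsup (\<lambda>n. log_card (enat (name_count A \<alpha> \<theta> \<epsilon> F n))
        / ereal (index n))) \<le> periodic_growth + ereal \<epsilon>0"
    by (simp only: B\<beta> prod.case)
qed

lemma meas_sofic_entropy_ge:
  assumes erg: "ergodic_action G (shift G) \<mu>"
    and windows: "\<And>E. \<lbrakk>finite E; E \<subseteq> carrier G\<rbrakk> \<Longrightarrow>
      \<forall>\<^sub>F n in sequentially. patterns E (fixed_points G (N n) X) = patterns E X"
  shows "periodic_growth \<le> meas_sofic_entropy G (shift G) \<mu> (\<lambda>n. D n) (\<lambda>n. coset_sofic G)"
proof -
  define enc where "enc = to_nat_on (carrier K)"
  have enc: "inj_on enc (carrier K)" unfolding enc_def by (intro inj_on_to_nat_on countable_finite finite_K)
  define B where "B = enc ` carrier K"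
  define \<beta> where "\<beta> = (\<lambda>x :: 'g \<Rightarrow> 'k. enc (x \<one>))"
  have "\<beta> \<in> measurable \<mu> (count_space B)"
    by (rule window_function_measurable[of "{\<one>}"]) (auto simp: window_function_def \<beta>_def B_def X_K)
  then have B\<beta>: "(B, \<beta>) \<in> {(B, \<beta>). finite B \<and> \<beta> \<in> measurable \<mu> (count_space B)}"
    using finite_K by (simp add: B_def)
  show ?thesis
    unfolding meas_sofic_entropy_def
  proof (rule SUP_upper2[OF B\<beta>], unfold prod.case, intro INF_greatest)
    fix r assume r: "r \<in> finite_refinements \<mu> B \<beta>"
    obtain A \<alpha> \<theta> where r_eq: "r = (A, \<alpha>, \<theta>)" by (cases r) auto
    have ref: "(A, \<alpha>, \<theta>) \<in> finite_refinements \<mu> B (\<lambda>x. enc (x \<one>))" using r by (simp add: r_eq \<beta>_def)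
    have "periodic_growth \<le> limsup (\<lambda>n. log_card (enat (name_count A \<alpha> \<theta> \<epsilon> F n))
        / ereal (index n))" (is "_ \<le> ?L")
      if \<epsilon>: "0 < \<epsilon>" and F: "finite F" "F \<subseteq> carrier G" for \<epsilon> F
    proof (rule ereal_le_epsilon2)
      \<comment> \<open>A proportion \<open>exp (- e)\<close> of good configurations costs \<open>e\<close> in the rate.\<close>
      fix e :: real assume e: "0 < e"
      have "0 < 1 - exp (- e)" using e by simp
      from meas_microstates_ge[OF erg enc ref \<epsilon> F this] obtain E' where E': "finite E'" "E' \<subseteq> carrier G"
        and bound: "\<forall>H. finite_quotient G K X H \<longrightarrow> patterns E' (fixed_points G H X) = patterns E' X \<longrightarrow>
          (1 - (1 - exp (- e))) * real (card (fixed_points G H X)) \<le>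
          real (card (compose (rcosets H) \<theta> ` meas_microstates (shift G) \<mu> A \<alpha> F \<epsilon> (rcosets H) (coset_sofic G)))"
        by (elim exE conjE)
      have ev: "\<forall>\<^sub>F n in sequentially. exp (- e) * periodic n \<le>
          real (name_count A \<alpha> \<theta> \<epsilon> F n)"
        by (rule eventually_mono[OF windows[OF E']]) (use bound[rule_format, OF quotients] in simp)
      have "periodic_growth + ereal (ln (exp (- e))) \<le> ?L"
        by (rule limsup_rate_ge[OF order_refl _ _ ev]) (use e in simp_all)
      then show "periodic_growth \<le> ?L + ereal e"
        by (cases periodic_growth; cases "?L") (simp_all)
    qed
    then show "(case r of (A, \<alpha>, \<theta>) \<Rightarrow> INF \<epsilon>\<in>{0<..}. INF F\<in>{F. finite F \<and> F \<subseteq> carrier G}.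
        limsup (\<lambda>n. log_card (enat (name_count A \<alpha> \<theta> \<epsilon> F n))
          / ereal (index n))) \<ge> periodic_growth"
      unfolding r_eq prod.case by (intro INF_greatest) auto
  qed
qed

end

theorem corollary8p5:
  fixes G :: "('g, 'm) monoid_scheme"
    and K :: "('k, 'l) monoid_scheme"
    and N :: "nat \<Rightarrow> 'g set"
    and X :: "('g \<Rightarrow> 'k) set"
    and haar :: "('g \<Rightarrow> 'k) measure"
    and d \<rho> :: "('g \<Rightarrow> 'k) \<Rightarrow> ('g \<Rightarrow> 'k) \<Rightarrow> real"
  assumes "group G" and "countable (carrier G)" and "residually_finite G"
    and "\<And>n. N n \<lhd> G"
    and "\<And>n. finite (rcosets\<^bsub>G\<^esub> (N n))"
    and "\<And>n. N (Suc n) \<subseteq> N n"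
    and "(\<Inter>n. N n) = {\<one>\<^bsub>G\<^esub>}"
    and "group K" and "finite (carrier K)"
    and "algebraic_subshift G K X" and "finite_type G K X"
    and "haar_probability G K X haar"
    and "Metric_space (carrier (full_shift G K)) d"
    and "Metric_space.mtopology (carrier (full_shift G K)) d = full_shift_top G K"
    and "(\<lambda>n. hausdorff_dist d (fixed_points G (N n) X) X) \<longlonglongrightarrow> 0"
    and "ergodic_action G (shift G) haar"
    and "continuous_generating_pseudometric G (shift G) (subtopology (full_shift_top G K) X) \<rho>"
  shows "meas_sofic_entropy G (shift G) haar (\<lambda>n. rcosets\<^bsub>G\<^esub> (N n)) (\<lambda>n. coset_sofic G)
           = top_sofic_entropy G (shift G) X \<rho> (\<lambda>n. rcosets\<^bsub>G\<^esub> (N n)) (\<lambda>n. coset_sofic G)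
       \<and> top_sofic_entropy G (shift G) X \<rho> (\<lambda>n. rcosets\<^bsub>G\<^esub> (N n)) (\<lambda>n. coset_sofic G)
           = limsup (\<lambda>n. ereal (1 / real (card (rcosets\<^bsub>G\<^esub> (N n)))
                                * ln (real (card (fixed_points G (N n) X)))))"
proof -
  interpret G: group G by (rule assms(1))
  interpret K: group K by (rule assms(8))
  interpret alg_subshift G K X
    by unfold_locales (rule assms(2), rule assms(9), rule assms(10))
  interpret haar_subshift G K X haar
    by unfold_locales (rule assms(12))
  have quot: "finite_quotient G K X (N n)" for n
    by (intro finite_quotient.intro finite_quotient_axioms.intro alg_subshift_axioms assms)
  interpret quotient_sequence G K X haar N
    by (intro quotient_sequence.intro quotient_sequence_axioms.intro haar_subshift_axioms assms(11) quot)
  have windows: "\<forall>\<^sub>F n in sequentially. patterns E (fixed_points G (N n) X) = patterns E X"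
    if E: "finite E" "E \<subseteq> carrier G" for E
  proof -
    from hausdorff_patterns[OF assms(13,14) E] obtain r where r: "0 < r"
      and pat: "\<forall>H. finite_quotient G K X H \<longrightarrow> hausdorff_dist d (fixed_points G H X) X < r \<longrightarrow>
        patterns E (fixed_points G H X) = patterns E X" by (elim exE conjE)
    have "\<forall>\<^sub>F n in sequentially. hausdorff_dist d (fixed_points G (N n) X) X < r"
      by (rule order_tendstoD(2)[OF assms(15) r])
    then show ?thesis by (rule eventually_mono) (rule pat[rule_format, OF quot])
  qed
  have "meas_sofic_entropy G (shift G) haar (\<lambda>n. rcosets\<^bsub>G\<^esub> (N n)) (\<lambda>n. coset_sofic G) = periodic_growth"
    by (rule antisym[OF meas_sofic_entropy_le meas_sofic_entropy_ge[OF assms(16) windows]])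
  then show ?thesis
    using top_sofic_entropy_eq[OF assms(17)] by (simp only: periodic_growth_def)
qed

end
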